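(* The functor $\mathcal{T}\colon\mathbf{Cat}(\mathcal{C})\to\mathbf{Mnd}_{\mathrm{co}}^{\mathrm{adj}}$, $\mathbb{D}\mapsto\mathcal{T}_{\mathbb{D}}$, factors through the faithful functor $\mathbf{ActMnd}(\mathcal{C})\hookrightarrow\mathbf{Mnd}_{\mathrm{co}}^{\mathrm{adj}}$ (via $\mathbb{D}\mapsto(D_0,\mathcal{T}_{\mathbb{D}},\alpha)$). Moreover, the resulting functor $\mathcal{T}\colon\mathbf{Cat}(\mathcal{C})\to\mathbf{ActMnd}(\mathcal{C})$ is part of an equivalence of categories $$\mathcal{T}\colon\mathbf{Cat}(\mathcal{C})\simeq\mathbf{ActMnd}(\mathcal{C})\colon\Psi.$$
   Context: $\mathcal{C}$ is a fixed category with finite limits. An internal category $\mathbb{D}$ in $\mathcal{C}$ consists of objects $D_0,D_1$, source and target maps $s,t\colon D_1\to D_0$, an identity map $i\colon D_0\to D_1$ and a composition map $\mathrm{comp}\colon D_1\times_{s,D_0,t}D_1\to D_1$, satisfying the usual axioms; $\mathbf{Cat}(\mathcal{C})$ is the category of internal categories and internal functors. Comorphisms of monads: a comorphism of monads $(\mathcal{E},T)\to(\mathcal{A},S)$ is a pair $(F,\chi)$ with $F\colon\mathcal{E}\to\mathcal{A}$ a functor and $\chi\colon FT\Rightarrow SF$ a natural transformation with $\chi\circ F\eta^T=\eta^SF$ and $\chi\circ F\mu^T=\mu^SF\circ S\chi\circ\chi T$. $\mathbf{Mnd}_{\mathrm{co}}^{\mathrm{adj}}$ is the category of monads and those comorphisms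 whose underlying functor $F$ is a left adjoint. The functor $\mathcal{T}\colon\mathbf{Cat}(\mathcal{C})\to\mathbf{Mnd}_{\mathrm{co}}^{\mathrm{adj}}$ sends $\mathbb{D}$ to the monad $\mathcal{T}_{\mathbb{D}}$ on $\mathcal{C}/D_0$ with $\mathcal{T}_{\mathbb{D}}(\gamma\colon X\to D_0)=(D_1\times_{s,D_0,\gamma}X\xrightarrow{\pi_1}D_1\xrightarrow{t}D_0)$, $\mathcal{T}_{\mathbb{D}}(f)=\mathrm{id}_{D_1}\times f$, unit $\eta^{\mathbb{D}}_\gamma=\langle i\gamma,\mathrm{id}_X\rangle$ and multiplication $D_1\times_{D_0}(D_1\times_{D_0}X)\cong(D_1\times_{D_0}D_1)\times_{D_0}X\xrightarrow{\mathrm{comp}\times\mathrm{id}}D_1\times_{D_0}X$. It sends an internal functor $F=(F_0,F_1)\colon\mathbb{D}\to\mathbb{E}$ to the comorphism $(F_0\circ-,\tau_F)$, where $F_0\circ-\colon\mathcal{C}/D_0\to\mathcal{C}/E_0$ is postcomposition and $(\tau_F)_\gamma=F_1\times\mathrm{id}_X\colon D_1\times_{D_0}X\to E_1\times_{E_0}X$. Each $\mathcal{T}_{\mathbb{D}}$ carries the natural transformation $\alpha\colon\mathrm{dom}\circ\mathcal{T}_{\mathbb{D}}\Rightarrow\mathrm{dom}$ with component at $\gamma\colon X\to D_0$ the second projection $\pi_2\colon D_1\times_{s,D_0,\gamma}X\to X$, where $\mathrm{dom}\colon\mathcal{C}/D_0\to\mathcal{C}$ is the domain functor. The category $\mathbf{ActMnd}(\mathcal{C})$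 (of generalized action monads): objects are triples $(D_0,T,\alpha)$ where $D_0\in\mathcal{C}$, $T$ is a monad on $\mathcal{C}/D_0$, and $\alpha\colon\mathrm{dom}\circ T\Rightarrow\mathrm{dom}$ is a cartesian natural transformation (all its naturality squares are pullbacks) such that $(\mathrm{dom},\alpha)$ is a comorphism of monads $(\mathcal{C}/D_0,T)\to(\mathcal{C},\mathrm{Id}_{\mathcal{C}})$. A morphism $(D_0,T,\alpha)\to(E_0,T',\beta)$ is a pair $(h,\lambda)$ where $h\colon D_0\to E_0$ is a morphism in $\mathcal{C}$ and $\lambda\colon(h\circ-)\circ T\Rightarrow T'\circ(h\circ-)$ is such that $(h\circ-,\lambda)$ is a comorphism of monads $T\to T'$ and $(\mathrm{dom},\beta)\circ(h\circ-,\lambda)=(\mathrm{dom},\alpha)$ as comorphisms, i.e. $\beta_{h\gamma}\circ\mathrm{dom}(\lambda_\gamma)=\alpha_\gamma$ for every $\gamma\in\mathcal{C}/D_0$. Composition is given by composing the morphisms of $\mathcal{C}$ and pasting the natural transformations; identities are $(\mathrm{id}_{D_0},\mathrm{id})$. The faithful functor to $\mathbf{Mnd}_{\mathrm{co}}^{\mathrm{adj}}$ sends $(D_0,T,\alpha)$ to $(\mathcal{C}/D_0,T)$ and $(h,\lambda)$ to $(h\circ-,\lambda)$. *)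

theory Defs
  imports "HOL-Library.FuncSet"
begin

text \<open>
  Categories are records with explicit carriers. Maps on carriers that enter into equality of
  functors or of natural transformations are required to be \<open>extensional\<close>, so that HOL equality
  of such data is equality on the carriers. Composition is written in applicative order:
  \<open>g \<odot>\<^bsub>C\<^esub> f\<close> is \<open>f\<close> followed by \<open>g\<close>.
\<close>

section \<open>Categories, functors and natural transformations\<close>

record ('o, 'm) cat =
  Obj :: "'o set"
  Arr :: "'m set"
  Dom :: "'m \<Rightarrow> 'o"
  Cod :: "'m \<Rightarrow> 'o"
  Ident :: "'o \<Rightarrow> 'm"
  Comp :: "'m \<Rightarrow> 'm \<Rightarrow> 'm"  (infixl "\<odot>\<index>" 70)

definition Hom :: "('o, 'm) cat \<Rightarrow> 'o \<Rightarrow> 'o \<Rightarrow> 'm set" where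
  "Hom C a b = {f \<in> Arr C. Dom C f = a \<and> Cod C f = b}"

locale category =
  fixes C :: "('o, 'm) cat" (structure)
  assumes dom_in_obj: "f \<in> Arr C \<Longrightarrow> Dom C f \<in> Obj C"
    and cod_in_obj: "f \<in> Arr C \<Longrightarrow> Cod C f \<in> Obj C"
    and ident_in_hom: "a \<in> Obj C \<Longrightarrow> Ident C a \<in> Hom C a a"
    and comp_in_hom: "f \<in> Hom C a b \<Longrightarrow> g \<in> Hom C b c \<Longrightarrow> g \<odot> f \<in> Hom C a c"
    and ident_comp: "f \<in> Hom C a b \<Longrightarrow> Ident C b \<odot> f = f"
    and comp_ident: "f \<in> Hom C a b \<Longrightarrow> f \<odot> Ident C a = f"
    and comp_assoc: "f \<in> Hom C a b \<Longrightarrow> g \<in> Hom C b c \<Longrightarrow> h \<in> Hom C c d \<Longrightarrow>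
          (h \<odot> g) \<odot> f = h \<odot> (g \<odot> f)"

definition is_iso :: "('o, 'm) cat \<Rightarrow> 'm \<Rightarrow> bool" where
  "is_iso C f \<longleftrightarrow> f \<in> Arr C \<and>
     (\<exists>g \<in> Hom C (Cod C f) (Dom C f).
        g \<odot>\<^bsub>C\<^esub> f = Ident C (Dom C f) \<and> f \<odot>\<^bsub>C\<^esub> g = Ident C (Cod C f))"

record ('o, 'm, 'p, 'n) cfunctor =
  ObjMap :: "'o \<Rightarrow> 'p"
  ArrMap :: "'m \<Rightarrow> 'n"

definition is_functor ::
  "('o, 'm) cat \<Rightarrow> ('p, 'n) cat \<Rightarrow> ('o, 'm, 'p, 'n) cfunctor \<Rightarrow> bool" where
  "is_functor A B F \<longleftrightarrow>
     category A \<and> category B \<and>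
     ObjMap F \<in> extensional (Obj A) \<and> ArrMap F \<in> extensional (Arr A) \<and>
     (\<forall>a \<in> Obj A. ObjMap F a \<in> Obj B) \<and>
     (\<forall>f \<in> Arr A. ArrMap F f \<in> Hom B (ObjMap F (Dom A f)) (ObjMap F (Cod A f))) \<and>
     (\<forall>a \<in> Obj A. ArrMap F (Ident A a) = Ident B (ObjMap F a)) \<and>
     (\<forall>f \<in> Arr A. \<forall>g \<in> Arr A. Cod A f = Dom A g \<longrightarrow>
        ArrMap F (g \<odot>\<^bsub>A\<^esub> f) = ArrMap F g \<odot>\<^bsub>B\<^esub> ArrMap F f)"

definition id_functor :: "('o, 'm) cat \<Rightarrow> ('o, 'm, 'o, 'm) cfunctor" where
  "id_functor A = \<lparr>ObjMap = (\<lambda>a \<in> Obj A. a), ArrMap = (\<lambda>f \<in> Arr A. f)\<rparr>"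

text \<open>The first argument is the domain of the composite \<open>G \<circ> F\<close>.\<close>

definition comp_functor ::
  "('o, 'm) cat \<Rightarrow> ('p, 'n, 'q, 'k) cfunctor \<Rightarrow> ('o, 'm, 'p, 'n) cfunctor
     \<Rightarrow> ('o, 'm, 'q, 'k) cfunctor" where
  "comp_functor A G F =
     \<lparr>ObjMap = (\<lambda>a \<in> Obj A. ObjMap G (ObjMap F a)),
      ArrMap = (\<lambda>f \<in> Arr A. ArrMap G (ArrMap F f))\<rparr>"

definition faithful_functor ::
  "('o, 'm) cat \<Rightarrow> ('p, 'n) cat \<Rightarrow> ('o, 'm, 'p, 'n) cfunctor \<Rightarrow> bool" where
  "faithful_functor A B F \<longleftrightarrow> is_functor A B F \<and>
     (\<forall>f \<in> Arr A. \<forall>g \<in> Arr A.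
        Dom A f = Dom A g \<and> Cod A f = Cod A g \<and> ArrMap F f = ArrMap F g \<longrightarrow> f = g)"

definition nat_trans ::
  "('o, 'm) cat \<Rightarrow> ('p, 'n) cat \<Rightarrow> ('o, 'm, 'p, 'n) cfunctor \<Rightarrow> ('o, 'm, 'p, 'n) cfunctor
     \<Rightarrow> ('o \<Rightarrow> 'n) \<Rightarrow> bool" where
  "nat_trans A B F G \<chi> \<longleftrightarrow>
     is_functor A B F \<and> is_functor A B G \<and> \<chi> \<in> extensional (Obj A) \<and>
     (\<forall>a \<in> Obj A. \<chi> a \<in> Hom B (ObjMap F a) (ObjMap G a)) \<and>
     (\<forall>f \<in> Arr A. \<chi> (Cod A f) \<odot>\<^bsub>B\<^esub> ArrMap F f = ArrMap G f \<odot>\<^bsub>B\<^esub> \<chi> (Dom A f))"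

definition nat_iso ::
  "('o, 'm) cat \<Rightarrow> ('p, 'n) cat \<Rightarrow> ('o, 'm, 'p, 'n) cfunctor \<Rightarrow> ('o, 'm, 'p, 'n) cfunctor
     \<Rightarrow> ('o \<Rightarrow> 'n) \<Rightarrow> bool" where
  "nat_iso A B F G \<chi> \<longleftrightarrow> nat_trans A B F G \<chi> \<and> (\<forall>a \<in> Obj A. is_iso B (\<chi> a))"

definition equivalence_of_cats ::
  "('o, 'm) cat \<Rightarrow> ('p, 'n) cat \<Rightarrow> ('o, 'm, 'p, 'n) cfunctor \<Rightarrow> ('p, 'n, 'o, 'm) cfunctor
     \<Rightarrow> bool" where
  "equivalence_of_cats A B F G \<longleftrightarrow>
     is_functor A B F \<and> is_functor B A G \<and>
     (\<exists>\<eta>. nat_iso A A (id_functor A) (comp_functor A G F) \<eta>) \<and>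
     (\<exists>\<epsilon>. nat_iso B B (comp_functor B F G) (id_functor B) \<epsilon>)"

definition adjunction ::
  "('o, 'm) cat \<Rightarrow> ('p, 'n) cat \<Rightarrow> ('o, 'm, 'p, 'n) cfunctor \<Rightarrow> ('p, 'n, 'o, 'm) cfunctor
     \<Rightarrow> ('o \<Rightarrow> 'm) \<Rightarrow> ('p \<Rightarrow> 'n) \<Rightarrow> bool" where
  "adjunction A B F G \<eta> \<epsilon> \<longleftrightarrow>
     is_functor A B F \<and> is_functor B A G \<and>
     nat_trans A A (id_functor A) (comp_functor A G F) \<eta> \<and>
     nat_trans B B (comp_functor B F G) (id_functor B) \<epsilon> \<and>
     (\<forall>a \<in> Obj A. \<epsilon> (ObjMap F a) \<odot>\<^bsub>B\<^esub> ArrMap F (\<eta> a) = Ident B (ObjMap F a)) \<and>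
     (\<forall>b \<in> Obj B. ArrMap G (\<epsilon> b) \<odot>\<^bsub>A\<^esub> \<eta> (ObjMap G b) = Ident A (ObjMap G b))"

definition left_adjoint ::
  "('o, 'm) cat \<Rightarrow> ('p, 'n) cat \<Rightarrow> ('o, 'm, 'p, 'n) cfunctor \<Rightarrow> bool" where
  "left_adjoint A B F \<longleftrightarrow> (\<exists>G \<eta> \<epsilon>. adjunction A B F G \<eta> \<epsilon>)"


section \<open>Finite limits and pullbacks\<close>

definition is_cone ::
  "('i, 'j) cat \<Rightarrow> ('o, 'm) cat \<Rightarrow> ('i, 'j, 'o, 'm) cfunctor \<Rightarrow> 'o \<Rightarrow> ('i \<Rightarrow> 'm) \<Rightarrow> bool" where
  "is_cone J C D v \<pi> \<longleftrightarrow> v \<in> Obj C \<and>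
     (\<forall>j \<in> Obj J. \<pi> j \<in> Hom C v (ObjMap D j)) \<and>
     (\<forall>f \<in> Arr J. ArrMap D f \<odot>\<^bsub>C\<^esub> \<pi> (Dom J f) = \<pi> (Cod J f))"

definition is_limit ::
  "('i, 'j) cat \<Rightarrow> ('o, 'm) cat \<Rightarrow> ('i, 'j, 'o, 'm) cfunctor \<Rightarrow> 'o \<Rightarrow> ('i \<Rightarrow> 'm) \<Rightarrow> bool" where
  "is_limit J C D v \<pi> \<longleftrightarrow> is_cone J C D v \<pi> \<and>
     (\<forall>w \<rho>. is_cone J C D w \<rho> \<longrightarrow>
        (\<exists>!u. u \<in> Hom C w v \<and> (\<forall>j \<in> Obj J. \<pi> j \<odot>\<^bsub>C\<^esub> u = \<rho> j)))"

text \<open>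
  Every finite category is isomorphic to one whose objects and arrows are natural numbers, so
  it suffices to let the shape \<open>J\<close> range over finite categories on the type \<^typ>\<open>nat\<close>.
\<close>

definition has_finite_limits :: "('o, 'm) cat \<Rightarrow> bool" where
  "has_finite_limits C \<longleftrightarrow>
     (\<forall>(J :: (nat, nat) cat) D. finite (Obj J) \<and> finite (Arr J) \<and> is_functor J C D \<longrightarrow>
        (\<exists>v \<pi>. is_limit J C D v \<pi>))"

definition is_pullback :: "('o, 'm) cat \<Rightarrow> 'm \<Rightarrow> 'm \<Rightarrow> 'm \<Rightarrow> 'm \<Rightarrow> bool" where
  "is_pullback C f g p q \<longleftrightarrow>
     f \<in> Arr C \<and> g \<in> Arr C \<and> Cod C f = Cod C g \<and>
     p \<in> Arr C \<and> q \<in> Arr C \<and> Dom C p = Dom C q \<and>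
     Cod C p = Dom C f \<and> Cod C q = Dom C g \<and> f \<odot>\<^bsub>C\<^esub> p = g \<odot>\<^bsub>C\<^esub> q \<and>
     (\<forall>w. \<forall>a \<in> Hom C w (Dom C f). \<forall>b \<in> Hom C w (Dom C g). f \<odot>\<^bsub>C\<^esub> a = g \<odot>\<^bsub>C\<^esub> b \<longrightarrow>
        (\<exists>!u. u \<in> Hom C w (Dom C p) \<and> p \<odot>\<^bsub>C\<^esub> u = a \<and> q \<odot>\<^bsub>C\<^esub> u = b))"

text \<open>
  A chosen pullback of each cospan \<open>(f, g)\<close>, with its two projections. If \<open>f\<close> has domain \<open>A\<close> and \<open>g\<close>
  has domain \<open>B\<close>, then \<open>pb C f g\<close> is the object written as \<open>A\<close> times \<open>B\<close> over the common
  codomain, and \<open>pb_pair C f g a b\<close> is the induced arrow with components \<open>a\<close> and \<open>b\<close>.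
\<close>

definition chosen_pullback :: "('o, 'm) cat \<Rightarrow> 'm \<Rightarrow> 'm \<Rightarrow> 'm \<times> 'm" where
  "chosen_pullback C f g = (SOME pq. is_pullback C f g (fst pq) (snd pq))"

definition pr1 :: "('o, 'm) cat \<Rightarrow> 'm \<Rightarrow> 'm \<Rightarrow> 'm" where
  "pr1 C f g = fst (chosen_pullback C f g)"

definition pr2 :: "('o, 'm) cat \<Rightarrow> 'm \<Rightarrow> 'm \<Rightarrow> 'm" where
  "pr2 C f g = snd (chosen_pullback C f g)"

definition pb :: "('o, 'm) cat \<Rightarrow> 'm \<Rightarrow> 'm \<Rightarrow> 'o" where
  "pb C f g = Dom C (pr1 C f g)"

definition pb_pair :: "('o, 'm) cat \<Rightarrow> 'm \<Rightarrow> 'm \<Rightarrow> 'm \<Rightarrow> 'm \<Rightarrow> 'm" where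
  "pb_pair C f g a b =
     (THE u. u \<in> Hom C (Dom C a) (pb C f g) \<and>
             pr1 C f g \<odot>\<^bsub>C\<^esub> u = a \<and> pr2 C f g \<odot>\<^bsub>C\<^esub> u = b)"

definition cartesian_nat_trans ::
  "('o, 'm) cat \<Rightarrow> ('p, 'n) cat \<Rightarrow> ('o, 'm, 'p, 'n) cfunctor \<Rightarrow> ('o, 'm, 'p, 'n) cfunctor
     \<Rightarrow> ('o \<Rightarrow> 'n) \<Rightarrow> bool" where
  "cartesian_nat_trans A B F G \<chi> \<longleftrightarrow> nat_trans A B F G \<chi> \<and>
     (\<forall>f \<in> Arr A. is_pullback B (\<chi> (Cod A f)) (ArrMap G f) (ArrMap F f) (\<chi> (Dom A f)))"


section \<open>Internal categories\<close>

record ('o, 'm) icat =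
  iobj :: 'o
  iarr :: 'o
  isrc :: 'm
  itgt :: 'm
  iid :: 'm
  icomp :: 'm

text \<open>
  On generalized elements, \<open>icomp\<close> sends a pair \<open>(g, f)\<close> with \<open>s g = t f\<close> to the composite of \<open>f\<close>
  followed by \<open>g\<close>. Associativity is stated on the object of triples \<open>(h, (g, f))\<close>, whose
  projections to \<open>h\<close> and to \<open>(g, f)\<close> are \<open>p\<close> and \<open>q\<close>.
\<close>

definition internal_category :: "('o, 'm) cat \<Rightarrow> ('o, 'm) icat \<Rightarrow> bool" where
  "internal_category C D \<longleftrightarrow>
     (let s = isrc D; t = itgt D; i = iid D; c = icomp D;
          \<pi>\<^sub>1 = pr1 C s t; \<pi>\<^sub>2 = pr2 C s t;
          p = pr1 C s (t \<odot>\<^bsub>C\<^esub> \<pi>\<^sub>1); q = pr2 C s (t \<odot>\<^bsub>C\<^esub> \<pi>\<^sub>1)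
      in iobj D \<in> Obj C \<and> iarr D \<in> Obj C \<and>
         s \<in> Hom C (iarr D) (iobj D) \<and> t \<in> Hom C (iarr D) (iobj D) \<and>
         i \<in> Hom C (iobj D) (iarr D) \<and> c \<in> Hom C (pb C s t) (iarr D) \<and>
         s \<odot>\<^bsub>C\<^esub> i = Ident C (iobj D) \<and> t \<odot>\<^bsub>C\<^esub> i = Ident C (iobj D) \<and>
         s \<odot>\<^bsub>C\<^esub> c = s \<odot>\<^bsub>C\<^esub> \<pi>\<^sub>2 \<and> t \<odot>\<^bsub>C\<^esub> c = t \<odot>\<^bsub>C\<^esub> \<pi>\<^sub>1 \<and>
         c \<odot>\<^bsub>C\<^esub> pb_pair C s t (i \<odot>\<^bsub>C\<^esub> t) (Ident C (iarr D)) = Ident C (iarr D) \<and>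
         c \<odot>\<^bsub>C\<^esub> pb_pair C s t (Ident C (iarr D)) (i \<odot>\<^bsub>C\<^esub> s) = Ident C (iarr D) \<and>
         c \<odot>\<^bsub>C\<^esub> pb_pair C s t p (c \<odot>\<^bsub>C\<^esub> q) =
           c \<odot>\<^bsub>C\<^esub> pb_pair C s t (c \<odot>\<^bsub>C\<^esub> pb_pair C s t p (\<pi>\<^sub>1 \<odot>\<^bsub>C\<^esub> q)) (\<pi>\<^sub>2 \<odot>\<^bsub>C\<^esub> q))"

definition internal_functor ::
  "('o, 'm) cat \<Rightarrow> ('o, 'm) icat \<Rightarrow> ('o, 'm) icat \<Rightarrow> 'm \<Rightarrow> 'm \<Rightarrow> bool" where
  "internal_functor C D E F0 F1 \<longleftrightarrow>
     internal_category C D \<and> internal_category C E \<and>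
     F0 \<in> Hom C (iobj D) (iobj E) \<and> F1 \<in> Hom C (iarr D) (iarr E) \<and>
     isrc E \<odot>\<^bsub>C\<^esub> F1 = F0 \<odot>\<^bsub>C\<^esub> isrc D \<and> itgt E \<odot>\<^bsub>C\<^esub> F1 = F0 \<odot>\<^bsub>C\<^esub> itgt D \<and>
     F1 \<odot>\<^bsub>C\<^esub> iid D = iid E \<odot>\<^bsub>C\<^esub> F0 \<and>
     F1 \<odot>\<^bsub>C\<^esub> icomp D =
       icomp E \<odot>\<^bsub>C\<^esub> pb_pair C (isrc E) (itgt E)
         (F1 \<odot>\<^bsub>C\<^esub> pr1 C (isrc D) (itgt D)) (F1 \<odot>\<^bsub>C\<^esub> pr2 C (isrc D) (itgt D))"

text \<open>
  In \<open>Cat_int\<close> and the categories below, an arrow carries its source and target as first and last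
  components.
\<close>

type_synonym ('o, 'm) ifun = "('o, 'm) icat \<times> 'm \<times> 'm \<times> ('o, 'm) icat"

definition Cat_int :: "('o, 'm) cat \<Rightarrow> (('o, 'm) icat, ('o, 'm) ifun) cat" where
  "Cat_int C =
     \<lparr>Obj = {D. internal_category C D},
      Arr = {(D, F0, F1, E). internal_functor C D E F0 F1},
      Dom = (\<lambda>(D, F0, F1, E). D),
      Cod = (\<lambda>(D, F0, F1, E). E),
      Ident = (\<lambda>D. (D, Ident C (iobj D), Ident C (iarr D), D)),
      Comp = (\<lambda>(_, G0, G1, E) (D, F0, F1, _). (D, G0 \<odot>\<^bsub>C\<^esub> F0, G1 \<odot>\<^bsub>C\<^esub> F1, E))\<rparr>"


section \<open>Slice categories\<close>

text \<open>
  The triple \<open>(\<gamma>, f, \<delta>)\<close> is the arrow \<open>f\<close> regarded as going from \<open>\<gamma>\<close> to \<open>\<delta>\<close> over \<open>a\<close>.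
\<close>

type_synonym 'm sarr = "'m \<times> 'm \<times> 'm"

definition slice :: "('o, 'm) cat \<Rightarrow> 'o \<Rightarrow> ('m, 'm sarr) cat" where
  "slice C a =
     \<lparr>Obj = {\<gamma> \<in> Arr C. Cod C \<gamma> = a},
      Arr = {(\<gamma>, f, \<delta>). \<gamma> \<in> Arr C \<and> Cod C \<gamma> = a \<and> \<delta> \<in> Arr C \<and> Cod C \<delta> = a \<and>
               f \<in> Hom C (Dom C \<gamma>) (Dom C \<delta>) \<and> \<delta> \<odot>\<^bsub>C\<^esub> f = \<gamma>},
      Dom = (\<lambda>(\<gamma>, f, \<delta>). \<gamma>),
      Cod = (\<lambda>(\<gamma>, f, \<delta>). \<delta>),
      Ident = (\<lambda>\<gamma>. (\<gamma>, Ident C (Dom C \<gamma>), \<gamma>)),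
      Comp = (\<lambda>(_, g, \<epsilon>) (\<gamma>, f, _). (\<gamma>, g \<odot>\<^bsub>C\<^esub> f, \<epsilon>))\<rparr>"

definition dom_functor :: "('o, 'm) cat \<Rightarrow> 'o \<Rightarrow> ('m, 'm sarr, 'o, 'm) cfunctor" where
  "dom_functor C a =
     \<lparr>ObjMap = (\<lambda>\<gamma> \<in> Obj (slice C a). Dom C \<gamma>),
      ArrMap = (\<lambda>(\<gamma>, f, \<delta>) \<in> Arr (slice C a). f)\<rparr>"

definition postcomp :: "('o, 'm) cat \<Rightarrow> 'm \<Rightarrow> ('m, 'm sarr, 'm, 'm sarr) cfunctor" where
  "postcomp C h =
     \<lparr>ObjMap = (\<lambda>\<gamma> \<in> Obj (slice C (Dom C h)). h \<odot>\<^bsub>C\<^esub> \<gamma>),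
      ArrMap = (\<lambda>(\<gamma>, f, \<delta>) \<in> Arr (slice C (Dom C h)). (h \<odot>\<^bsub>C\<^esub> \<gamma>, f, h \<odot>\<^bsub>C\<^esub> \<delta>))\<rparr>"


section \<open>Monads and comorphisms\<close>

record ('o, 'm) monad =
  mfun :: "('o, 'm, 'o, 'm) cfunctor"
  munit :: "'o \<Rightarrow> 'm"
  mmult :: "'o \<Rightarrow> 'm"

definition is_monad :: "('o, 'm) cat \<Rightarrow> ('o, 'm) monad \<Rightarrow> bool" where
  "is_monad E T \<longleftrightarrow>
     is_functor E E (mfun T) \<and>
     nat_trans E E (id_functor E) (mfun T) (munit T) \<and>
     nat_trans E E (comp_functor E (mfun T) (mfun T)) (mfun T) (mmult T) \<and>
     (\<forall>a \<in> Obj E.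
        mmult T a \<odot>\<^bsub>E\<^esub> ArrMap (mfun T) (munit T a) = Ident E (ObjMap (mfun T) a) \<and>
        mmult T a \<odot>\<^bsub>E\<^esub> munit T (ObjMap (mfun T) a) = Ident E (ObjMap (mfun T) a) \<and>
        mmult T a \<odot>\<^bsub>E\<^esub> ArrMap (mfun T) (mmult T a) =
          mmult T a \<odot>\<^bsub>E\<^esub> mmult T (ObjMap (mfun T) a))"

definition id_monad :: "('o, 'm) cat \<Rightarrow> ('o, 'm) monad" where
  "id_monad E =
     \<lparr>mfun = id_functor E, munit = (\<lambda>a \<in> Obj E. Ident E a), mmult = (\<lambda>a \<in> Obj E. Ident E a)\<rparr>"

definition comorphism ::
  "('o, 'm) cat \<Rightarrow> ('o, 'm) monad \<Rightarrow> ('p, 'n) cat \<Rightarrow> ('p, 'n) monad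
     \<Rightarrow> ('o, 'm, 'p, 'n) cfunctor \<Rightarrow> ('o \<Rightarrow> 'n) \<Rightarrow> bool" where
  "comorphism E T A S F \<chi> \<longleftrightarrow>
     is_monad E T \<and> is_monad A S \<and> is_functor E A F \<and>
     nat_trans E A (comp_functor E F (mfun T)) (comp_functor E (mfun S) F) \<chi> \<and>
     (\<forall>a \<in> Obj E. \<chi> a \<odot>\<^bsub>A\<^esub> ArrMap F (munit T a) = munit S (ObjMap F a)) \<and>
     (\<forall>a \<in> Obj E. \<chi> a \<odot>\<^bsub>A\<^esub> ArrMap F (mmult T a) =
        mmult S (ObjMap F a) \<odot>\<^bsub>A\<^esub> (ArrMap (mfun S) (\<chi> a) \<odot>\<^bsub>A\<^esub> \<chi> (ObjMap (mfun T) a)))"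

type_synonym ('o, 'm) catmnd = "('o, 'm) cat \<times> ('o, 'm) monad"

type_synonym ('o, 'm) mndco =
  "('o, 'm) catmnd \<times> ('o, 'm, 'o, 'm) cfunctor \<times> ('o \<Rightarrow> 'm) \<times> ('o, 'm) catmnd"

text \<open>
  The types \<^typ>\<open>'o\<close> and \<^typ>\<open>'m\<close> play the role of the universe in which the objects and arrows of
  the base categories of the monads lie.
\<close>

definition Mnd_co_adj :: "(('o, 'm) catmnd, ('o, 'm) mndco) cat" where
  "Mnd_co_adj =
     \<lparr>Obj = {(E, T). is_monad E T},
      Arr = {((E, T), F, \<chi>, (A, S)). comorphism E T A S F \<chi> \<and> left_adjoint E A F},
      Dom = (\<lambda>(X, F, \<chi>, Y). X),
      Cod = (\<lambda>(X, F, \<chi>, Y). Y),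
      Ident = (\<lambda>(E, T). ((E, T), id_functor E,
                 (\<lambda>a \<in> Obj E. Ident E (ObjMap (mfun T) a)), (E, T))),
      Comp = (\<lambda>(_, G, \<psi>, (B, R)) ((E, T), F, \<chi>, _).
                ((E, T), comp_functor E G F,
                 (\<lambda>a \<in> Obj E. \<psi> (ObjMap F a) \<odot>\<^bsub>B\<^esub> ArrMap G (\<chi> a)), (B, R)))\<rparr>"


section \<open>Generalized action monads\<close>

type_synonym ('o, 'm) actmnd = "'o \<times> ('m, 'm sarr) monad \<times> ('m \<Rightarrow> 'm)"

type_synonym ('o, 'm) actmor =
  "('o, 'm) actmnd \<times> 'm \<times> ('m \<Rightarrow> 'm sarr) \<times> ('o, 'm) actmnd"

definition action_monad ::
  "('o, 'm) cat \<Rightarrow> 'o \<Rightarrow> ('m, 'm sarr) monad \<Rightarrow> ('m \<Rightarrow> 'm) \<Rightarrow> bool" where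
  "action_monad C a T \<alpha> \<longleftrightarrow>
     a \<in> Obj C \<and> is_monad (slice C a) T \<and>
     cartesian_nat_trans (slice C a) C
       (comp_functor (slice C a) (dom_functor C a) (mfun T)) (dom_functor C a) \<alpha> \<and>
     comorphism (slice C a) T C (id_monad C) (dom_functor C a) \<alpha>"

definition action_monad_morphism ::
  "('o, 'm) cat \<Rightarrow> ('o, 'm) actmnd \<Rightarrow> ('o, 'm) actmnd \<Rightarrow> 'm \<Rightarrow> ('m \<Rightarrow> 'm sarr) \<Rightarrow> bool" where
  "action_monad_morphism C X Y h \<Lambda> \<longleftrightarrow>
     (case (X, Y) of ((a, T, \<alpha>), (b, S, \<beta>)) \<Rightarrow>
        action_monad C a T \<alpha> \<and> action_monad C b S \<beta> \<and> h \<in> Hom C a b \<and>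
        comorphism (slice C a) T (slice C b) S (postcomp C h) \<Lambda> \<and>
        (\<forall>\<gamma> \<in> Obj (slice C a).
           \<beta> (h \<odot>\<^bsub>C\<^esub> \<gamma>) \<odot>\<^bsub>C\<^esub> ArrMap (dom_functor C b) (\<Lambda> \<gamma>) = \<alpha> \<gamma>))"

definition ActMnd :: "('o, 'm) cat \<Rightarrow> (('o, 'm) actmnd, ('o, 'm) actmor) cat" where
  "ActMnd C =
     \<lparr>Obj = {(a, T, \<alpha>). action_monad C a T \<alpha>},
      Arr = {(X, h, \<Lambda>, Y). action_monad_morphism C X Y h \<Lambda>},
      Dom = (\<lambda>(X, h, \<Lambda>, Y). X),
      Cod = (\<lambda>(X, h, \<Lambda>, Y). Y),
      Ident = (\<lambda>(a, T, \<alpha>). ((a, T, \<alpha>), Ident C a,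
                 (\<lambda>\<gamma> \<in> Obj (slice C a). Ident (slice C a) (ObjMap (mfun T) \<gamma>)), (a, T, \<alpha>))),
      Comp = (\<lambda>(_, k, K, Z) (X, h, \<Lambda>, _).
                (X, k \<odot>\<^bsub>C\<^esub> h,
                 (\<lambda>\<gamma> \<in> Obj (slice C (Dom C h)).
                    K (h \<odot>\<^bsub>C\<^esub> \<gamma>) \<odot>\<^bsub>slice C (Cod C k)\<^esub> ArrMap (postcomp C k) (\<Lambda> \<gamma>)), Z))\<rparr>"

definition ActMnd_forget ::
  "('o, 'm) cat \<Rightarrow> (('o, 'm) actmnd, ('o, 'm) actmor, ('m, 'm sarr) catmnd, ('m, 'm sarr) mndco) cfunctor"
  where
  "ActMnd_forget C =
     \<lparr>ObjMap = (\<lambda>(a, T, \<alpha>) \<in> Obj (ActMnd C). (slice C a, T)),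
      ArrMap = (\<lambda>((a, T, \<alpha>), h, \<Lambda>, (b, S, \<beta>)) \<in> Arr (ActMnd C).
                  ((slice C a, T), postcomp C h, \<Lambda>, (slice C b, S)))\<rparr>"


section \<open>The action monad of an internal category\<close>

definition act_obj :: "('o, 'm) cat \<Rightarrow> ('o, 'm) icat \<Rightarrow> 'm \<Rightarrow> 'm" where
  "act_obj C D \<gamma> = itgt D \<odot>\<^bsub>C\<^esub> pr1 C (isrc D) \<gamma>"

definition act_functor :: "('o, 'm) cat \<Rightarrow> ('o, 'm) icat \<Rightarrow> ('m, 'm sarr, 'm, 'm sarr) cfunctor" where
  "act_functor C D =
     \<lparr>ObjMap = (\<lambda>\<gamma> \<in> Obj (slice C (iobj D)). act_obj C D \<gamma>),
      ArrMap = (\<lambda>(\<gamma>, f, \<delta>) \<in> Arr (slice C (iobj D)).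
        (act_obj C D \<gamma>,
         pb_pair C (isrc D) \<delta> (pr1 C (isrc D) \<gamma>) (f \<odot>\<^bsub>C\<^esub> pr2 C (isrc D) \<gamma>),
         act_obj C D \<delta>))\<rparr>"

definition act_unit :: "('o, 'm) cat \<Rightarrow> ('o, 'm) icat \<Rightarrow> 'm \<Rightarrow> 'm sarr" where
  "act_unit C D = (\<lambda>\<gamma> \<in> Obj (slice C (iobj D)).
     (\<gamma>, pb_pair C (isrc D) \<gamma> (iid D \<odot>\<^bsub>C\<^esub> \<gamma>) (Ident C (Dom C \<gamma>)), act_obj C D \<gamma>))"

text \<open>
  \<open>act_assoc\<close> is the associativity isomorphism, on generalized elements
  \<open>(g, (f, x)) \<mapsto> ((g, f), x)\<close>; its codomain is the pullback along \<open>\<gamma>\<close> of the source map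
  \<open>(g, f) \<mapsto> s f\<close>.
\<close>

definition act_assoc :: "('o, 'm) cat \<Rightarrow> ('o, 'm) icat \<Rightarrow> 'm \<Rightarrow> 'm" where
  "act_assoc C D \<gamma> =
     (let s = isrc D; t = itgt D;
          p = pr1 C s (act_obj C D \<gamma>); q = pr2 C s (act_obj C D \<gamma>)
      in pb_pair C (s \<odot>\<^bsub>C\<^esub> pr2 C s t) \<gamma>
           (pb_pair C s t p (pr1 C s \<gamma> \<odot>\<^bsub>C\<^esub> q)) (pr2 C s \<gamma> \<odot>\<^bsub>C\<^esub> q))"

definition act_comp_id :: "('o, 'm) cat \<Rightarrow> ('o, 'm) icat \<Rightarrow> 'm \<Rightarrow> 'm" where
  "act_comp_id C D \<gamma> =
     (let s = isrc D; t = itgt D; u = s \<odot>\<^bsub>C\<^esub> pr2 C s t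
      in pb_pair C s \<gamma> (icomp D \<odot>\<^bsub>C\<^esub> pr1 C u \<gamma>) (pr2 C u \<gamma>))"

definition act_mult :: "('o, 'm) cat \<Rightarrow> ('o, 'm) icat \<Rightarrow> 'm \<Rightarrow> 'm sarr" where
  "act_mult C D = (\<lambda>\<gamma> \<in> Obj (slice C (iobj D)).
     (act_obj C D (act_obj C D \<gamma>),
      act_comp_id C D \<gamma> \<odot>\<^bsub>C\<^esub> act_assoc C D \<gamma>,
      act_obj C D \<gamma>))"

definition act_monad :: "('o, 'm) cat \<Rightarrow> ('o, 'm) icat \<Rightarrow> ('m, 'm sarr) monad" where
  "act_monad C D = \<lparr>mfun = act_functor C D, munit = act_unit C D, mmult = act_mult C D\<rparr>"

definition act_proj :: "('o, 'm) cat \<Rightarrow> ('o, 'm) icat \<Rightarrow> 'm \<Rightarrow> 'm" where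
  "act_proj C D = (\<lambda>\<gamma> \<in> Obj (slice C (iobj D)). pr2 C (isrc D) \<gamma>)"

definition act_tau ::
  "('o, 'm) cat \<Rightarrow> ('o, 'm) icat \<Rightarrow> ('o, 'm) icat \<Rightarrow> 'm \<Rightarrow> 'm \<Rightarrow> 'm \<Rightarrow> 'm sarr" where
  "act_tau C D E F0 F1 = (\<lambda>\<gamma> \<in> Obj (slice C (iobj D)).
     (F0 \<odot>\<^bsub>C\<^esub> act_obj C D \<gamma>,
      pb_pair C (isrc E) (F0 \<odot>\<^bsub>C\<^esub> \<gamma>) (F1 \<odot>\<^bsub>C\<^esub> pr1 C (isrc D) \<gamma>) (pr2 C (isrc D) \<gamma>),
      act_obj C E (F0 \<odot>\<^bsub>C\<^esub> \<gamma>)))"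

definition T_Mnd ::
  "('o, 'm) cat \<Rightarrow> (('o, 'm) icat, ('o, 'm) ifun, ('m, 'm sarr) catmnd, ('m, 'm sarr) mndco) cfunctor"
  where
  "T_Mnd C =
     \<lparr>ObjMap = (\<lambda>D \<in> Obj (Cat_int C). (slice C (iobj D), act_monad C D)),
      ArrMap = (\<lambda>(D, F0, F1, E) \<in> Arr (Cat_int C).
        ((slice C (iobj D), act_monad C D), postcomp C F0, act_tau C D E F0 F1,
         (slice C (iobj E), act_monad C E)))\<rparr>"

definition T_Act ::
  "('o, 'm) cat \<Rightarrow> (('o, 'm) icat, ('o, 'm) ifun, ('o, 'm) actmnd, ('o, 'm) actmor) cfunctor"
  where
  "T_Act C =
     \<lparr>ObjMap = (\<lambda>D \<in> Obj (Cat_int C). (iobj D, act_monad C D, act_proj C D)),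
      ArrMap = (\<lambda>(D, F0, F1, E) \<in> Arr (Cat_int C).
        ((iobj D, act_monad C D, act_proj C D), F0, act_tau C D E F0 F1,
         (iobj E, act_monad C E, act_proj C E)))\<rparr>"

end

theory Submission
  imports Defs
begin

text \<open>
  An action monad on the slice over \<open>a\<close> is determined by its value at the terminal object \<open>id\<close> of that
  slice. Every \<open>\<gamma> : X \<rightarrow> a\<close> has exactly one slice arrow to \<open>id\<close>, namely \<open>\<gamma>\<close> itself, and the naturality
  square of \<open>\<alpha>\<close> at this arrow is a pullback. So the domain of \<open>T \<gamma>\<close> is the pullback along \<open>\<gamma>\<close> of
  \<open>s = \<alpha> id : D\<^sub>1 \<rightarrow> a\<close>, where \<open>D\<^sub>1\<close> is the domain of \<open>t = T id\<close>. This is the formula for the action monad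
  of an internal category with objects \<open>a\<close>, arrows \<open>D\<^sub>1\<close>, source \<open>s\<close> and target \<open>t\<close>. The unit at \<open>id\<close>
  provides its identities, the multiplication at \<open>id\<close> its composition, and the monad laws at \<open>id\<close> are
  its unit and associativity axioms (\<open>internal_category_D\<close>). Naturality at the arrows \<open>\<gamma> \<rightarrow> id\<close>
  extends the identification from \<open>id\<close> to all \<open>\<gamma>\<close>, which gives an isomorphism of action monads
  (\<open>act_monad_iso\<close>).

  For the same reason a morphism between the action monads of \<open>D\<close> and \<open>E\<close> is determined by its
  component at the identity of the object of objects. The source of that component is a copy of the
  object of arrows of \<open>D\<close>, its first projection to the object of arrows of \<open>E\<close> is the arrow part of an
  internal functor, and every morphism arises from this functor (\<open>internal_functor_F1\<close>,
  \<open>act_tau_F1\<close>). Hence the functor to action monads is fully faithful and essentially surjective, and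
  therefore part of an equivalence (\<open>equivalence_if_fully_faithful_ess_surj\<close>).

  The forgetful functor to monads is faithful because postcomposition with \<open>h\<close> sends an identity
  to \<open>h\<close>; its values are left adjoints because pullback along \<open>h\<close> is right adjoint to
  postcomposition with \<open>h\<close> (\<open>left_adjoint_postcomp\<close>).

  Equations between arrows of slices are reduced to equations between their underlying arrows in \<open>C\<close>,
  and arrows into a pullback are compared by composing with the two projections.
\<close>

section \<open>Categories, functors and adjunctions\<close>

context category
begin

lemma comp_arr [simp]:
  "\<lbrakk>f \<in> Arr C; g \<in> Arr C; Cod C f = Dom C g\<rbrakk> \<Longrightarrow> g \<odot> f \<in> Arr C"
  and dom_comp [simp]: "\<lbrakk>f \<in> Arr C; g \<in> Arr C; Cod C f = Dom C g\<rbrakk> \<Longrightarrow> Dom C (g \<odot> f) = Dom C f"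
  and cod_comp [simp]: "\<lbrakk>f \<in> Arr C; g \<in> Arr C; Cod C f = Dom C g\<rbrakk> \<Longrightarrow> Cod C (g \<odot> f) = Cod C g"
  using comp_in_hom[of f "Dom C f" "Cod C f" g "Cod C g"] by (auto simp: Hom_def)

lemma ident_arr [simp]: "a \<in> Obj C \<Longrightarrow> Ident C a \<in> Arr C"
  and dom_ident [simp]: "a \<in> Obj C \<Longrightarrow> Dom C (Ident C a) = a"
  and cod_ident [simp]: "a \<in> Obj C \<Longrightarrow> Cod C (Ident C a) = a"
  using ident_in_hom[of a] by (auto simp: Hom_def)

lemma ident_left [simp]: "\<lbrakk>f \<in> Arr C; Cod C f = a\<rbrakk> \<Longrightarrow> Ident C a \<odot> f = f"
  and ident_right [simp]: "\<lbrakk>f \<in> Arr C; Dom C f = a\<rbrakk> \<Longrightarrow> f \<odot> Ident C a = f"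
  using ident_comp[of f "Dom C f" a] comp_ident[of f a "Cod C f"] by (auto simp: Hom_def)

lemma assoc [simp]:
  "\<lbrakk>f \<in> Arr C; g \<in> Arr C; h \<in> Arr C; Cod C f = Dom C g; Cod C g = Dom C h\<rbrakk>
    \<Longrightarrow> (h \<odot> g) \<odot> f = h \<odot> (g \<odot> f)"
  using comp_assoc[of f "Dom C f" "Cod C f" g "Cod C g" h "Cod C h"] by (auto simp: Hom_def)

lemmas [simp] = dom_in_obj cod_in_obj

text \<open>
  Equations between composites are used as rewrite rules on right-nested composites; this turns
  an equation for \<open>g \<odot> f\<close> into one for \<open>g \<odot> (f \<odot> x)\<close>.
\<close>

lemma precompose:
  assumes "g \<odot> f = k" "f \<in> Arr C" "g \<in> Arr C" "Cod C f = Dom C g" "x \<in> Arr C" "Cod C x = Dom C f"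
  shows "g \<odot> (f \<odot> x) = k \<odot> x"
  using assms assoc[of x f g] by simp

lemma precompose2:
  assumes "g \<odot> f = k \<odot> l" "f \<in> Arr C" "g \<in> Arr C" "Cod C f = Dom C g"
    "k \<in> Arr C" "l \<in> Arr C" "Cod C l = Dom C k" "Dom C l = Dom C f"
    "x \<in> Arr C" "Cod C x = Dom C f"
  shows "g \<odot> (f \<odot> x) = k \<odot> (l \<odot> x)"
  using precompose[OF assms(1-4) assms(9,10)] assms by simp

end

lemma is_isoI:
  assumes "f \<in> Hom C a b" "g \<in> Hom C b a" "g \<odot>\<^bsub>C\<^esub> f = Ident C a" "f \<odot>\<^bsub>C\<^esub> g = Ident C b"
  shows "is_iso C f"
  using assms unfolding is_iso_def Hom_def by auto

locale functor_between = A: category A + B: category B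
  for A :: "('o, 'm) cat" and B :: "('p, 'n) cat" +
  fixes F :: "('o, 'm, 'p, 'n) cfunctor"
  assumes functorial: "is_functor A B F"
begin

lemma obj [simp]: "a \<in> Obj A \<Longrightarrow> ObjMap F a \<in> Obj B"
  and arr [simp]: "f \<in> Arr A \<Longrightarrow> ArrMap F f \<in> Arr B"
  and dom [simp]: "f \<in> Arr A \<Longrightarrow> Dom B (ArrMap F f) = ObjMap F (Dom A f)"
  and cod [simp]: "f \<in> Arr A \<Longrightarrow> Cod B (ArrMap F f) = ObjMap F (Cod A f)"
  and ident [simp]: "a \<in> Obj A \<Longrightarrow> ArrMap F (Ident A a) = Ident B (ObjMap F a)"
  and comp [simp]: "\<lbrakk>f \<in> Arr A; g \<in> Arr A; Cod A f = Dom A g\<rbrakk>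
    \<Longrightarrow> ArrMap F (g \<odot>\<^bsub>A\<^esub> f) = ArrMap F g \<odot>\<^bsub>B\<^esub> ArrMap F f"
  and ext_obj [simp]: "ObjMap F \<in> extensional (Obj A)"
  and ext_arr [simp]: "ArrMap F \<in> extensional (Arr A)"
  using functorial unfolding is_functor_def Hom_def by auto

end

lemma functor_betweenI: "is_functor A B F \<Longrightarrow> functor_between A B F"
  unfolding functor_between_def functor_between_axioms_def is_functor_def by auto

locale transformation = F: functor_between A B F + G: functor_between A B G
  for A :: "('o, 'm) cat" and B :: "('p, 'n) cat"
    and F :: "('o, 'm, 'p, 'n) cfunctor" and G :: "('o, 'm, 'p, 'n) cfunctor" +
  fixes \<chi> :: "'o \<Rightarrow> 'n"
  assumes nat_trans: "nat_trans A B F G \<chi>"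
begin

lemma component [simp]: "a \<in> Obj A \<Longrightarrow> \<chi> a \<in> Arr B"
  and component_dom [simp]: "a \<in> Obj A \<Longrightarrow> Dom B (\<chi> a) = ObjMap F a"
  and component_cod [simp]: "a \<in> Obj A \<Longrightarrow> Cod B (\<chi> a) = ObjMap G a"
  and ext_component [simp]: "\<chi> \<in> extensional (Obj A)"
  using nat_trans unfolding nat_trans_def Hom_def by auto

lemma naturality: "\<lbrakk>f \<in> Arr A; Dom A f = a; Cod A f = b\<rbrakk>
    \<Longrightarrow> \<chi> b \<odot>\<^bsub>B\<^esub> ArrMap F f = ArrMap G f \<odot>\<^bsub>B\<^esub> \<chi> a"
  using nat_trans unfolding nat_trans_def by auto

lemma naturality_precompose:
  assumes "f \<in> Arr A" "Dom A f = a" "Cod A f = b" "x \<in> Arr B" "Cod B x = ObjMap F a"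
  shows "\<chi> b \<odot>\<^bsub>B\<^esub> (ArrMap F f \<odot>\<^bsub>B\<^esub> x) = ArrMap G f \<odot>\<^bsub>B\<^esub> (\<chi> a \<odot>\<^bsub>B\<^esub> x)"
  by (rule F.B.precompose2[OF naturality[OF assms(1-3)]]) (use assms in auto)

end

lemma transformationI: "nat_trans A B F G \<chi> \<Longrightarrow> transformation A B F G \<chi>"
  unfolding transformation_def transformation_axioms_def
  by (auto simp: nat_trans_def intro: functor_betweenI)

lemma id_functor_simps [simp]:
  "a \<in> Obj A \<Longrightarrow> ObjMap (id_functor A) a = a" "f \<in> Arr A \<Longrightarrow> ArrMap (id_functor A) f = f"
  by (auto simp: id_functor_def)

lemma comp_functor_simps [simp]:
  "a \<in> Obj A \<Longrightarrow> ObjMap (comp_functor A G F) a = ObjMap G (ObjMap F a)"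
  "f \<in> Arr A \<Longrightarrow> ArrMap (comp_functor A G F) f = ArrMap G (ArrMap F f)"
  by (auto simp: comp_functor_def)

lemma is_functor_id: "category A \<Longrightarrow> is_functor A A (id_functor A)"
proof -
  assume "category A"
  then interpret category A .
  show ?thesis by (auto simp: is_functor_def category_axioms id_functor_def Hom_def)
qed

lemma is_functor_comp:
  assumes "is_functor A B F" "is_functor B E G"
  shows "is_functor A E (comp_functor A G F)"
proof -
  interpret F: functor_between A B F by (rule functor_betweenI) fact
  interpret G: functor_between B E G by (rule functor_betweenI) fact
  show ?thesis
    by (auto simp: is_functor_def F.A.category_axioms G.B.category_axioms comp_functor_def Hom_def)
qed

lemma cfunctor_eqI:
  fixes F G :: "('o, 'm, 'p, 'n) cfunctor"
  assumes "ObjMap F \<in> extensional (Obj A)" "ArrMap F \<in> extensional (Arr A)"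
    "ObjMap G \<in> extensional (Obj A)" "ArrMap G \<in> extensional (Arr A)"
    "\<And>a. a \<in> Obj A \<Longrightarrow> ObjMap F a = ObjMap G a" "\<And>f. f \<in> Arr A \<Longrightarrow> ArrMap F f = ArrMap G f"
  shows "F = G"
  using extensionalityI[OF assms(1,3,5)] extensionalityI[OF assms(2,4,6)] by simp

lemma comp_functor_ext [simp]:
  "ObjMap (comp_functor A G F) \<in> extensional (Obj A)"
  "ArrMap (comp_functor A G F) \<in> extensional (Arr A)"
  by (auto simp: comp_functor_def)

lemma comp_functor_assoc:
  assumes "is_functor A B F"
  shows "comp_functor A (comp_functor B H G) F = comp_functor A H (comp_functor A G F)"
proof -
  interpret F: functor_between A B F by (rule functor_betweenI) fact
  show ?thesis by (rule cfunctor_eqI[where A = A]) auto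
qed

lemma comp_functor_id:
  assumes "is_functor A B F"
  shows "comp_functor A (id_functor B) F = F" "comp_functor A F (id_functor A) = F"
proof -
  interpret F: functor_between A B F by (rule functor_betweenI) fact
  show "comp_functor A (id_functor B) F = F" "comp_functor A F (id_functor A) = F"
    by (rule cfunctor_eqI[where A = A]; auto)+
qed

lemma nat_transI:
  assumes "is_functor A B F" "is_functor A B G" "\<chi> \<in> extensional (Obj A)"
    "\<And>a. a \<in> Obj A \<Longrightarrow> \<chi> a \<in> Hom B (ObjMap F a) (ObjMap G a)"
    "\<And>f. f \<in> Arr A \<Longrightarrow> \<chi> (Cod A f) \<odot>\<^bsub>B\<^esub> ArrMap F f = ArrMap G f \<odot>\<^bsub>B\<^esub> \<chi> (Dom A f)"
  shows "nat_trans A B F G \<chi>"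
  using assms by (simp add: nat_trans_def)

text \<open>
  Each triangle identity of the composite is a naturality square that brings the inner counit (or
  unit) next to the matching unit (or counit), followed by the two given triangle identities.
\<close>

lemma adjunction_comp:
  assumes FG: "adjunction A B F G \<eta> \<epsilon>" and FG': "adjunction B E F' G' \<eta>' \<epsilon>'"
  shows "adjunction A E (comp_functor A F' F) (comp_functor E G G')
           (\<lambda>a \<in> Obj A. ArrMap G (\<eta>' (ObjMap F a)) \<odot>\<^bsub>A\<^esub> \<eta> a)
           (\<lambda>e \<in> Obj E. \<epsilon>' e \<odot>\<^bsub>E\<^esub> ArrMap F' (\<epsilon> (ObjMap G' e)))"
    (is "adjunction A E ?F ?G ?\<eta> ?\<epsilon>")
proof -
  interpret F: functor_between A B F using FG by (auto simp: adjunction_def intro: functor_betweenI)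
  interpret G: functor_between B A G using FG by (auto simp: adjunction_def intro: functor_betweenI)
  interpret F': functor_between B E F' using FG' by (auto simp: adjunction_def intro: functor_betweenI)
  interpret G': functor_between E B G' using FG' by (auto simp: adjunction_def intro: functor_betweenI)
  interpret \<eta>: transformation A A "id_functor A" "comp_functor A G F" \<eta>
    using FG by (auto simp: adjunction_def intro: transformationI)
  interpret \<epsilon>: transformation B B "comp_functor B F G" "id_functor B" \<epsilon>
    using FG by (auto simp: adjunction_def intro: transformationI)
  interpret \<eta>': transformation B B "id_functor B" "comp_functor B G' F'" \<eta>'
    using FG' by (auto simp: adjunction_def intro: transformationI)
  interpret \<epsilon>': transformation E E "comp_functor E F' G'" "id_functor E" \<epsilon>'
    using FG' by (auto simp: adjunction_def intro: transformationI)
  have tri: "\<And>a. a \<in> Obj A \<Longrightarrow> \<epsilon> (ObjMap F a) \<odot>\<^bsub>B\<^esub> ArrMap F (\<eta> a) = Ident B (ObjMap F a)"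
    "\<And>b. b \<in> Obj B \<Longrightarrow> ArrMap G (\<epsilon> b) \<odot>\<^bsub>A\<^esub> \<eta> (ObjMap G b) = Ident A (ObjMap G b)"
    "\<And>b. b \<in> Obj B \<Longrightarrow> \<epsilon>' (ObjMap F' b) \<odot>\<^bsub>E\<^esub> ArrMap F' (\<eta>' b) = Ident E (ObjMap F' b)"
    "\<And>e. e \<in> Obj E \<Longrightarrow> ArrMap G' (\<epsilon>' e) \<odot>\<^bsub>B\<^esub> \<eta>' (ObjMap G' e) = Ident B (ObjMap G' e)"
    using FG FG' by (auto simp: adjunction_def)
  have fun_F: "is_functor A E ?F" and fun_G: "is_functor E A ?G"
    using is_functor_comp F.functorial G.functorial F'.functorial G'.functorial by blast+
  have nat_\<eta>: "ArrMap G (\<eta>' (ObjMap F (Cod A f))) \<odot>\<^bsub>A\<^esub> (\<eta> (Cod A f) \<odot>\<^bsub>A\<^esub> f) =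
      ArrMap G (ArrMap G' (ArrMap F' (ArrMap F f))) \<odot>\<^bsub>A\<^esub>
        (ArrMap G (\<eta>' (ObjMap F (Dom A f))) \<odot>\<^bsub>A\<^esub> \<eta> (Dom A f))" if f: "f \<in> Arr A" for f
  proof -
    have "ArrMap G (\<eta>' (ObjMap F (Cod A f))) \<odot>\<^bsub>A\<^esub> (\<eta> (Cod A f) \<odot>\<^bsub>A\<^esub> f) =
        ArrMap G (\<eta>' (ObjMap F (Cod A f)) \<odot>\<^bsub>B\<^esub> ArrMap F f) \<odot>\<^bsub>A\<^esub> \<eta> (Dom A f)"
      using \<eta>.naturality[OF f refl refl] f by simp
    also have "\<eta>' (ObjMap F (Cod A f)) \<odot>\<^bsub>B\<^esub> ArrMap F f =
        ArrMap G' (ArrMap F' (ArrMap F f)) \<odot>\<^bsub>B\<^esub> \<eta>' (ObjMap F (Dom A f))"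
      using \<eta>'.naturality[of "ArrMap F f"] f by simp
    finally show ?thesis using f by simp
  qed
  have nat_\<epsilon>: "\<epsilon>' (Cod E f) \<odot>\<^bsub>E\<^esub> (ArrMap F' (\<epsilon> (ObjMap G' (Cod E f))) \<odot>\<^bsub>E\<^esub>
        ArrMap F' (ArrMap F (ArrMap G (ArrMap G' f)))) =
      f \<odot>\<^bsub>E\<^esub> (\<epsilon>' (Dom E f) \<odot>\<^bsub>E\<^esub> ArrMap F' (\<epsilon> (ObjMap G' (Dom E f))))" if f: "f \<in> Arr E" for f
  proof -
    have "\<epsilon> (ObjMap G' (Cod E f)) \<odot>\<^bsub>B\<^esub> ArrMap F (ArrMap G (ArrMap G' f)) =
        ArrMap G' f \<odot>\<^bsub>B\<^esub> \<epsilon> (ObjMap G' (Dom E f))"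
      using \<epsilon>.naturality[of "ArrMap G' f"] f by simp
    from arg_cong[OF this, of "ArrMap F'"]
    have "ArrMap F' (\<epsilon> (ObjMap G' (Cod E f))) \<odot>\<^bsub>E\<^esub> ArrMap F' (ArrMap F (ArrMap G (ArrMap G' f))) =
        ArrMap F' (ArrMap G' f) \<odot>\<^bsub>E\<^esub> ArrMap F' (\<epsilon> (ObjMap G' (Dom E f)))" using f by simp
    then show ?thesis
      using \<epsilon>'.naturality_precompose[of f "Dom E f" "Cod E f" "ArrMap F' (\<epsilon> (ObjMap G' (Dom E f)))"] f by simp
  qed
  have "?\<epsilon> (ObjMap ?F a) \<odot>\<^bsub>E\<^esub> ArrMap ?F (?\<eta> a) = Ident E (ObjMap ?F a)" if a: "a \<in> Obj A" for a
  proof -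
    let ?b = "ObjMap F a"
    have "?\<epsilon> (ObjMap ?F a) \<odot>\<^bsub>E\<^esub> ArrMap ?F (?\<eta> a) =
      \<epsilon>' (ObjMap F' ?b) \<odot>\<^bsub>E\<^esub> ArrMap F' (\<epsilon> (ObjMap G' (ObjMap F' ?b)) \<odot>\<^bsub>B\<^esub>
        (ArrMap F (ArrMap G (\<eta>' ?b)) \<odot>\<^bsub>B\<^esub> ArrMap F (\<eta> a)))" using a by simp
    also have "\<epsilon> (ObjMap G' (ObjMap F' ?b)) \<odot>\<^bsub>B\<^esub> (ArrMap F (ArrMap G (\<eta>' ?b)) \<odot>\<^bsub>B\<^esub> ArrMap F (\<eta> a))
        = \<eta>' ?b"
      using \<epsilon>.naturality_precompose[OF _ refl refl, of "\<eta>' ?b" "ArrMap F (\<eta> a)"] tri(1)[OF a] a by simp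
    finally show ?thesis using tri(3)[of ?b] a by simp
  qed
  moreover have "ArrMap ?G (?\<epsilon> e) \<odot>\<^bsub>A\<^esub> ?\<eta> (ObjMap ?G e) = Ident A (ObjMap ?G e)"
    if e: "e \<in> Obj E" for e
  proof -
    let ?b = "ObjMap G' e"
    have "\<eta>' ?b \<odot>\<^bsub>B\<^esub> \<epsilon> ?b = ArrMap G' (ArrMap F' (\<epsilon> ?b)) \<odot>\<^bsub>B\<^esub> \<eta>' (ObjMap F (ObjMap G ?b))"
      using \<eta>'.naturality[OF _ refl refl, of "\<epsilon> ?b"] e by simp
    from arg_cong[OF this, of "\<lambda>x. ArrMap G x \<odot>\<^bsub>A\<^esub> \<eta> (ObjMap G ?b)"]
    have "ArrMap G (ArrMap G' (ArrMap F' (\<epsilon> ?b))) \<odot>\<^bsub>A\<^esub>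
        (ArrMap G (\<eta>' (ObjMap F (ObjMap G ?b))) \<odot>\<^bsub>A\<^esub> \<eta> (ObjMap G ?b)) = ArrMap G (\<eta>' ?b)"
      using tri(2)[of ?b] e by simp
    then show ?thesis using arg_cong[OF tri(4)[OF e], of "ArrMap G"] e by simp
  qed
  ultimately show ?thesis
    unfolding adjunction_def
    by (intro conjI ballI fun_F fun_G nat_transI is_functor_id is_functor_comp[OF fun_F fun_G]
        is_functor_comp[OF fun_G fun_F] F.A.category_axioms F'.B.category_axioms)
      (auto simp: Hom_def nat_\<eta> nat_\<epsilon>)
qed

lemma left_adjoint_comp:
  "left_adjoint A B F \<Longrightarrow> left_adjoint B E G \<Longrightarrow> left_adjoint A E (comp_functor A G F)"
  unfolding left_adjoint_def using adjunction_comp by blast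

lemma left_adjoint_id:
  assumes "category A" shows "left_adjoint A A (id_functor A)"
proof -
  interpret category A by fact
  note id = is_functor_id[OF assms]
  have "adjunction A A (id_functor A) (id_functor A) (\<lambda>a\<in>Obj A. Ident A a) (\<lambda>a\<in>Obj A. Ident A a)"
    unfolding adjunction_def
    by (intro conjI ballI id nat_transI is_functor_comp[OF id id]) (auto simp: Hom_def)
  then show ?thesis unfolding left_adjoint_def by blast
qed

text \<open>
  Choose for each \<open>b\<close> an object \<open>g b\<close> and an isomorphism \<open>e b\<close> from \<open>F (g b)\<close> to \<open>b\<close> with inverse
  \<open>e' b\<close>. The quasi-inverse sends \<open>u\<close> to the unique lift along \<open>F\<close> of the conjugate of \<open>u\<close> by these
  isomorphisms. The counit is \<open>e\<close>, the unit is the lift of \<open>e'\<close>, and every equation in \<open>A\<close> is verified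
  after applying \<open>F\<close>.
\<close>

lemma equivalence_if_fully_faithful_ess_surj:
  assumes F: "is_functor A B F"
    and faithful: "\<And>f g. \<lbrakk>f \<in> Arr A; g \<in> Arr A; Dom A f = Dom A g; Cod A f = Cod A g;
          ArrMap F f = ArrMap F g\<rbrakk> \<Longrightarrow> f = g"
    and full: "\<And>a a' g. \<lbrakk>a \<in> Obj A; a' \<in> Obj A; g \<in> Hom B (ObjMap F a) (ObjMap F a')\<rbrakk>
          \<Longrightarrow> \<exists>f \<in> Hom A a a'. ArrMap F f = g"
    and ess_surj: "\<And>b. b \<in> Obj B \<Longrightarrow> \<exists>a \<in> Obj A. \<exists>e \<in> Hom B (ObjMap F a) b. is_iso B e"
  shows "\<exists>G. equivalence_of_cats A B F G"
proof -
  interpret F: functor_between A B F by (rule functor_betweenI) fact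
  have "\<exists>a e e'. a \<in> Obj A \<and> e \<in> Hom B (ObjMap F a) b \<and> e' \<in> Hom B b (ObjMap F a) \<and>
      e' \<odot>\<^bsub>B\<^esub> e = Ident B (ObjMap F a) \<and> e \<odot>\<^bsub>B\<^esub> e' = Ident B b" if "b \<in> Obj B" for b
    using ess_surj[OF that] unfolding is_iso_def Hom_def by force
  then obtain g e e' where g: "\<And>b. b \<in> Obj B \<Longrightarrow> g b \<in> Obj A"
    and e: "\<And>b. b \<in> Obj B \<Longrightarrow> e b \<in> Hom B (ObjMap F (g b)) b"
    and e': "\<And>b. b \<in> Obj B \<Longrightarrow> e' b \<in> Hom B b (ObjMap F (g b))"
    and e'e: "\<And>b. b \<in> Obj B \<Longrightarrow> e' b \<odot>\<^bsub>B\<^esub> e b = Ident B (ObjMap F (g b))"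
    and ee': "\<And>b. b \<in> Obj B \<Longrightarrow> e b \<odot>\<^bsub>B\<^esub> e' b = Ident B b" by metis
  note [simp] = g e[unfolded Hom_def, simplified] e'[unfolded Hom_def, simplified] e'e ee'
  have [simp]: "e b \<odot>\<^bsub>B\<^esub> (e' b \<odot>\<^bsub>B\<^esub> x) = x" if "b \<in> Obj B" "x \<in> Arr B" "Cod B x = b" for b x
    using that F.B.precompose[OF ee'[OF that(1)], of x] by auto
  have [simp]: "e' b \<odot>\<^bsub>B\<^esub> (e b \<odot>\<^bsub>B\<^esub> x) = x"
    if "b \<in> Obj B" "x \<in> Arr B" "Cod B x = ObjMap F (g b)" for b x
    using that F.B.precompose[OF e'e[OF that(1)], of x] by auto
  define lift where "lift a a' u = (SOME f. f \<in> Hom A a a' \<and> ArrMap F f = u)" for a a' u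
  have lift: "lift a a' u \<in> Hom A a a' \<and> ArrMap F (lift a a' u) = u"
    if "a \<in> Obj A" "a' \<in> Obj A" "u \<in> Arr B" "Dom B u = ObjMap F a" "Cod B u = ObjMap F a'" for a a' u
    unfolding lift_def by (rule someI_ex) (use full[of a a' u] that in \<open>auto simp: Hom_def\<close>)
  have lift' [simp]: "lift a a' u \<in> Arr A" "Dom A (lift a a' u) = a" "Cod A (lift a a' u) = a'"
    "ArrMap F (lift a a' u) = u"
    if "a \<in> Obj A" "a' \<in> Obj A" "u \<in> Arr B" "Dom B u = ObjMap F a" "Cod B u = ObjMap F a'" for a a' u
    using lift[OF that] by (auto simp: Hom_def)
  define G where "G = \<lparr>ObjMap = (\<lambda>b\<in>Obj B. g b),
    ArrMap = (\<lambda>u\<in>Arr B. lift (g (Dom B u)) (g (Cod B u)) (e' (Cod B u) \<odot>\<^bsub>B\<^esub> (u \<odot>\<^bsub>B\<^esub> e (Dom B u))))\<rparr>"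
  have G: "is_functor B A G"
    unfolding is_functor_def
  proof (intro conjI ballI impI F.A.category_axioms F.B.category_axioms)
    show "ArrMap G (Ident B b) = Ident A (ObjMap G b)" if "b \<in> Obj B" for b
      using that by (intro faithful) (auto simp: G_def)
    show "ArrMap G (v \<odot>\<^bsub>B\<^esub> u) = ArrMap G v \<odot>\<^bsub>A\<^esub> ArrMap G u"
      if "u \<in> Arr B" "v \<in> Arr B" "Cod B u = Dom B v" for u v
      using that by (intro faithful) (auto simp: G_def)
  qed (auto simp: G_def Hom_def)
  define \<eta> where "\<eta> = (\<lambda>a\<in>Obj A. lift a (g (ObjMap F a)) (e' (ObjMap F a)))"
  define \<eta>' where "\<eta>' = (\<lambda>a\<in>Obj A. lift (g (ObjMap F a)) a (e (ObjMap F a)))"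
  have "nat_iso A A (id_functor A) (comp_functor A G F) \<eta>"
    unfolding nat_iso_def
  proof (intro conjI ballI nat_transI is_functor_id is_functor_comp[OF F G] F.A.category_axioms)
    show "\<eta> (Cod A f) \<odot>\<^bsub>A\<^esub> ArrMap (id_functor A) f = ArrMap (comp_functor A G F) f \<odot>\<^bsub>A\<^esub> \<eta> (Dom A f)"
      if "f \<in> Arr A" for f
      using that by (intro faithful) (auto simp: G_def \<eta>_def)
    show "is_iso A (\<eta> a)" if a: "a \<in> Obj A" for a
    proof (rule is_isoI)
      show "\<eta>' a \<odot>\<^bsub>A\<^esub> \<eta> a = Ident A a" "\<eta> a \<odot>\<^bsub>A\<^esub> \<eta>' a = Ident A (g (ObjMap F a))"
        using a by (intro faithful; auto simp: \<eta>_def \<eta>'_def)+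
    qed (use a in \<open>auto simp: \<eta>_def \<eta>'_def Hom_def\<close>)
  qed (auto simp: \<eta>_def G_def Hom_def)
  moreover have "nat_iso B B (comp_functor B F G) (id_functor B) (\<lambda>b\<in>Obj B. e b)"
    unfolding nat_iso_def
  proof (intro conjI ballI nat_transI is_functor_id is_functor_comp[OF G F] F.B.category_axioms)
    show "is_iso B ((\<lambda>b\<in>Obj B. e b) b)" if b: "b \<in> Obj B" for b
      using b by (auto intro!: is_isoI[of _ B "ObjMap F (g b)" b "e' b"] simp: Hom_def)
  qed (auto simp: G_def Hom_def)
  ultimately show ?thesis unfolding equivalence_of_cats_def using F G by blast
qed

section \<open>Monads and comorphisms\<close>

locale monad_on = T: functor_between E E "mfun T"
  for E :: "('o, 'm) cat" and T :: "('o, 'm) monad" +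
  assumes monad: "is_monad E T"
begin

sublocale unit: transformation E E "id_functor E" "mfun T" "munit T"
  using monad by (auto simp: is_monad_def intro: transformationI)

sublocale mult: transformation E E "comp_functor E (mfun T) (mfun T)" "mfun T" "mmult T"
  using monad by (auto simp: is_monad_def intro: transformationI)

lemma unit_laws:
  "a \<in> Obj E \<Longrightarrow> mmult T a \<odot>\<^bsub>E\<^esub> ArrMap (mfun T) (munit T a) = Ident E (ObjMap (mfun T) a)"
  "a \<in> Obj E \<Longrightarrow> mmult T a \<odot>\<^bsub>E\<^esub> munit T (ObjMap (mfun T) a) = Ident E (ObjMap (mfun T) a)"
  and mult_law: "a \<in> Obj E \<Longrightarrow> mmult T a \<odot>\<^bsub>E\<^esub> ArrMap (mfun T) (mmult T a) =
    mmult T a \<odot>\<^bsub>E\<^esub> mmult T (ObjMap (mfun T) a)"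
  using monad by (auto simp: is_monad_def)

end

lemma monad_onI: "is_monad E T \<Longrightarrow> monad_on E T"
  unfolding monad_on_def monad_on_axioms_def by (auto simp: is_monad_def intro: functor_betweenI)

locale comorphism_between = T: monad_on E T + S: monad_on A S + F: functor_between E A F
  for E :: "('o, 'm) cat" and T :: "('o, 'm) monad"
    and A :: "('p, 'n) cat" and S :: "('p, 'n) monad" and F +
  fixes \<chi> :: "'o \<Rightarrow> 'n"
  assumes comorphism: "comorphism E T A S F \<chi>"
begin

sublocale tr: transformation E A "comp_functor E F (mfun T)" "comp_functor E (mfun S) F" \<chi>
  using comorphism by (auto simp: comorphism_def intro: transformationI)

lemma unit_compat: "a \<in> Obj E \<Longrightarrow> \<chi> a \<odot>\<^bsub>A\<^esub> ArrMap F (munit T a) = munit S (ObjMap F a)"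
  and mult_compat: "a \<in> Obj E \<Longrightarrow> \<chi> a \<odot>\<^bsub>A\<^esub> ArrMap F (mmult T a) =
        mmult S (ObjMap F a) \<odot>\<^bsub>A\<^esub> (ArrMap (mfun S) (\<chi> a) \<odot>\<^bsub>A\<^esub> \<chi> (ObjMap (mfun T) a))"
  using comorphism by (auto simp: comorphism_def)

end

lemma comorphism_betweenI: "comorphism E T A S F \<chi> \<Longrightarrow> comorphism_between E T A S F \<chi>"
  unfolding comorphism_between_def comorphism_between_axioms_def
  by (auto simp: comorphism_def intro: functor_betweenI monad_onI)

lemma comorphism_id:
  assumes "is_monad E T"
  shows "comorphism E T E T (id_functor E) (\<lambda>a\<in>Obj E. Ident E (ObjMap (mfun T) a))"
proof -
  interpret monad_on E T by (rule monad_onI) fact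
  note id = is_functor_id[OF T.A.category_axioms]
  show ?thesis
    unfolding comorphism_def
    by (intro conjI ballI assms id nat_transI is_functor_comp[OF T.functorial id]
        is_functor_comp[OF id T.functorial]) (auto simp: Hom_def)
qed

text \<open>
  The multiplication law of the composite is a pasting: the law of \<open>\<chi>\<close> under \<open>G\<close>, then the law of \<open>\<psi>\<close>
  at \<open>F a\<close>, then naturality of \<open>\<psi>\<close> at \<open>\<chi> a\<close>.
\<close>

lemma comorphism_comp:
  assumes "comorphism E T A S F \<chi>" "comorphism A S B R G \<psi>"
  shows "comorphism E T B R (comp_functor E G F)
           (\<lambda>a\<in>Obj E. \<psi> (ObjMap F a) \<odot>\<^bsub>B\<^esub> ArrMap G (\<chi> a))"
proof -
  interpret F: comorphism_between E T A S F \<chi> by (rule comorphism_betweenI) fact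
  interpret G: comorphism_between A S B R G \<psi> by (rule comorphism_betweenI) fact
  note GF = is_functor_comp[OF F.F.functorial G.F.functorial]
  have nat: "\<psi> (ObjMap F (Cod E f)) \<odot>\<^bsub>B\<^esub> (ArrMap G (\<chi> (Cod E f)) \<odot>\<^bsub>B\<^esub>
        ArrMap G (ArrMap F (ArrMap (mfun T) f))) =
      ArrMap (mfun R) (ArrMap G (ArrMap F f)) \<odot>\<^bsub>B\<^esub> (\<psi> (ObjMap F (Dom E f)) \<odot>\<^bsub>B\<^esub> ArrMap G (\<chi> (Dom E f)))"
    if f: "f \<in> Arr E" for f
  proof -
    have "ArrMap G (\<chi> (Cod E f)) \<odot>\<^bsub>B\<^esub> ArrMap G (ArrMap F (ArrMap (mfun T) f)) =
        ArrMap G (ArrMap (mfun S) (ArrMap F f)) \<odot>\<^bsub>B\<^esub> ArrMap G (\<chi> (Dom E f))"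
      using arg_cong[OF F.tr.naturality[OF f refl refl], of "ArrMap G"] f by simp
    then show ?thesis
      using G.tr.naturality_precompose[OF _ refl refl, of "ArrMap F f" "ArrMap G (\<chi> (Dom E f))"] f by simp
  qed
  have mult: "\<psi> (ObjMap F a) \<odot>\<^bsub>B\<^esub> (ArrMap G (\<chi> a) \<odot>\<^bsub>B\<^esub> ArrMap G (ArrMap F (mmult T a))) =
      mmult R (ObjMap G (ObjMap F a)) \<odot>\<^bsub>B\<^esub> (ArrMap (mfun R) (\<psi> (ObjMap F a)) \<odot>\<^bsub>B\<^esub>
        (ArrMap (mfun R) (ArrMap G (\<chi> a)) \<odot>\<^bsub>B\<^esub>
          (\<psi> (ObjMap F (ObjMap (mfun T) a)) \<odot>\<^bsub>B\<^esub> ArrMap G (\<chi> (ObjMap (mfun T) a)))))"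
    if a: "a \<in> Obj E" for a
  proof -
    let ?x = "ArrMap G (ArrMap (mfun S) (\<chi> a)) \<odot>\<^bsub>B\<^esub> ArrMap G (\<chi> (ObjMap (mfun T) a))"
    have "ArrMap G (\<chi> a) \<odot>\<^bsub>B\<^esub> ArrMap G (ArrMap F (mmult T a)) = ArrMap G (mmult S (ObjMap F a)) \<odot>\<^bsub>B\<^esub> ?x"
      using arg_cong[OF F.mult_compat[OF a], of "ArrMap G"] a by simp
    moreover have "\<psi> (ObjMap F a) \<odot>\<^bsub>B\<^esub> (ArrMap G (mmult S (ObjMap F a)) \<odot>\<^bsub>B\<^esub> ?x) =
        mmult R (ObjMap G (ObjMap F a)) \<odot>\<^bsub>B\<^esub> (ArrMap (mfun R) (\<psi> (ObjMap F a)) \<odot>\<^bsub>B\<^esub>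
          (\<psi> (ObjMap (mfun S) (ObjMap F a)) \<odot>\<^bsub>B\<^esub> ?x))"
      using arg_cong[OF G.mult_compat[of "ObjMap F a"], of "\<lambda>z. z \<odot>\<^bsub>B\<^esub> ?x"] a by simp
    moreover have "\<psi> (ObjMap (mfun S) (ObjMap F a)) \<odot>\<^bsub>B\<^esub> ?x =
        ArrMap (mfun R) (ArrMap G (\<chi> a)) \<odot>\<^bsub>B\<^esub>
          (\<psi> (ObjMap F (ObjMap (mfun T) a)) \<odot>\<^bsub>B\<^esub> ArrMap G (\<chi> (ObjMap (mfun T) a)))"
      using G.tr.naturality_precompose[OF _ refl refl, of "\<chi> a" "ArrMap G (\<chi> (ObjMap (mfun T) a))"] a by simp
    ultimately show ?thesis by simp
  qed
  have unit: "\<psi> (ObjMap F a) \<odot>\<^bsub>B\<^esub> (ArrMap G (\<chi> a) \<odot>\<^bsub>B\<^esub> ArrMap G (ArrMap F (munit T a))) =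
      munit R (ObjMap G (ObjMap F a))" if a: "a \<in> Obj E" for a
    using arg_cong[OF F.unit_compat[OF a], of "ArrMap G"] G.unit_compat[of "ObjMap F a"] a by simp
  show ?thesis
    unfolding comorphism_def
    by (intro conjI ballI F.T.monad G.S.monad GF nat_transI is_functor_comp[OF F.T.T.functorial GF]
        is_functor_comp[OF GF G.S.T.functorial])
      (auto simp: Hom_def nat mult unit)
qed

lemma category_Mnd_co_adj: "category (Mnd_co_adj :: (('o, 'm) catmnd, ('o, 'm) mndco) cat)"
proof -
  have D: "category E \<and> is_monad E T \<and> is_monad A S \<and> is_functor E A F \<and>
      is_functor A A (mfun S) \<and> \<chi> \<in> extensional (Obj E) \<and>
      (\<forall>a\<in>Obj E. ObjMap F a \<in> Obj A \<and> ObjMap (mfun T) a \<in> Obj E)"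
    if "comorphism E T A S F \<chi>" for E A :: "('o, 'm) cat" and T S F \<chi>
  proof -
    interpret comorphism_between E T A S F \<chi> by (rule comorphism_betweenI) fact
    show ?thesis using T.monad S.monad F.functorial S.T.functorial by (auto simp: is_functor_def)
  qed
  show ?thesis
  proof
    fix x assume "x \<in> Arr (Mnd_co_adj :: (('o, 'm) catmnd, ('o, 'm) mndco) cat)"
    then show "Dom Mnd_co_adj x \<in> Obj Mnd_co_adj" "Cod Mnd_co_adj x \<in> Obj Mnd_co_adj"
      by (auto simp: Mnd_co_adj_def dest: D)
  next
    fix a assume "a \<in> Obj (Mnd_co_adj :: (('o, 'm) catmnd, ('o, 'm) mndco) cat)"
    then show "Ident Mnd_co_adj a \<in> Hom Mnd_co_adj a a"
      by (auto simp: Mnd_co_adj_def Hom_def is_monad_def is_functor_def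
          intro: comorphism_id[unfolded is_monad_def is_functor_def] left_adjoint_id)
  next
    fix f g :: "('o, 'm) mndco" and a b c
    assume "f \<in> Hom Mnd_co_adj a b" "g \<in> Hom Mnd_co_adj b c"
    then show "g \<odot>\<^bsub>Mnd_co_adj\<^esub> f \<in> Hom Mnd_co_adj a c"
      by (auto simp: Mnd_co_adj_def Hom_def intro: comorphism_comp left_adjoint_comp)
  next
    fix f :: "('o, 'm) mndco" and a b
    assume f: "f \<in> Hom Mnd_co_adj a b"
    obtain E T F \<chi> A S where eq: "f = ((E, T), F, \<chi>, (A, S))" by (cases f) auto
    have "comorphism E T A S F \<chi>" using f eq by (auto simp: Mnd_co_adj_def Hom_def)
    then interpret comorphism_between E T A S F \<chi> by (rule comorphism_betweenI)
    show "Ident Mnd_co_adj b \<odot>\<^bsub>Mnd_co_adj\<^esub> f = f" "f \<odot>\<^bsub>Mnd_co_adj\<^esub> Ident Mnd_co_adj a = f"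
      using f eq
      by (auto simp: Mnd_co_adj_def Hom_def comp_functor_id[OF F.functorial]
          intro!: extensionalityI[where A = "Obj E"])
  next
    fix f g h :: "('o, 'm) mndco" and a b c d
    assume fgh: "f \<in> Hom Mnd_co_adj a b" "g \<in> Hom Mnd_co_adj b c" "h \<in> Hom Mnd_co_adj c d"
    obtain E T F \<chi> A S where f: "f = ((E, T), F, \<chi>, (A, S))" by (cases f) auto
    obtain G \<psi> B R where g: "g = ((A, S), G, \<psi>, (B, R))"
      using fgh f by (cases g) (auto simp: Mnd_co_adj_def Hom_def)
    obtain H \<theta> D Q where h: "h = ((B, R), H, \<theta>, (D, Q))"
      using fgh g by (cases h) (auto simp: Mnd_co_adj_def Hom_def)
    interpret F: comorphism_between E T A S F \<chi>
      using fgh f by (intro comorphism_betweenI) (auto simp: Mnd_co_adj_def Hom_def)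
    interpret G: comorphism_between A S B R G \<psi>
      using fgh g by (intro comorphism_betweenI) (auto simp: Mnd_co_adj_def Hom_def)
    interpret H: comorphism_between B R D Q H \<theta>
      using fgh h by (intro comorphism_betweenI) (auto simp: Mnd_co_adj_def Hom_def)
    show "h \<odot>\<^bsub>Mnd_co_adj\<^esub> g \<odot>\<^bsub>Mnd_co_adj\<^esub> f = h \<odot>\<^bsub>Mnd_co_adj\<^esub> (g \<odot>\<^bsub>Mnd_co_adj\<^esub> f)"
      unfolding f g h
      by (auto simp: Mnd_co_adj_def comp_functor_assoc[OF F.F.functorial] intro!: restrict_ext)
  qed
qed

section \<open>Pullbacks\<close>

locale category_with_pullbacks = category C for C :: "('o, 'm) cat" (structure) +
  assumes ex_pullback: "\<lbrakk>f \<in> Arr C; g \<in> Arr C; Cod C f = Cod C g\<rbrakk> \<Longrightarrow> \<exists>p q. is_pullback C f g p q"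
begin

text \<open>
  The universal property is stated as a rule with separate premises because the unique existence
  under quantifiers is unsuitable for automatic proof search.
\<close>

lemma is_pullbackD:
  assumes "is_pullback C f g p q"
  shows "p \<in> Arr C" "q \<in> Arr C" "Dom C p = Dom C q" "Cod C p = Dom C f" "Cod C q = Dom C g"
    "f \<odot> p = g \<odot> q"
    "\<lbrakk>a \<in> Arr C; b \<in> Arr C; Dom C a = Dom C b; Cod C a = Dom C f; Cod C b = Dom C g; f \<odot> a = g \<odot> b\<rbrakk>
      \<Longrightarrow> \<exists>!u. u \<in> Hom C (Dom C b) (Dom C p) \<and> p \<odot> u = a \<and> q \<odot> u = b"
proof -
  have *: "\<forall>w. \<forall>a\<in>Hom C w (Dom C f). \<forall>b\<in>Hom C w (Dom C g). f \<odot> a = g \<odot> b \<longrightarrow>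
      (\<exists>!u. u \<in> Hom C w (Dom C p) \<and> p \<odot> u = a \<and> q \<odot> u = b)"
    using assms unfolding is_pullback_def by (elim conjE)
  show "\<lbrakk>a \<in> Arr C; b \<in> Arr C; Dom C a = Dom C b; Cod C a = Dom C f; Cod C b = Dom C g; f \<odot> a = g \<odot> b\<rbrakk>
      \<Longrightarrow> \<exists>!u. u \<in> Hom C (Dom C b) (Dom C p) \<and> p \<odot> u = a \<and> q \<odot> u = b"
    by (rule *[rule_format]) (simp_all add: Hom_def)
  have "p \<in> Arr C \<and> q \<in> Arr C \<and> Dom C p = Dom C q \<and> Cod C p = Dom C f \<and> Cod C q = Dom C g \<and>
      f \<odot> p = g \<odot> q"
    using assms unfolding is_pullback_def by (elim conjE) (intro conjI)
  then show "p \<in> Arr C" "q \<in> Arr C" "Dom C p = Dom C q" "Cod C p = Dom C f" "Cod C q = Dom C g"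
    "f \<odot> p = g \<odot> q" by auto
qed

lemma is_pullback_pr:
  assumes "f \<in> Arr C" "g \<in> Arr C" "Cod C f = Cod C g"
  shows "is_pullback C f g (pr1 C f g) (pr2 C f g)"
  unfolding pr1_def pr2_def chosen_pullback_def
  using someI_ex[of "\<lambda>pq. is_pullback C f g (fst pq) (snd pq)"] ex_pullback[OF assms] by auto

lemma Dom_pr1 [simp]: "Dom C (pr1 C f g) = pb C f g"
  by (simp add: pb_def)

context
  fixes f g
  assumes cospan: "f \<in> Arr C" "g \<in> Arr C" "Cod C f = Cod C g"
begin

lemma pr_simps [simp]:
  shows pr_arr: "pr1 C f g \<in> Arr C" "pr2 C f g \<in> Arr C"
    "Dom C (pr2 C f g) = pb C f g" "Cod C (pr1 C f g) = Dom C f" "Cod C (pr2 C f g) = Dom C g"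
    "pb C f g \<in> Obj C"
    and pr_eq: "f \<odot> pr1 C f g = g \<odot> pr2 C f g"
  using is_pullbackD(1-6)[OF is_pullback_pr[OF cospan]] dom_in_obj[of "pr1 C f g"] by auto

lemma pr_eq_precompose [simp]: "\<lbrakk>x \<in> Arr C; Cod C x = pb C f g\<rbrakk>
    \<Longrightarrow> f \<odot> (pr1 C f g \<odot> x) = g \<odot> (pr2 C f g \<odot> x)"
  using cospan by (intro precompose2[OF pr_eq]) auto

lemma pb_eqI:
  assumes "u \<in> Arr C" "v \<in> Arr C" "Cod C u = pb C f g" "Cod C v = pb C f g" "Dom C u = Dom C v"
    "pr1 C f g \<odot> u = pr1 C f g \<odot> v" "pr2 C f g \<odot> u = pr2 C f g \<odot> v"
  shows "u = v"
proof -
  have "\<exists>!w. w \<in> Hom C (Dom C u) (pb C f g) \<and> pr1 C f g \<odot> w = pr1 C f g \<odot> u \<and> pr2 C f g \<odot> w = pr2 C f g \<odot> u"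
    using is_pullbackD(7)[OF is_pullback_pr[OF cospan], of "pr1 C f g \<odot> u" "pr2 C f g \<odot> u"]
      assms cospan pr_eq_precompose[of u] by simp
  moreover have "u \<in> Hom C (Dom C u) (pb C f g)" "v \<in> Hom C (Dom C u) (pb C f g)"
    using assms by (auto simp: Hom_def)
  ultimately show ?thesis using assms(6,7) by metis
qed

context
  fixes a b
  assumes cone: "a \<in> Arr C" "b \<in> Arr C" "Dom C a = Dom C b" "Cod C a = Dom C f" "Cod C b = Dom C g"
    "f \<odot> a = g \<odot> b"
begin

lemma pb_pair_simps [simp]:
  "pb_pair C f g a b \<in> Arr C" "Dom C (pb_pair C f g a b) = Dom C b"
  "Cod C (pb_pair C f g a b) = pb C f g"
  "pr1 C f g \<odot> pb_pair C f g a b = a" "pr2 C f g \<odot> pb_pair C f g a b = b"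
proof -
  have "\<exists>!u. u \<in> Hom C (Dom C a) (pb C f g) \<and> pr1 C f g \<odot> u = a \<and> pr2 C f g \<odot> u = b"
    using is_pullbackD(7)[OF is_pullback_pr[OF cospan] cone] cone(3) by simp
  from theI'[OF this]
  show "pb_pair C f g a b \<in> Arr C" "Dom C (pb_pair C f g a b) = Dom C b"
    "Cod C (pb_pair C f g a b) = pb C f g"
    "pr1 C f g \<odot> pb_pair C f g a b = a" "pr2 C f g \<odot> pb_pair C f g a b = b"
    unfolding pb_pair_def using cone by (auto simp: Hom_def)
qed

lemma pr_pb_pair_precompose [simp]:
  assumes "x \<in> Arr C" "Cod C x = Dom C b"
  shows "pr1 C f g \<odot> (pb_pair C f g a b \<odot> x) = a \<odot> x" "pr2 C f g \<odot> (pb_pair C f g a b \<odot> x) = b \<odot> x"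
  using cospan assms
  by (auto intro: precompose[OF pb_pair_simps(4)] precompose[OF pb_pair_simps(5)])

end
end

end

text \<open>
  The arrows 0, 1, 2 are the identities; 3 goes from 0 to 2 and 4 goes from 1 to 2.
\<close>

definition cospan_shape :: "(nat, nat) cat" where
  "cospan_shape = \<lparr>Obj = {0, 1, 2}, Arr = {0, 1, 2, 3, 4},
     Dom = (\<lambda>f. if f = 3 then 0 else if f = 4 then 1 else f), Cod = (\<lambda>f. if f \<ge> 3 then 2 else f),
     Ident = (\<lambda>a. a), Comp = (\<lambda>g f. if g < 3 then f else g)\<rparr>"

lemma category_cospan_shape: "category cospan_shape"
  unfolding category_def by (auto simp: cospan_shape_def Hom_def split: if_splits)

text \<open>
  In a cone over a cospan the component at the vertex 2 is determined by the other two, so limit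
  cones over the cospan are exactly pullback squares.
\<close>

lemma category_with_pullbacksI:
  fixes C :: "('o, 'm) cat"
  assumes "category C" "has_finite_limits C"
  shows "category_with_pullbacks C"
proof -
  interpret category C by fact
  have "\<exists>p q. is_pullback C f g p q" if fg: "f \<in> Arr C" "g \<in> Arr C" "Cod C f = Cod C g" for f g
  proof -
    define ob where "ob j = (if j = 0 then Dom C f else if j = 1 then Dom C g else Cod C f)" for j :: nat
    define D where "D = \<lparr>ObjMap = (\<lambda>j\<in>Obj cospan_shape. ob j),
      ArrMap = (\<lambda>k\<in>Arr cospan_shape. if k = 3 then f else if k = 4 then g else Ident C (ob k))\<rparr>"
    have "is_functor cospan_shape C D"
      unfolding is_functor_def using fg
      by (intro conjI category_cospan_shape category_axioms)
        (auto simp: D_def cospan_shape_def ob_def Hom_def)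
    then obtain v \<pi> where lim: "is_limit cospan_shape C D v \<pi>"
      using assms(2) unfolding has_finite_limits_def
      by (metis (no_types, lifting) cospan_shape_def cat.select_convs(1,2) finite.emptyI finite_insert)
    have cone: "is_cone cospan_shape C D w \<rho> \<longleftrightarrow> \<rho> 0 \<in> Hom C w (Dom C f) \<and> \<rho> 1 \<in> Hom C w (Dom C g) \<and>
        \<rho> 2 = f \<odot>\<^bsub>C\<^esub> \<rho> 0 \<and> \<rho> 2 = g \<odot>\<^bsub>C\<^esub> \<rho> 1" for w \<rho>
      using fg dom_in_obj[of "\<rho> 0"] by (auto simp: is_cone_def cospan_shape_def D_def ob_def Hom_def)
    note v = lim[unfolded is_limit_def cone]
    have "is_pullback C f g (\<pi> 0) (\<pi> 1)"
      unfolding is_pullback_def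
    proof (intro conjI allI ballI impI)
      fix w a b assume ab: "a \<in> Hom C w (Dom C f)" "b \<in> Hom C w (Dom C g)" "f \<odot>\<^bsub>C\<^esub> a = g \<odot>\<^bsub>C\<^esub> b"
      define \<rho> where "\<rho> j = (if j = 0 then a else if j = 1 then b else f \<odot>\<^bsub>C\<^esub> a)" for j :: nat
      have "\<exists>!u. u \<in> Hom C w v \<and> (\<forall>j\<in>Obj cospan_shape. \<pi> j \<odot>\<^bsub>C\<^esub> u = \<rho> j)"
        using v ab by (auto simp: \<rho>_def)
      moreover have "u \<in> Hom C w v \<and> (\<forall>j\<in>Obj cospan_shape. \<pi> j \<odot>\<^bsub>C\<^esub> u = \<rho> j) \<longleftrightarrow>
          u \<in> Hom C w (Dom C (\<pi> 0)) \<and> \<pi> 0 \<odot>\<^bsub>C\<^esub> u = a \<and> \<pi> 1 \<odot>\<^bsub>C\<^esub> u = b" for u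
        using v fg by (auto simp: \<rho>_def cospan_shape_def Hom_def)
      ultimately show "\<exists>!u. u \<in> Hom C w (Dom C (\<pi> 0)) \<and> \<pi> 0 \<odot>\<^bsub>C\<^esub> u = a \<and> \<pi> 1 \<odot>\<^bsub>C\<^esub> u = b"
        by simp
    qed (use v fg in \<open>auto simp: Hom_def\<close>)
    then show ?thesis by blast
  qed
  then show ?thesis by unfold_locales auto
qed

section \<open>Slice categories\<close>

text \<open>
  The underlying arrow in the base category. An arrow of a slice is determined by its source, its
  target and this arrow, so equations in a slice become equations in the base.
\<close>

definition und :: "'m sarr \<Rightarrow> 'm" where
  "und x = fst (snd x)"

lemma und_simps [simp]: "und (\<gamma>, f, \<delta>) = f"
  by (simp add: und_def)

lemma slice_simps [simp]:
  "\<gamma> \<in> Obj (slice C a) \<longleftrightarrow> \<gamma> \<in> Arr C \<and> Cod C \<gamma> = a"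
  "Dom (slice C a) (\<gamma>, f, \<delta>) = \<gamma>" "Cod (slice C a) (\<gamma>, f, \<delta>) = \<delta>"
  "Ident (slice C a) \<gamma> = (\<gamma>, Ident C (Dom C \<gamma>), \<gamma>)"
  "(\<gamma>', g, \<epsilon>) \<odot>\<^bsub>slice C a\<^esub> (\<gamma>, f, \<delta>) = (\<gamma>, g \<odot>\<^bsub>C\<^esub> f, \<epsilon>)"
  "und (y \<odot>\<^bsub>slice C a\<^esub> x) = und y \<odot>\<^bsub>C\<^esub> und x"
  by (auto simp: slice_def und_def split: prod.splits)

lemma slice_tuple: "x = (Dom (slice C a) x, und x, Cod (slice C a) x)"
  by (cases x) simp

lemma extensional_simps [simp]:
  "ObjMap (postcomp C h) \<in> extensional (Obj (slice C (Dom C h)))"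
  "ArrMap (postcomp C h) \<in> extensional (Arr (slice C (Dom C h)))"
  "ObjMap (dom_functor C a) \<in> extensional (Obj (slice C a))"
  "ArrMap (dom_functor C a) \<in> extensional (Arr (slice C a))"
  by (simp_all only: postcomp_def dom_functor_def cfunctor.select_convs restrict_extensional)

context category
begin

lemma slice_arr_iff [simp]: "(\<gamma>, f, \<delta>) \<in> Arr (slice C a) \<longleftrightarrow>
    \<delta> \<in> Arr C \<and> Cod C \<delta> = a \<and> f \<in> Arr C \<and> Cod C f = Dom C \<delta> \<and> \<gamma> = \<delta> \<odot> f"
  by (auto simp: slice_def Hom_def)

lemma slice_arr_cases:
  assumes "x \<in> Arr (slice C a)"
  obtains f \<delta> where "x = (\<delta> \<odot> f, f, \<delta>)" "\<delta> \<in> Arr C" "Cod C \<delta> = a" "f \<in> Arr C" "Cod C f = Dom C \<delta>"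
  using assms by (cases x) auto

lemma postcomp_simps [simp]:
  "\<gamma> \<in> Arr C \<Longrightarrow> Cod C \<gamma> = Dom C h \<Longrightarrow> ObjMap (postcomp C h) \<gamma> = h \<odot> \<gamma>"
  "(\<gamma>, f, \<delta>) \<in> Arr (slice C (Dom C h)) \<Longrightarrow>
    ArrMap (postcomp C h) (\<gamma>, f, \<delta>) = (h \<odot> \<gamma>, f, h \<odot> \<delta>)"
  by (simp_all add: postcomp_def)

lemma dom_functor_simps [simp]:
  "\<gamma> \<in> Arr C \<Longrightarrow> Cod C \<gamma> = a \<Longrightarrow> ObjMap (dom_functor C a) \<gamma> = Dom C \<gamma>"
  "x \<in> Arr (slice C a) \<Longrightarrow> ArrMap (dom_functor C a) x = und x"
  by (simp_all add: dom_functor_def und_def split: prod.splits)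

lemma slice_homE:
  assumes "x \<in> Hom (slice C a) \<gamma> \<delta>"
  obtains f where "x = (\<delta> \<odot> f, f, \<delta>)" "\<gamma> = \<delta> \<odot> f" "\<delta> \<in> Arr C" "Cod C \<delta> = a"
    "f \<in> Arr C" "Cod C f = Dom C \<delta>"
proof -
  have "x \<in> Arr (slice C a)" "Dom (slice C a) x = \<gamma>" "Cod (slice C a) x = \<delta>"
    using assms by (auto simp only: Hom_def)
  then show thesis using that by (auto elim!: slice_arr_cases)
qed

lemma category_slice: "category (slice C a)"
proof
  fix f g h \<gamma> \<delta> \<epsilon> \<zeta>
  assume f: "f \<in> Hom (slice C a) \<gamma> \<delta>"
  show "Ident (slice C a) \<delta> \<odot>\<^bsub>slice C a\<^esub> f = f" "f \<odot>\<^bsub>slice C a\<^esub> Ident (slice C a) \<gamma> = f"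
    by (rule slice_homE[OF f]; simp)+
  assume g: "g \<in> Hom (slice C a) \<delta> \<epsilon>"
  obtain f' where f': "f = (\<delta> \<odot> f', f', \<delta>)" "\<gamma> = \<delta> \<odot> f'" "f' \<in> Arr C" "Cod C f' = Dom C \<delta>"
    by (rule slice_homE[OF f])
  obtain g' where g': "g = (\<epsilon> \<odot> g', g', \<epsilon>)" "\<delta> = \<epsilon> \<odot> g'" "g' \<in> Arr C" "Cod C g' = Dom C \<epsilon>"
    "\<epsilon> \<in> Arr C" "Cod C \<epsilon> = a" by (rule slice_homE[OF g])
  show "g \<odot>\<^bsub>slice C a\<^esub> f \<in> Hom (slice C a) \<gamma> \<epsilon>"
    by (simp add: Hom_def f' g')
  assume h: "h \<in> Hom (slice C a) \<epsilon> \<zeta>"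
  obtain h' where h': "h = (\<zeta> \<odot> h', h', \<zeta>)" "\<epsilon> = \<zeta> \<odot> h'" "h' \<in> Arr C" "Cod C h' = Dom C \<zeta>"
    "\<zeta> \<in> Arr C" by (rule slice_homE[OF h])
  show "h \<odot>\<^bsub>slice C a\<^esub> g \<odot>\<^bsub>slice C a\<^esub> f = h \<odot>\<^bsub>slice C a\<^esub> (g \<odot>\<^bsub>slice C a\<^esub> f)"
    by (simp add: f' g' h')
qed (auto simp: Hom_def elim!: slice_arr_cases)

lemma und_postcomp:
  assumes "h \<in> Arr C" "x \<in> Arr (slice C (Dom C h))"
  shows "und (ArrMap (postcomp C h) x) = und x"
  by (rule slice_arr_cases[OF assms(2)]; simp add: assms(1))

lemma is_functor_postcomp:
  assumes "h \<in> Hom C a b" shows "is_functor (slice C a) (slice C b) (postcomp C h)"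
proof -
  have h: "h \<in> Arr C" "a = Dom C h" "b = Cod C h" using assms by (auto simp: Hom_def)
  show ?thesis
    unfolding is_functor_def Hom_def h(2,3)
    by (intro conjI category_slice) ((intro ballI impI)?; (elim slice_arr_cases)?; simp add: h(1))+
qed

lemma is_functor_dom: "is_functor (slice C a) C (dom_functor C a)"
  unfolding is_functor_def Hom_def
  by (intro conjI category_slice category_axioms) ((intro ballI impI)?; (elim slice_arr_cases)?; simp)+

lemma postcomp_ident:
  assumes "a \<in> Obj C" shows "postcomp C (Ident C a) = id_functor (slice C a)"
proof (rule cfunctor_eqI[where A = "slice C a"])
  have "Dom C (Ident C a) = a" using assms by simp
  then show "ObjMap (postcomp C (Ident C a)) \<in> extensional (Obj (slice C a))"
    "ArrMap (postcomp C (Ident C a)) \<in> extensional (Arr (slice C a))"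
    using extensional_simps(1,2)[of C "Ident C a"] by auto
qed ((elim slice_arr_cases)?; use assms in \<open>simp add: id_functor_def\<close>)+

lemma postcomp_comp:
  assumes "h \<in> Hom C a b" "k \<in> Hom C b c"
  shows "postcomp C (k \<odot> h) = comp_functor (slice C a) (postcomp C k) (postcomp C h)"
proof (rule cfunctor_eqI[where A = "slice C a"])
  have "Dom C (k \<odot> h) = a" using assms by (simp add: Hom_def)
  then show "ObjMap (postcomp C (k \<odot> h)) \<in> extensional (Obj (slice C a))"
    "ArrMap (postcomp C (k \<odot> h)) \<in> extensional (Arr (slice C a))"
    using extensional_simps(1,2)[of C "k \<odot> h"] by auto
qed ((elim slice_arr_cases)?; use assms in \<open>simp add: Hom_def comp_functor_def\<close>)+

text \<open>Postcomposition with \<open>h\<close> remembers \<open>h\<close>, since it sends the identity of its domain to \<open>h\<close>.\<close>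

lemma postcomp_inject:
  assumes "h \<in> Hom C a b" "k \<in> Hom C a b'" "postcomp C h = postcomp C k"
  shows "h = k"
proof -
  have hk: "h \<in> Arr C" "Dom C h = a" "k \<in> Arr C" "Dom C k = a"
    using assms(1,2) by (simp_all add: Hom_def)
  have a: "a \<in> Obj C" using dom_in_obj[OF hk(1)] by (simp add: hk)
  have "ObjMap (postcomp C h) (Ident C a) = h" "ObjMap (postcomp C k) (Ident C a) = k"
    by (simp_all add: hk a)
  then show ?thesis using assms(3) by metis
qed

end

context category_with_pullbacks
begin

text \<open>The right adjoint of postcomposition with \<open>h\<close> is pullback along \<open>h\<close>.\<close>

lemma left_adjoint_postcomp:
  assumes "h \<in> Hom C a b" shows "left_adjoint (slice C a) (slice C b) (postcomp C h)"
proof -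
  have [simp]: "h \<in> Arr C" "Dom C h = a" "Cod C h = b" "a \<in> Obj C" "b \<in> Obj C"
    using assms dom_in_obj[of h] cod_in_obj[of h] by (auto simp: Hom_def)
  define G where "G = \<lparr>ObjMap = (\<lambda>\<delta>\<in>Obj (slice C b). pr1 C h \<delta>),
    ArrMap = (\<lambda>(\<delta>, f, \<delta>')\<in>Arr (slice C b).
      (pr1 C h \<delta>, pb_pair C h \<delta>' (pr1 C h \<delta>) (f \<odot> pr2 C h \<delta>), pr1 C h \<delta>'))\<rparr>"
  have G_simps [simp]: "ObjMap G \<delta> = pr1 C h \<delta>" if "\<delta> \<in> Obj (slice C b)" for \<delta>
    using that by (simp add: G_def)
  have G_simps' [simp]: "ArrMap G (\<delta>, f, \<delta>') =
      (pr1 C h \<delta>, pb_pair C h \<delta>' (pr1 C h \<delta>) (f \<odot> pr2 C h \<delta>), pr1 C h \<delta>')"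
    if "(\<delta>, f, \<delta>') \<in> Arr (slice C b)" for \<delta> f \<delta>'
    using that by (simp add: G_def)
  have "is_functor (slice C b) (slice C a) G"
    unfolding is_functor_def Hom_def
    apply (intro conjI category_slice)
    subgoal by (simp add: G_def)
    subgoal by (simp add: G_def)
    subgoal by simp
    subgoal by (intro ballI, elim slice_arr_cases, simp)
    apply (intro ballI)
    subgoal for \<delta> by (simp,  rule pb_eqI[of h \<delta>]; simp)
    apply (intro ballI impI, elim slice_arr_cases)
    subgoal for _ _ _ _ _ \<delta> by (simp, rule pb_eqI[of h \<delta>]; simp)
    done
  note G = this and F = is_functor_postcomp[OF assms]
  define \<eta> where "\<eta> = (\<lambda>\<gamma>\<in>Obj (slice C a).
    (\<gamma>, pb_pair C h (h \<odot> \<gamma>) \<gamma> (Ident C (Dom C \<gamma>)), pr1 C h (h \<odot> \<gamma>)))"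
  define \<epsilon> where "\<epsilon> = (\<lambda>\<delta>\<in>Obj (slice C b). (h \<odot> pr1 C h \<delta>, pr2 C h \<delta>, \<delta>))"
  have "adjunction (slice C a) (slice C b) (postcomp C h) G \<eta> \<epsilon>"
    unfolding adjunction_def
    apply (intro conjI F G nat_transI is_functor_id category_slice is_functor_comp[OF F G] is_functor_comp[OF G F])
    subgoal by (simp add: \<eta>_def)
    subgoal by (simp add: \<eta>_def Hom_def)
    apply (elim slice_arr_cases)
    subgoal for _ _ \<delta> by (simp add: \<eta>_def, rule pb_eqI[of h "h \<odot> \<delta>"]; simp)
    subgoal by (simp add: \<epsilon>_def)
    subgoal by (simp add: \<epsilon>_def Hom_def)
    subgoal by (elim slice_arr_cases, simp add: \<epsilon>_def)
    subgoal by (simp add: \<eta>_def \<epsilon>_def)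
    apply (intro ballI)
    subgoal for \<delta> by (simp add: \<eta>_def \<epsilon>_def, rule pb_eqI[of h \<delta>]; simp)
    done
  then show ?thesis unfolding left_adjoint_def by blast
qed

end

section \<open>Action monads in terms of arrows of the base category\<close>

text \<open>
  An action monad lives in the category of arrows over \<open>a\<close>. The constants below are the underlying
  arrows of its structure, and the lemmas of this locale restate all laws as equations between
  arrows of \<open>C\<close>. A slice arrow into \<open>\<delta>\<close> is given by \<open>f\<close> alone, its source being \<open>\<delta> \<odot> f\<close>; therefore
  \<open>Tar\<close> takes \<open>f\<close> and \<open>\<delta>\<close> only.
\<close>

locale action_monad_on = category C for C :: "('o, 'm) cat" (structure) +
  fixes a :: 'o and T :: "('m, 'm sarr) monad" and \<alpha> :: "'m \<Rightarrow> 'm"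
  assumes action_monad: "action_monad C a T \<alpha>"
begin

abbreviation Tob :: "'m \<Rightarrow> 'm" where "Tob \<equiv> ObjMap (mfun T)"

definition Tar :: "'m \<Rightarrow> 'm \<Rightarrow> 'm" where
  "Tar f \<delta> = und (ArrMap (mfun T) (\<delta> \<odot> f, f, \<delta>))"

definition e :: "'m \<Rightarrow> 'm" where "e \<gamma> = und (munit T \<gamma>)"

definition m :: "'m \<Rightarrow> 'm" where "m \<gamma> = und (mmult T \<gamma>)"

lemma monad_on: "monad_on (slice C a) T"
  and comorphism_between: "comorphism_between (slice C a) T C (id_monad C) (dom_functor C a) \<alpha>"
  and a_obj [simp]: "a \<in> Obj C"
  using action_monad
  by (simp_all add: action_monad_def monad_onI comorphism_betweenI)

lemma Tob [simp]:
  assumes "\<gamma> \<in> Arr C" "Cod C \<gamma> = a"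
  shows "Tob \<gamma> \<in> Arr C" "Cod C (Tob \<gamma>) = a"
proof -
  interpret M: monad_on "slice C a" T by (rule monad_on)
  show "Tob \<gamma> \<in> Arr C" "Cod C (Tob \<gamma>) = a" using M.T.obj[of \<gamma>] assms by simp_all
qed

context
  fixes f \<delta>
  assumes typed: "\<delta> \<in> Arr C" "Cod C \<delta> = a" "f \<in> Arr C" "Cod C f = Dom C \<delta>"
begin

lemma Tar_eq:
  assumes "\<gamma> = \<delta> \<odot> f"
  shows "ArrMap (mfun T) (\<gamma>, f, \<delta>) = (Tob \<gamma>, Tar f \<delta>, Tob \<delta>)"
proof -
  interpret M: monad_on "slice C a" T by (rule monad_on)
  have "(\<gamma>, f, \<delta>) \<in> Arr (slice C a)" using typed assms by simp
  then show ?thesis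
    using slice_tuple[of "ArrMap (mfun T) (\<gamma>, f, \<delta>)" C a] M.T.dom M.T.cod assms
    by (simp add: Tar_def)
qed

lemma Tar [simp]:
  "Tar f \<delta> \<in> Arr C" "Dom C (Tar f \<delta>) = Dom C (Tob (\<delta> \<odot> f))" "Cod C (Tar f \<delta>) = Dom C (Tob \<delta>)"
  "Tob \<delta> \<odot> Tar f \<delta> = Tob (\<delta> \<odot> f)"
proof -
  interpret M: monad_on "slice C a" T by (rule monad_on)
  have "(\<delta> \<odot> f, f, \<delta>) \<in> Arr (slice C a)" using typed by simp
  from M.T.arr[OF this, unfolded Tar_eq[OF refl] slice_arr_iff]
  show "Tar f \<delta> \<in> Arr C" "Dom C (Tar f \<delta>) = Dom C (Tob (\<delta> \<odot> f))" "Cod C (Tar f \<delta>) = Dom C (Tob \<delta>)"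
    "Tob \<delta> \<odot> Tar f \<delta> = Tob (\<delta> \<odot> f)"
    by simp_all
qed

end

lemma Tar_ident [simp]:
  assumes "\<delta> \<in> Arr C" "Cod C \<delta> = a" "Dom C \<delta> = x"
  shows "Tar (Ident C x) \<delta> = Ident C (Dom C (Tob \<delta>))"
proof -
  interpret M: monad_on "slice C a" T by (rule monad_on)
  have "x \<in> Obj C" using assms dom_in_obj[of \<delta>] by simp
  then show ?thesis using M.T.ident[of \<delta>] assms by (simp add: Tar_def)
qed

lemma Tar_comp:
  assumes "\<delta> \<in> Arr C" "Cod C \<delta> = a" "f \<in> Arr C" "Cod C f = Dom C \<delta>" "g \<in> Arr C" "Cod C g = Dom C f"
  shows "Tar (f \<odot> g) \<delta> = Tar f \<delta> \<odot> Tar g (\<delta> \<odot> f)"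
proof -
  interpret M: monad_on "slice C a" T by (rule monad_on)
  show ?thesis
    using M.T.comp[of "(\<delta> \<odot> (f \<odot> g), g, \<delta> \<odot> f)" "(\<delta> \<odot> f, f, \<delta>)"] assms
    by (simp add: Tar_def)
qed

context
  fixes \<gamma>
  assumes typed: "\<gamma> \<in> Arr C" "Cod C \<gamma> = a"
begin

lemma \<alpha> [simp]: "\<alpha> \<gamma> \<in> Arr C" "Dom C (\<alpha> \<gamma>) = Dom C (Tob \<gamma>)" "Cod C (\<alpha> \<gamma>) = Dom C \<gamma>"
proof -
  interpret P: comorphism_between "slice C a" T C "id_monad C" "dom_functor C a" \<alpha>
    by (rule comorphism_between)
  show "\<alpha> \<gamma> \<in> Arr C" "Dom C (\<alpha> \<gamma>) = Dom C (Tob \<gamma>)" "Cod C (\<alpha> \<gamma>) = Dom C \<gamma>"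
    using P.tr.component[of \<gamma>] P.tr.component_dom[of \<gamma>] P.tr.component_cod[of \<gamma>] typed
    by (simp_all add: id_monad_def)
qed

lemma unit_eq: "munit T \<gamma> = (\<gamma>, e \<gamma>, Tob \<gamma>)"
proof -
  interpret M: monad_on "slice C a" T by (rule monad_on)
  show ?thesis
    using slice_tuple[of "munit T \<gamma>" C a] M.unit.component_dom[of \<gamma>] M.unit.component_cod[of \<gamma>] typed
    by (simp add: e_def)
qed

lemma mult_eq: "mmult T \<gamma> = (Tob (Tob \<gamma>), m \<gamma>, Tob \<gamma>)"
proof -
  interpret M: monad_on "slice C a" T by (rule monad_on)
  show ?thesis
    using slice_tuple[of "mmult T \<gamma>" C a] M.mult.component_dom[of \<gamma>] M.mult.component_cod[of \<gamma>] typed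
    by (simp add: m_def)
qed

lemma e [simp]: "e \<gamma> \<in> Arr C" "Dom C (e \<gamma>) = Dom C \<gamma>" "Cod C (e \<gamma>) = Dom C (Tob \<gamma>)"
    "Tob \<gamma> \<odot> e \<gamma> = \<gamma>"
  and m [simp]: "m \<gamma> \<in> Arr C" "Dom C (m \<gamma>) = Dom C (Tob (Tob \<gamma>))" "Cod C (m \<gamma>) = Dom C (Tob \<gamma>)"
    "Tob \<gamma> \<odot> m \<gamma> = Tob (Tob \<gamma>)"
proof -
  interpret M: monad_on "slice C a" T by (rule monad_on)
  have *: "\<gamma> \<in> Obj (slice C a)" using typed by simp
  note E = M.unit.component[OF *, unfolded unit_eq slice_arr_iff]
  have E1: "\<gamma> = Tob \<gamma> \<odot> e \<gamma>" and E2: "e \<gamma> \<in> Arr C" "Cod C (e \<gamma>) = Dom C (Tob \<gamma>)"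
    using E by blast+
  show "Tob \<gamma> \<odot> e \<gamma> = \<gamma>" by (rule E1[symmetric])
  have "Dom C (Tob \<gamma> \<odot> e \<gamma>) = Dom C (e \<gamma>)" by (simp add: E2 typed)
  then show "e \<gamma> \<in> Arr C" "Dom C (e \<gamma>) = Dom C \<gamma>" "Cod C (e \<gamma>) = Dom C (Tob \<gamma>)"
    using E2 by (simp_all only: E1[symmetric])
  note M = M.mult.component[OF *, unfolded mult_eq slice_arr_iff]
  from M have "Tob (Tob \<gamma>) = Tob \<gamma> \<odot> m \<gamma>" by (elim conjE)
  from this[symmetric] show "Tob \<gamma> \<odot> m \<gamma> = Tob (Tob \<gamma>)" .
  from arg_cong[OF this, of "Dom C"] M
  show "m \<gamma> \<in> Arr C" "Dom C (m \<gamma>) = Dom C (Tob (Tob \<gamma>))" "Cod C (m \<gamma>) = Dom C (Tob \<gamma>)"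
    using typed by simp_all
qed

lemma \<alpha>_e: "\<alpha> \<gamma> \<odot> e \<gamma> = Ident C (Dom C \<gamma>)"
  and \<alpha>_m: "\<alpha> \<gamma> \<odot> m \<gamma> = \<alpha> \<gamma> \<odot> \<alpha> (Tob \<gamma>)"
proof -
  interpret P: comorphism_between "slice C a" T C "id_monad C" "dom_functor C a" \<alpha>
    by (rule comorphism_between)
  have "\<gamma> \<in> Obj (slice C a)" using typed by simp
  from P.unit_compat[OF this] P.mult_compat[OF this]
  show "\<alpha> \<gamma> \<odot> e \<gamma> = Ident C (Dom C \<gamma>)" "\<alpha> \<gamma> \<odot> m \<gamma> = \<alpha> \<gamma> \<odot> \<alpha> (Tob \<gamma>)"
    using typed by (simp_all add: unit_eq mult_eq id_monad_def)
qed

lemma m_Tar_e: "m \<gamma> \<odot> Tar (e \<gamma>) (Tob \<gamma>) = Ident C (Dom C (Tob \<gamma>))"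
  and m_e: "m \<gamma> \<odot> e (Tob \<gamma>) = Ident C (Dom C (Tob \<gamma>))"
  and m_m: "m \<gamma> \<odot> Tar (m \<gamma>) (Tob \<gamma>) = m \<gamma> \<odot> m (Tob \<gamma>)"
proof -
  interpret M: monad_on "slice C a" T by (rule monad_on)
  have "\<gamma> \<in> Obj (slice C a)" using typed by simp
  from M.unit_laws[OF this] M.mult_law[OF this]
  show "m \<gamma> \<odot> Tar (e \<gamma>) (Tob \<gamma>) = Ident C (Dom C (Tob \<gamma>))"
    "m \<gamma> \<odot> e (Tob \<gamma>) = Ident C (Dom C (Tob \<gamma>))"
    "m \<gamma> \<odot> Tar (m \<gamma>) (Tob \<gamma>) = m \<gamma> \<odot> m (Tob \<gamma>)"
    using typed by (simp_all add: unit_eq mult_eq Tar_eq action_monad_on.unit_eq[OF action_monad_on_axioms] action_monad_on.mult_eq[OF action_monad_on_axioms])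
qed

end

context
  fixes f \<delta>
  assumes typed: "\<delta> \<in> Arr C" "Cod C \<delta> = a" "f \<in> Arr C" "Cod C f = Dom C \<delta>"
begin

lemma \<alpha>_natural: "\<alpha> \<delta> \<odot> Tar f \<delta> = f \<odot> \<alpha> (\<delta> \<odot> f)"
  and \<alpha>_pullback: "is_pullback C (\<alpha> \<delta>) f (Tar f \<delta>) (\<alpha> (\<delta> \<odot> f))"
proof -
  have x: "(\<delta> \<odot> f, f, \<delta>) \<in> Arr (slice C a)" using typed by simp
  have *: "is_pullback C (\<alpha> (Cod (slice C a) x)) (ArrMap (dom_functor C a) x)
      (ArrMap (comp_functor (slice C a) (dom_functor C a) (mfun T)) x) (\<alpha> (Dom (slice C a) x))"
    if "x \<in> Arr (slice C a)" for x
    using that action_monad unfolding action_monad_def cartesian_nat_trans_def by (elim conjE) (drule (1) bspec)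
  interpret M: monad_on "slice C a" T by (rule monad_on)
  show "is_pullback C (\<alpha> \<delta>) f (Tar f \<delta>) (\<alpha> (\<delta> \<odot> f))"
    using *[OF x] x M.T.arr[OF x] typed by (simp add: Tar_eq)
  then show "\<alpha> \<delta> \<odot> Tar f \<delta> = f \<odot> \<alpha> (\<delta> \<odot> f)"
    unfolding is_pullback_def by (elim conjE)
qed

lemma e_natural: "e \<delta> \<odot> f = Tar f \<delta> \<odot> e (\<delta> \<odot> f)"
  and m_natural: "m \<delta> \<odot> Tar (Tar f \<delta>) (Tob \<delta>) = Tar f \<delta> \<odot> m (\<delta> \<odot> f)"
proof -
  interpret M: monad_on "slice C a" T by (rule monad_on)
  have x: "(\<delta> \<odot> f, f, \<delta>) \<in> Arr (slice C a)" using typed by simp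
  from M.unit.naturality[OF x refl refl]
  show "e \<delta> \<odot> f = Tar f \<delta> \<odot> e (\<delta> \<odot> f)"
    using x typed by (simp add: Tar_eq unit_eq)
  from M.mult.naturality[OF x refl refl]
  show "m \<delta> \<odot> Tar (Tar f \<delta>) (Tob \<delta>) = Tar f \<delta> \<odot> m (\<delta> \<odot> f)"
    using x typed by (simp add: Tar_eq mult_eq)
qed

end

end

text \<open>
  The converse passage: arrows of \<open>C\<close> that satisfy the equations above assemble into an action monad.
\<close>

lemma (in category) action_monadI:
  fixes T :: "('m, 'm sarr) monad"
  assumes a: "a \<in> Obj C"
    and T: "mfun T = \<lparr>ObjMap = (\<lambda>\<gamma>\<in>Obj (slice C a). Tob \<gamma>),
          ArrMap = (\<lambda>(\<gamma>, f, \<delta>)\<in>Arr (slice C a). (Tob \<gamma>, Tar f \<delta>, Tob \<delta>))\<rparr>"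
      "munit T = (\<lambda>\<gamma>\<in>Obj (slice C a). (\<gamma>, e \<gamma>, Tob \<gamma>))"
      "mmult T = (\<lambda>\<gamma>\<in>Obj (slice C a). (Tob (Tob \<gamma>), m \<gamma>, Tob \<gamma>))"
      "\<alpha> = (\<lambda>\<gamma>\<in>Obj (slice C a). p \<gamma>)"
    and Tob [simp]: "\<And>\<gamma>. \<lbrakk>\<gamma> \<in> Arr C; Cod C \<gamma> = a\<rbrakk> \<Longrightarrow> Tob \<gamma> \<in> Arr C \<and> Cod C (Tob \<gamma>) = a"
    and Tar [simp]: "\<And>\<delta> f. \<lbrakk>\<delta> \<in> Arr C; Cod C \<delta> = a; f \<in> Arr C; Cod C f = Dom C \<delta>\<rbrakk> \<Longrightarrow>
      Tar f \<delta> \<in> Arr C \<and> Dom C (Tar f \<delta>) = Dom C (Tob (\<delta> \<odot> f)) \<and> Cod C (Tar f \<delta>) = Dom C (Tob \<delta>) \<and>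
      Tob \<delta> \<odot> Tar f \<delta> = Tob (\<delta> \<odot> f)"
    and Tar_ident: "\<And>\<delta>. \<lbrakk>\<delta> \<in> Arr C; Cod C \<delta> = a\<rbrakk> \<Longrightarrow> Tar (Ident C (Dom C \<delta>)) \<delta> = Ident C (Dom C (Tob \<delta>))"
    and Tar_comp: "\<And>\<delta> f g. \<lbrakk>\<delta> \<in> Arr C; Cod C \<delta> = a; f \<in> Arr C; Cod C f = Dom C \<delta>; g \<in> Arr C; Cod C g = Dom C f\<rbrakk>
      \<Longrightarrow> Tar (f \<odot> g) \<delta> = Tar f \<delta> \<odot> Tar g (\<delta> \<odot> f)"
    and e [simp]: "\<And>\<gamma>. \<lbrakk>\<gamma> \<in> Arr C; Cod C \<gamma> = a\<rbrakk> \<Longrightarrow>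
      e \<gamma> \<in> Arr C \<and> Dom C (e \<gamma>) = Dom C \<gamma> \<and> Cod C (e \<gamma>) = Dom C (Tob \<gamma>) \<and> Tob \<gamma> \<odot> e \<gamma> = \<gamma>"
    and m [simp]: "\<And>\<gamma>. \<lbrakk>\<gamma> \<in> Arr C; Cod C \<gamma> = a\<rbrakk> \<Longrightarrow>
      m \<gamma> \<in> Arr C \<and> Dom C (m \<gamma>) = Dom C (Tob (Tob \<gamma>)) \<and> Cod C (m \<gamma>) = Dom C (Tob \<gamma>) \<and>
      Tob \<gamma> \<odot> m \<gamma> = Tob (Tob \<gamma>)"
    and p [simp]: "\<And>\<gamma>. \<lbrakk>\<gamma> \<in> Arr C; Cod C \<gamma> = a\<rbrakk> \<Longrightarrow>
      p \<gamma> \<in> Arr C \<and> Dom C (p \<gamma>) = Dom C (Tob \<gamma>) \<and> Cod C (p \<gamma>) = Dom C \<gamma>"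
    and e_natural: "\<And>\<delta> f. \<lbrakk>\<delta> \<in> Arr C; Cod C \<delta> = a; f \<in> Arr C; Cod C f = Dom C \<delta>\<rbrakk>
      \<Longrightarrow> e \<delta> \<odot> f = Tar f \<delta> \<odot> e (\<delta> \<odot> f)"
    and m_natural: "\<And>\<delta> f. \<lbrakk>\<delta> \<in> Arr C; Cod C \<delta> = a; f \<in> Arr C; Cod C f = Dom C \<delta>\<rbrakk>
      \<Longrightarrow> m \<delta> \<odot> Tar (Tar f \<delta>) (Tob \<delta>) = Tar f \<delta> \<odot> m (\<delta> \<odot> f)"
    and pullback: "\<And>\<delta> f. \<lbrakk>\<delta> \<in> Arr C; Cod C \<delta> = a; f \<in> Arr C; Cod C f = Dom C \<delta>\<rbrakk>
      \<Longrightarrow> is_pullback C (p \<delta>) f (Tar f \<delta>) (p (\<delta> \<odot> f))"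
    and p_e: "\<And>\<gamma>. \<lbrakk>\<gamma> \<in> Arr C; Cod C \<gamma> = a\<rbrakk> \<Longrightarrow> p \<gamma> \<odot> e \<gamma> = Ident C (Dom C \<gamma>)"
    and p_m: "\<And>\<gamma>. \<lbrakk>\<gamma> \<in> Arr C; Cod C \<gamma> = a\<rbrakk> \<Longrightarrow> p \<gamma> \<odot> m \<gamma> = p \<gamma> \<odot> p (Tob \<gamma>)"
    and m_Tar_e: "\<And>\<gamma>. \<lbrakk>\<gamma> \<in> Arr C; Cod C \<gamma> = a\<rbrakk> \<Longrightarrow> m \<gamma> \<odot> Tar (e \<gamma>) (Tob \<gamma>) = Ident C (Dom C (Tob \<gamma>))"
    and m_e: "\<And>\<gamma>. \<lbrakk>\<gamma> \<in> Arr C; Cod C \<gamma> = a\<rbrakk> \<Longrightarrow> m \<gamma> \<odot> e (Tob \<gamma>) = Ident C (Dom C (Tob \<gamma>))"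
    and m_m: "\<And>\<gamma>. \<lbrakk>\<gamma> \<in> Arr C; Cod C \<gamma> = a\<rbrakk> \<Longrightarrow> m \<gamma> \<odot> Tar (m \<gamma>) (Tob \<gamma>) = m \<gamma> \<odot> m (Tob \<gamma>)"
  shows "action_monad C a T \<alpha>"
proof -
  have T_simps [simp]: "\<And>\<gamma>. \<lbrakk>\<gamma> \<in> Arr C; Cod C \<gamma> = a\<rbrakk> \<Longrightarrow> ObjMap (mfun T) \<gamma> = Tob \<gamma>"
    "\<And>\<gamma> f \<delta>. (\<gamma>, f, \<delta>) \<in> Arr (slice C a) \<Longrightarrow> ArrMap (mfun T) (\<gamma>, f, \<delta>) = (Tob \<gamma>, Tar f \<delta>, Tob \<delta>)"
    "\<And>\<gamma>. \<lbrakk>\<gamma> \<in> Arr C; Cod C \<gamma> = a\<rbrakk> \<Longrightarrow> munit T \<gamma> = (\<gamma>, e \<gamma>, Tob \<gamma>)"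
    "\<And>\<gamma>. \<lbrakk>\<gamma> \<in> Arr C; Cod C \<gamma> = a\<rbrakk> \<Longrightarrow> mmult T \<gamma> = (Tob (Tob \<gamma>), m \<gamma>, Tob \<gamma>)"
    "\<And>\<gamma>. \<lbrakk>\<gamma> \<in> Arr C; Cod C \<gamma> = a\<rbrakk> \<Longrightarrow> \<alpha> \<gamma> = p \<gamma>"
    by (simp_all add: T)
  note D = is_functor_dom[of a] and S = category_slice[of a]
  have F: "is_functor (slice C a) (slice C a) (mfun T)"
    unfolding is_functor_def Hom_def
    apply (intro conjI S)
    subgoal by (simp add: T)
    subgoal by (simp add: T)
    subgoal by simp
    subgoal by (intro ballI, elim slice_arr_cases, simp)
    subgoal by (intro ballI, simp add: Tar_ident)
    subgoal by (intro ballI impI, elim slice_arr_cases, simp add: Tar_comp)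
    done
  have unit: "nat_trans (slice C a) (slice C a) (id_functor (slice C a)) (mfun T) (munit T)"
    apply (intro nat_transI F is_functor_id S)
    subgoal by (simp add: T)
    subgoal by (simp add: Hom_def)
    subgoal by (elim slice_arr_cases, simp add: e_natural)
    done
  have mult: "nat_trans (slice C a) (slice C a) (comp_functor (slice C a) (mfun T) (mfun T)) (mfun T) (mmult T)"
    apply (intro nat_transI F is_functor_comp[OF F F])
    subgoal by (simp add: T)
    subgoal by (simp add: Hom_def)
    subgoal by (elim slice_arr_cases, simp add: m_natural)
    done
  have monad: "is_monad (slice C a) T"
    unfolding is_monad_def
    by (intro conjI F unit mult ballI) (simp_all add: m_Tar_e m_e m_m)
  have p_natural: "p \<delta> \<odot> Tar f \<delta> = f \<odot> p (\<delta> \<odot> f)"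
    if "\<delta> \<in> Arr C" "Cod C \<delta> = a" "f \<in> Arr C" "Cod C f = Dom C \<delta>" for f \<delta>
    using pullback[OF that] unfolding is_pullback_def by (elim conjE)
  have p: "nat_trans (slice C a) C (comp_functor (slice C a) (dom_functor C a) (mfun T)) (dom_functor C a) \<alpha>"
    apply (intro nat_transI is_functor_comp[OF F D] D)
    subgoal by (simp add: T)
    subgoal by (simp add: Hom_def)
    subgoal by (elim slice_arr_cases, simp add: p_natural)
    done
  have cart: "cartesian_nat_trans (slice C a) C
       (comp_functor (slice C a) (dom_functor C a) (mfun T)) (dom_functor C a) \<alpha>"
    unfolding cartesian_nat_trans_def
    by (intro conjI p ballI, elim slice_arr_cases, simp add: pullback)
  have id: "is_monad C (id_monad C)"
    unfolding is_monad_def id_monad_def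
    apply (simp add: comp_functor_id(1)[OF is_functor_id[OF category_axioms]])
    apply (intro conjI is_functor_id category_axioms nat_transI)
    by (simp_all add: Hom_def)
  have "comorphism (slice C a) T C (id_monad C) (dom_functor C a) \<alpha>"
    unfolding comorphism_def
  proof (intro conjI monad id D ballI)
    show "nat_trans (slice C a) C (comp_functor (slice C a) (dom_functor C a) (mfun T))
       (comp_functor (slice C a) (mfun (id_monad C)) (dom_functor C a)) \<alpha>"
      using p by (simp add: id_monad_def comp_functor_id(1)[OF D])
  qed (simp_all add: id_monad_def p_e p_m)
  then show ?thesis
    unfolding action_monad_def using a monad cart by blast
qed

locale two_action_monads = X: action_monad_on C a T \<alpha> + Y: action_monad_on C b S \<beta>
  for C :: "('o, 'm) cat" (structure) and a T \<alpha> b S \<beta> +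
  fixes h :: 'm
  assumes h_hom: "h \<in> Hom C a b"
begin

lemma h [simp]: "h \<in> Arr C" "Dom C h = a" "Cod C h = b"
  using h_hom by (simp_all add: Hom_def)

text \<open>
  For morphisms too, the comorphism laws are equations between the underlying arrows \<open>l \<gamma>\<close> of the
  components.
\<close>

lemma morphismI:
  assumes \<Lambda>: "\<Lambda> = (\<lambda>\<gamma>\<in>Obj (slice C a). (h \<odot> X.Tob \<gamma>, l \<gamma>, Y.Tob (h \<odot> \<gamma>)))"
    and l [simp]: "\<And>\<gamma>. \<lbrakk>\<gamma> \<in> Arr C; Cod C \<gamma> = a\<rbrakk> \<Longrightarrow> l \<gamma> \<in> Arr C \<and> Dom C (l \<gamma>) = Dom C (X.Tob \<gamma>) \<and>
      Cod C (l \<gamma>) = Dom C (Y.Tob (h \<odot> \<gamma>)) \<and> Y.Tob (h \<odot> \<gamma>) \<odot> l \<gamma> = h \<odot> X.Tob \<gamma>"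
    and natural: "\<And>\<delta> f. \<lbrakk>\<delta> \<in> Arr C; Cod C \<delta> = a; f \<in> Arr C; Cod C f = Dom C \<delta>\<rbrakk>
      \<Longrightarrow> l \<delta> \<odot> X.Tar f \<delta> = Y.Tar f (h \<odot> \<delta>) \<odot> l (\<delta> \<odot> f)"
    and unit: "\<And>\<gamma>. \<lbrakk>\<gamma> \<in> Arr C; Cod C \<gamma> = a\<rbrakk> \<Longrightarrow> l \<gamma> \<odot> X.e \<gamma> = Y.e (h \<odot> \<gamma>)"
    and mult: "\<And>\<gamma>. \<lbrakk>\<gamma> \<in> Arr C; Cod C \<gamma> = a\<rbrakk> \<Longrightarrow>
      l \<gamma> \<odot> X.m \<gamma> = Y.m (h \<odot> \<gamma>) \<odot> (Y.Tar (l \<gamma>) (Y.Tob (h \<odot> \<gamma>)) \<odot> l (X.Tob \<gamma>))"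
    and action: "\<And>\<gamma>. \<lbrakk>\<gamma> \<in> Arr C; Cod C \<gamma> = a\<rbrakk> \<Longrightarrow> \<beta> (h \<odot> \<gamma>) \<odot> l \<gamma> = \<alpha> \<gamma>"
  shows "action_monad_morphism C (a, T, \<alpha>) (b, S, \<beta>) h \<Lambda>"
proof -
  have \<Lambda>_simp [simp]: "\<And>\<gamma>. \<lbrakk>\<gamma> \<in> Arr C; Cod C \<gamma> = a\<rbrakk> \<Longrightarrow> \<Lambda> \<gamma> = (h \<odot> X.Tob \<gamma>, l \<gamma>, Y.Tob (h \<odot> \<gamma>))"
    by (simp add: \<Lambda>)
  have T: "is_monad (slice C a) T" and S: "is_monad (slice C b) S"
    using X.action_monad Y.action_monad by (simp_all add: action_monad_def)
  note TS = T[unfolded is_monad_def, THEN conjunct1] S[unfolded is_monad_def, THEN conjunct1]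
  note H = X.is_functor_postcomp[OF h_hom]
  have "comorphism (slice C a) T (slice C b) S (postcomp C h) \<Lambda>"
    unfolding comorphism_def
    apply (intro conjI T S H nat_transI is_functor_comp[OF TS(1) H] is_functor_comp[OF H TS(2)])
    subgoal by (simp add: \<Lambda>)
    subgoal by (simp add: Hom_def)
    subgoal by (elim X.slice_arr_cases, simp add: X.Tar_eq Y.Tar_eq natural)
    subgoal by (simp add: X.unit_eq Y.unit_eq unit)
    subgoal by (simp add: X.mult_eq Y.mult_eq Y.Tar_eq mult)
    done
  then show ?thesis
    unfolding action_monad_morphism_def
    using X.action_monad Y.action_monad h_hom by (simp add: action)
qed

context
  fixes \<Lambda>
  assumes morphism: "action_monad_morphism C (a, T, \<alpha>) (b, S, \<beta>) h \<Lambda>"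
begin

lemma comorphism_morphism: "comorphism_between (slice C a) T (slice C b) S (postcomp C h) \<Lambda>"
  using morphism by (simp add: action_monad_morphism_def comorphism_betweenI)

lemma morphism_ext: "\<Lambda> \<in> extensional (Obj (slice C a))"
proof -
  interpret L: comorphism_between "slice C a" T "slice C b" S "postcomp C h" \<Lambda>
    by (rule comorphism_morphism)
  show ?thesis by (rule L.tr.ext_component)
qed

context
  fixes \<gamma>
  assumes typed: "\<gamma> \<in> Arr C" "Cod C \<gamma> = a"
begin

lemma morphism_eq: "\<Lambda> \<gamma> = (h \<odot> X.Tob \<gamma>, und (\<Lambda> \<gamma>), Y.Tob (h \<odot> \<gamma>))"
proof -
  interpret L: comorphism_between "slice C a" T "slice C b" S "postcomp C h" \<Lambda>
    by (rule comorphism_morphism)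
  show ?thesis
    using slice_tuple[of "\<Lambda> \<gamma>" C b] L.tr.component_dom[of \<gamma>] L.tr.component_cod[of \<gamma>] typed
    by simp
qed

lemma morphism_und [simp]:
  "und (\<Lambda> \<gamma>) \<in> Arr C" "Dom C (und (\<Lambda> \<gamma>)) = Dom C (X.Tob \<gamma>)"
  "Cod C (und (\<Lambda> \<gamma>)) = Dom C (Y.Tob (h \<odot> \<gamma>))" "Y.Tob (h \<odot> \<gamma>) \<odot> und (\<Lambda> \<gamma>) = h \<odot> X.Tob \<gamma>"
proof -
  interpret L: comorphism_between "slice C a" T "slice C b" S "postcomp C h" \<Lambda>
    by (rule comorphism_morphism)
  have "(h \<odot> X.Tob \<gamma>, und (\<Lambda> \<gamma>), Y.Tob (h \<odot> \<gamma>)) \<in> Arr (slice C b)"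
    using L.tr.component[of \<gamma>] typed by (simp only: morphism_eq[symmetric] slice_simps)
  then have E: "h \<odot> X.Tob \<gamma> = Y.Tob (h \<odot> \<gamma>) \<odot> und (\<Lambda> \<gamma>)" "und (\<Lambda> \<gamma>) \<in> Arr C"
      "Cod C (und (\<Lambda> \<gamma>)) = Dom C (Y.Tob (h \<odot> \<gamma>))"
    unfolding X.slice_arr_iff by blast+
  from E(1)[symmetric] show "Y.Tob (h \<odot> \<gamma>) \<odot> und (\<Lambda> \<gamma>) = h \<odot> X.Tob \<gamma>" .
  from arg_cong[OF this, of "Dom C"] E(2,3) show "und (\<Lambda> \<gamma>) \<in> Arr C"
    "Dom C (und (\<Lambda> \<gamma>)) = Dom C (X.Tob \<gamma>)" "Cod C (und (\<Lambda> \<gamma>)) = Dom C (Y.Tob (h \<odot> \<gamma>))"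
    using typed by simp_all
qed

lemma morphism_unit: "und (\<Lambda> \<gamma>) \<odot> X.e \<gamma> = Y.e (h \<odot> \<gamma>)"
  and morphism_mult: "und (\<Lambda> \<gamma>) \<odot> X.m \<gamma> = Y.m (h \<odot> \<gamma>) \<odot>
    (Y.Tar (und (\<Lambda> \<gamma>)) (Y.Tob (h \<odot> \<gamma>)) \<odot> und (\<Lambda> (X.Tob \<gamma>)))"
  and morphism_action: "\<beta> (h \<odot> \<gamma>) \<odot> und (\<Lambda> \<gamma>) = \<alpha> \<gamma>"
proof -
  interpret L: comorphism_between "slice C a" T "slice C b" S "postcomp C h" \<Lambda>
    by (rule comorphism_morphism)
  have g: "\<gamma> \<in> Obj (slice C a)" using typed by simp
  from arg_cong[OF L.unit_compat[OF g], of und]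
  show "und (\<Lambda> \<gamma>) \<odot> X.e \<gamma> = Y.e (h \<odot> \<gamma>)"
    using typed by (simp add: X.unit_eq Y.unit_eq)
  have T: "ArrMap (mfun S) (\<Lambda> \<gamma>) = (Y.Tob (h \<odot> X.Tob \<gamma>), Y.Tar (und (\<Lambda> \<gamma>)) (Y.Tob (h \<odot> \<gamma>)), Y.Tob (Y.Tob (h \<odot> \<gamma>)))"
    by (subst morphism_eq, rule Y.Tar_eq) (simp_all add: typed)
  from arg_cong[OF L.mult_compat[OF g], of und]
  show "und (\<Lambda> \<gamma>) \<odot> X.m \<gamma> = Y.m (h \<odot> \<gamma>) \<odot>
    (Y.Tar (und (\<Lambda> \<gamma>)) (Y.Tob (h \<odot> \<gamma>)) \<odot> und (\<Lambda> (X.Tob \<gamma>)))"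
    using typed by (simp add: X.mult_eq Y.mult_eq T)
  have "\<Lambda> \<gamma> \<in> Arr (slice C b)" using L.tr.component[OF g] .
  then show "\<beta> (h \<odot> \<gamma>) \<odot> und (\<Lambda> \<gamma>) = \<alpha> \<gamma>"
    using morphism g unfolding action_monad_morphism_def by simp
qed

end

lemma morphism_natural:
  assumes "\<delta> \<in> Arr C" "Cod C \<delta> = a" "f \<in> Arr C" "Cod C f = Dom C \<delta>"
  shows "und (\<Lambda> \<delta>) \<odot> X.Tar f \<delta> = Y.Tar f (h \<odot> \<delta>) \<odot> und (\<Lambda> (\<delta> \<odot> f))"
proof -
  interpret L: comorphism_between "slice C a" T "slice C b" S "postcomp C h" \<Lambda>
    by (rule comorphism_morphism)
  have x: "(\<delta> \<odot> f, f, \<delta>) \<in> Arr (slice C a)" using assms by simp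
  from arg_cong[OF L.tr.naturality[OF x refl refl], of und] show ?thesis
    using x assms by (simp add: X.Tar_eq Y.Tar_eq)
qed

end

end

section \<open>The category of action monads\<close>

lemma ActMnd_simps [simp]:
  "(a, T, \<alpha>) \<in> Obj (ActMnd C) \<longleftrightarrow> action_monad C a T \<alpha>"
  "(X, h, \<Lambda>, Y) \<in> Arr (ActMnd C) \<longleftrightarrow> action_monad_morphism C X Y h \<Lambda>"
  "Dom (ActMnd C) (X, h, \<Lambda>, Y) = X" "Cod (ActMnd C) (X, h, \<Lambda>, Y) = Y"
  "Ident (ActMnd C) (a, T, \<alpha>) = ((a, T, \<alpha>), Ident C a,
     (\<lambda>\<gamma> \<in> Obj (slice C a). Ident (slice C a) (ObjMap (mfun T) \<gamma>)), (a, T, \<alpha>))"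
  "(X', k, K, Z) \<odot>\<^bsub>ActMnd C\<^esub> (X, h, \<Lambda>, Y) = (X, k \<odot>\<^bsub>C\<^esub> h, (\<lambda>\<gamma> \<in> Obj (slice C (Dom C h)).
     K (h \<odot>\<^bsub>C\<^esub> \<gamma>) \<odot>\<^bsub>slice C (Cod C k)\<^esub> ArrMap (postcomp C k) (\<Lambda> \<gamma>)), Z)"
  by (simp_all add: ActMnd_def)

text \<open>
  The forgetful functor on arrows, without restriction to the carrier, so that it can be applied to
  a tuple before that tuple is known to be an arrow.
\<close>

definition forget_arr :: "('o, 'm) cat \<Rightarrow> ('o, 'm) actmor \<Rightarrow> ('m, 'm sarr) mndco" where
  "forget_arr C = (\<lambda>((a, T, \<alpha>), h, \<Lambda>, (b, S, \<beta>)). ((slice C a, T), postcomp C h, \<Lambda>, (slice C b, S)))"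

lemma action_monad_morphismD:
  assumes "action_monad_morphism C (a, T, \<alpha>) (b, S, \<beta>) h \<Lambda>"
  shows "action_monad C a T \<alpha>" "action_monad C b S \<beta>" "h \<in> Hom C a b"
    "comorphism (slice C a) T (slice C b) S (postcomp C h) \<Lambda>"
  using assms by (simp_all add: action_monad_morphism_def)

context category_with_pullbacks
begin

lemma two_action_monadsI:
  "\<lbrakk>action_monad C a T \<alpha>; action_monad C b S \<beta>; h \<in> Hom C a b\<rbrakk> \<Longrightarrow> two_action_monads C a T \<alpha> b S \<beta> h"
  unfolding two_action_monads_def two_action_monads_axioms_def action_monad_on_def action_monad_on_axioms_def
  using category_axioms by blast

lemma forget_arr_in:
  assumes "action_monad_morphism C (a, T, \<alpha>) (b, S, \<beta>) h \<Lambda>"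
  shows "forget_arr C ((a, T, \<alpha>), h, \<Lambda>, (b, S, \<beta>)) \<in> Hom Mnd_co_adj (slice C a, T) (slice C b, S)"
  using action_monad_morphismD[OF assms] left_adjoint_postcomp[OF action_monad_morphismD(3)[OF assms]]
  by (simp add: forget_arr_def Mnd_co_adj_def Hom_def)

lemma forget_arr_inject:
  assumes "f \<in> Hom (ActMnd C) X Y" "g \<in> Hom (ActMnd C) X Y" "forget_arr C f = forget_arr C g"
  shows "f = g"
proof -
  obtain a T \<alpha> b S \<beta> where XY: "X = (a, T, \<alpha>)" "Y = (b, S, \<beta>)" by (cases X; cases Y)
  obtain h \<Lambda> k K where fg: "f = (X, h, \<Lambda>, Y)" "g = (X, k, K, Y)"
    using assms(1,2) by (cases f; cases g) (simp add: Hom_def)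
  have "h \<in> Hom C a b" "k \<in> Hom C a b"
    using assms(1,2) unfolding fg XY by (simp_all add: Hom_def action_monad_morphism_def)
  then show ?thesis
    using assms(3) postcomp_inject unfolding fg XY forget_arr_def by simp
qed

lemma forget_arr_comp:
  assumes "action_monad_morphism C (a, T, \<alpha>) (b, S, \<beta>) h \<Lambda>" "action_monad_morphism C (b, S, \<beta>) (c, R, \<rho>) k K"
  shows "forget_arr C (((b, S, \<beta>), k, K, (c, R, \<rho>)) \<odot>\<^bsub>ActMnd C\<^esub> ((a, T, \<alpha>), h, \<Lambda>, (b, S, \<beta>))) =
    forget_arr C ((b, S, \<beta>), k, K, (c, R, \<rho>)) \<odot>\<^bsub>Mnd_co_adj\<^esub> forget_arr C ((a, T, \<alpha>), h, \<Lambda>, (b, S, \<beta>))"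
proof -
  note h = action_monad_morphismD(3)[OF assms(1)] and k = action_monad_morphismD(3)[OF assms(2)]
  have hk: "Dom C h = a" "Cod C k = c" using h k by (simp_all add: Hom_def)
  show ?thesis
    unfolding ActMnd_simps forget_arr_def Mnd_co_adj_def
    by (simp add: postcomp_comp[OF h k] hk cong: restrict_cong)
qed

text \<open>
  The composite is a comorphism because it is one in \<open>Mnd_co_adj\<close>; only its compatibility with the
  actions remains, and the two triangles over \<open>\<beta>\<close> paste to a triangle from \<open>\<alpha>\<close> to \<open>\<rho>\<close>.
\<close>

lemma ActMnd_comp_in:
  assumes f: "action_monad_morphism C (a, T, \<alpha>) (b, S, \<beta>) h \<Lambda>"
    and g: "action_monad_morphism C (b, S, \<beta>) (c, R, \<rho>) k K"
  shows "((b, S, \<beta>), k, K, (c, R, \<rho>)) \<odot>\<^bsub>ActMnd C\<^esub> ((a, T, \<alpha>), h, \<Lambda>, (b, S, \<beta>)) \<in>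
    Hom (ActMnd C) (a, T, \<alpha>) (c, R, \<rho>)"
proof -
  interpret F: two_action_monads C a T \<alpha> b S \<beta> h
    by (rule two_action_monadsI) (rule action_monad_morphismD[OF f])+
  interpret G: two_action_monads C b S \<beta> c R \<rho> k
    by (rule two_action_monadsI) (rule action_monad_morphismD[OF g])+
  define \<Theta> where "\<Theta> = (\<lambda>\<gamma> \<in> Obj (slice C a). K (h \<odot> \<gamma>) \<odot>\<^bsub>slice C c\<^esub> ArrMap (postcomp C k) (\<Lambda> \<gamma>))"
  have eq: "((b, S, \<beta>), k, K, (c, R, \<rho>)) \<odot>\<^bsub>ActMnd C\<^esub> ((a, T, \<alpha>), h, \<Lambda>, (b, S, \<beta>)) =
      ((a, T, \<alpha>), k \<odot> h, \<Theta>, (c, R, \<rho>))"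
    by (simp add: \<Theta>_def)
  have "forget_arr C ((a, T, \<alpha>), k \<odot> h, \<Theta>, (c, R, \<rho>)) \<in> Hom Mnd_co_adj (slice C a, T) (slice C c, R)"
    unfolding eq[symmetric] forget_arr_comp[OF f g]
    by (rule category.comp_in_hom[OF category_Mnd_co_adj forget_arr_in[OF f] forget_arr_in[OF g]])
  then have co: "comorphism (slice C a) T (slice C c) R (postcomp C (k \<odot> h)) \<Theta>"
    by (simp add: forget_arr_def Mnd_co_adj_def Hom_def)
  then interpret H: comorphism_between "slice C a" T "slice C c" R "postcomp C (k \<odot> h)" \<Theta>
    by (rule comorphism_betweenI)
  interpret L: comorphism_between "slice C a" T "slice C b" S "postcomp C h" \<Lambda>
    by (rule F.comorphism_morphism[OF f])
  have "\<rho> (k \<odot> h \<odot> \<gamma>) \<odot> ArrMap (dom_functor C c) (\<Theta> \<gamma>) = \<alpha> \<gamma>" if \<gamma>: "\<gamma> \<in> Obj (slice C a)" for \<gamma>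
  proof -
    have g': "\<gamma> \<in> Arr C" "Cod C \<gamma> = a" using \<gamma> by simp_all
    have "\<Theta> \<gamma> = K (h \<odot> \<gamma>) \<odot>\<^bsub>slice C c\<^esub> ArrMap (postcomp C k) (\<Lambda> \<gamma>)"
      unfolding \<Theta>_def using \<gamma> by (rule restrict_apply')
    moreover have "und (ArrMap (postcomp C k) (\<Lambda> \<gamma>)) = und (\<Lambda> \<gamma>)"
      using L.tr.component[OF \<gamma>] by (intro und_postcomp) simp_all
    ultimately have "ArrMap (dom_functor C c) (\<Theta> \<gamma>) = und (K (h \<odot> \<gamma>)) \<odot> und (\<Lambda> \<gamma>)"
      using H.tr.component[OF \<gamma>] by simp
    moreover have "\<rho> (k \<odot> (h \<odot> \<gamma>)) \<odot> (und (K (h \<odot> \<gamma>)) \<odot> und (\<Lambda> \<gamma>)) = \<beta> (h \<odot> \<gamma>) \<odot> und (\<Lambda> \<gamma>)"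
      by (rule precompose[OF G.morphism_action[OF g]])
        (simp_all add: g' G.morphism_und[OF g] F.morphism_und[OF f])
    ultimately show ?thesis
      using F.morphism_action[OF f g'] g' by simp
  qed
  then have "action_monad_morphism C (a, T, \<alpha>) (c, R, \<rho>) (k \<odot> h) \<Theta>"
    unfolding action_monad_morphism_def
    using co F.X.action_monad G.Y.action_monad by (simp add: Hom_def)
  then show ?thesis unfolding eq by (simp add: Hom_def)
qed

lemma ActMnd_ident_in:
  assumes "action_monad C a T \<alpha>"
  shows "Ident (ActMnd C) (a, T, \<alpha>) \<in> Hom (ActMnd C) (a, T, \<alpha>) (a, T, \<alpha>)"
    "forget_arr C (Ident (ActMnd C) (a, T, \<alpha>)) = Ident Mnd_co_adj (slice C a, T)"
proof -
  interpret action_monad_on C a T \<alpha>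
    using category_axioms assms by (simp add: action_monad_on_def action_monad_on_axioms_def)
  have "is_monad (slice C a) T" using assms by (simp add: action_monad_def)
  from comorphism_id[OF this] assms
  show "Ident (ActMnd C) (a, T, \<alpha>) \<in> Hom (ActMnd C) (a, T, \<alpha>) (a, T, \<alpha>)"
    by (simp add: Hom_def action_monad_morphism_def postcomp_ident)
  show "forget_arr C (Ident (ActMnd C) (a, T, \<alpha>)) = Ident Mnd_co_adj (slice C a, T)"
    by (simp add: forget_arr_def Mnd_co_adj_def postcomp_ident)
qed

lemma ActMnd_arrE:
  assumes "f \<in> Hom (ActMnd C) X Y"
  obtains a T \<alpha> h \<Lambda> b S \<beta> where "f = ((a, T, \<alpha>), h, \<Lambda>, (b, S, \<beta>))" "X = (a, T, \<alpha>)" "Y = (b, S, \<beta>)"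
    "action_monad_morphism C (a, T, \<alpha>) (b, S, \<beta>) h \<Lambda>"
  using assms by (cases f; cases X; cases Y) (auto simp: Hom_def)

lemma ActMnd_comp:
  assumes fg: "f \<in> Hom (ActMnd C) X Y" "g \<in> Hom (ActMnd C) Y Z"
  shows "g \<odot>\<^bsub>ActMnd C\<^esub> f \<in> Hom (ActMnd C) X Z"
    "forget_arr C (g \<odot>\<^bsub>ActMnd C\<^esub> f) = forget_arr C g \<odot>\<^bsub>Mnd_co_adj\<^esub> forget_arr C f"
    "\<exists>L M N. forget_arr C f \<in> Hom Mnd_co_adj L M \<and> forget_arr C g \<in> Hom Mnd_co_adj M N"
proof -
  obtain a T \<alpha> h \<Lambda> b S \<beta> where f: "f = ((a, T, \<alpha>), h, \<Lambda>, (b, S, \<beta>))" "X = (a, T, \<alpha>)" "Y = (b, S, \<beta>)"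
    "action_monad_morphism C (a, T, \<alpha>) (b, S, \<beta>) h \<Lambda>" by (rule ActMnd_arrE[OF fg(1)])
  obtain k K c R \<rho> where g: "g = ((b, S, \<beta>), k, K, (c, R, \<rho>))" "Z = (c, R, \<rho>)"
    "action_monad_morphism C (b, S, \<beta>) (c, R, \<rho>) k K"
    by (rule ActMnd_arrE[OF fg(2)]) (simp add: f)
  show "g \<odot>\<^bsub>ActMnd C\<^esub> f \<in> Hom (ActMnd C) X Z"
    "forget_arr C (g \<odot>\<^bsub>ActMnd C\<^esub> f) = forget_arr C g \<odot>\<^bsub>Mnd_co_adj\<^esub> forget_arr C f"
    "\<exists>L M N. forget_arr C f \<in> Hom Mnd_co_adj L M \<and> forget_arr C g \<in> Hom Mnd_co_adj M N"
    using ActMnd_comp_in[OF f(4) g(3)] forget_arr_comp[OF f(4) g(3)] forget_arr_in[OF f(4)] forget_arr_in[OF g(3)]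
    unfolding f g by blast+
qed

text \<open>
  The axioms of a category hold in \<open>ActMnd C\<close> because they hold in \<open>Mnd_co_adj\<close> and the forgetful
  map is injective on arrows with the same source and target.
\<close>

lemma category_ActMnd: "category (ActMnd C)"
proof -
  have arr: "\<exists>M N. forget_arr C f \<in> Hom Mnd_co_adj M N \<and>
      forget_arr C (Ident (ActMnd C) X) = Ident Mnd_co_adj M \<and>
      forget_arr C (Ident (ActMnd C) Y) = Ident Mnd_co_adj N \<and>
      Ident (ActMnd C) X \<in> Hom (ActMnd C) X X \<and> Ident (ActMnd C) Y \<in> Hom (ActMnd C) Y Y \<and>
      X \<in> Obj (ActMnd C) \<and> Y \<in> Obj (ActMnd C)"
    if "f \<in> Hom (ActMnd C) X Y" for f X Y
    using that
    by (elim ActMnd_arrE)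
      (metis forget_arr_in ActMnd_ident_in ActMnd_simps(1) action_monad_morphismD(1,2))
  interpret M: category "Mnd_co_adj :: (('m, 'm sarr) catmnd, ('m, 'm sarr) mndco) cat"
    by (rule category_Mnd_co_adj)
  show ?thesis
  proof
    fix f assume "f \<in> Arr (ActMnd C)"
    then have "f \<in> Hom (ActMnd C) (Dom (ActMnd C) f) (Cod (ActMnd C) f)" by (simp add: Hom_def)
    from arr[OF this] show "Dom (ActMnd C) f \<in> Obj (ActMnd C)" "Cod (ActMnd C) f \<in> Obj (ActMnd C)"
      by blast+
  next
    fix X assume "X \<in> Obj (ActMnd C)"
    then show "Ident (ActMnd C) X \<in> Hom (ActMnd C) X X"
      by (cases X) (metis ActMnd_ident_in(1) ActMnd_simps(1))
  next
    fix f g X Y Z assume "f \<in> Hom (ActMnd C) X Y" "g \<in> Hom (ActMnd C) Y Z"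
    then show "g \<odot>\<^bsub>ActMnd C\<^esub> f \<in> Hom (ActMnd C) X Z" using ActMnd_comp(1) by blast
  next
    fix f X Y assume f: "f \<in> Hom (ActMnd C) X Y"
    obtain M N where MN: "forget_arr C f \<in> Hom Mnd_co_adj M N"
      "forget_arr C (Ident (ActMnd C) X) = Ident Mnd_co_adj M"
      "forget_arr C (Ident (ActMnd C) Y) = Ident Mnd_co_adj N"
      "Ident (ActMnd C) X \<in> Hom (ActMnd C) X X" "Ident (ActMnd C) Y \<in> Hom (ActMnd C) Y Y"
      using arr[OF f] by blast
    show "Ident (ActMnd C) Y \<odot>\<^bsub>ActMnd C\<^esub> f = f"
      using ActMnd_comp[OF f MN(5)] MN f by (intro forget_arr_inject[OF _ f]) (simp_all add: M.ident_comp[OF MN(1)])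
    show "f \<odot>\<^bsub>ActMnd C\<^esub> Ident (ActMnd C) X = f"
      using ActMnd_comp[OF MN(4) f] MN f by (intro forget_arr_inject[OF _ f]) (simp_all add: M.comp_ident[OF MN(1)])
  next
    fix f g h X Y Z W
    assume f: "f \<in> Hom (ActMnd C) X Y" and g: "g \<in> Hom (ActMnd C) Y Z" and h: "h \<in> Hom (ActMnd C) Z W"
    note gf = ActMnd_comp[OF f g] and hg = ActMnd_comp[OF g h]
    note h_gf = ActMnd_comp[OF gf(1) h] and hg_f = ActMnd_comp[OF f hg(1)]
    obtain L M N where fg: "forget_arr C f \<in> Hom Mnd_co_adj L M" "forget_arr C g \<in> Hom Mnd_co_adj M N"
      using gf(3) by blast
    obtain K where "forget_arr C h \<in> Hom Mnd_co_adj N K"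
      using hg(3) fg(2) unfolding Hom_def by blast
    with fg have "forget_arr C (h \<odot>\<^bsub>ActMnd C\<^esub> g \<odot>\<^bsub>ActMnd C\<^esub> f) =
        forget_arr C (h \<odot>\<^bsub>ActMnd C\<^esub> (g \<odot>\<^bsub>ActMnd C\<^esub> f))"
      using gf hg h_gf hg_f by (simp add: M.comp_assoc)
    then show "h \<odot>\<^bsub>ActMnd C\<^esub> g \<odot>\<^bsub>ActMnd C\<^esub> f = h \<odot>\<^bsub>ActMnd C\<^esub> (g \<odot>\<^bsub>ActMnd C\<^esub> f)"
      by (rule forget_arr_inject[OF hg_f(1) h_gf(1)])
  qed
qed

lemma ActMnd_forget_simps:
  "action_monad C a T \<alpha> \<Longrightarrow> ObjMap (ActMnd_forget C) (a, T, \<alpha>) = (slice C a, T)"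
  "f \<in> Arr (ActMnd C) \<Longrightarrow> ArrMap (ActMnd_forget C) f = forget_arr C f"
  by (simp_all add: ActMnd_forget_def forget_arr_def)

theorem faithful_ActMnd_forget: "faithful_functor (ActMnd C) Mnd_co_adj (ActMnd_forget C)"
proof -
  interpret A: category "ActMnd C" by (rule category_ActMnd)
  have "is_functor (ActMnd C) Mnd_co_adj (ActMnd_forget C)"
    unfolding is_functor_def
  proof (intro conjI ballI impI category_ActMnd category_Mnd_co_adj)
    show "ObjMap (ActMnd_forget C) \<in> extensional (Obj (ActMnd C))"
      "ArrMap (ActMnd_forget C) \<in> extensional (Arr (ActMnd C))"
      by (simp_all add: ActMnd_forget_def)
  next
    fix X assume X: "X \<in> Obj (ActMnd C)"
    obtain a T \<alpha> where [simp]: "X = (a, T, \<alpha>)" by (cases X)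
    have m: "action_monad C a T \<alpha>" using X by simp
    then show "ObjMap (ActMnd_forget C) X \<in> Obj Mnd_co_adj"
      by (simp add: ActMnd_forget_simps Mnd_co_adj_def action_monad_def)
    show "ArrMap (ActMnd_forget C) (Ident (ActMnd C) X) = Ident Mnd_co_adj (ObjMap (ActMnd_forget C) X)"
      using ActMnd_forget_simps(1)[OF m] ActMnd_forget_simps(2)[OF A.ident_arr[OF X]] ActMnd_ident_in(2)[OF m]
      by simp
  next
    fix f assume "f \<in> Arr (ActMnd C)"
    then have *: "f \<in> Hom (ActMnd C) (Dom (ActMnd C) f) (Cod (ActMnd C) f)" by (simp add: Hom_def)
    show "ArrMap (ActMnd_forget C) f \<in>
        Hom Mnd_co_adj (ObjMap (ActMnd_forget C) (Dom (ActMnd C) f)) (ObjMap (ActMnd_forget C) (Cod (ActMnd C) f))"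
      by (rule ActMnd_arrE[OF *])
        (simp add: ActMnd_forget_simps action_monad_morphismD(1,2) forget_arr_in)
    fix g assume "g \<in> Arr (ActMnd C)" "Cod (ActMnd C) f = Dom (ActMnd C) g"
    then have **: "g \<in> Hom (ActMnd C) (Cod (ActMnd C) f) (Cod (ActMnd C) g)" by (simp add: Hom_def)
    have gf: "g \<odot>\<^bsub>ActMnd C\<^esub> f \<in> Arr (ActMnd C)" using A.comp_in_hom[OF * **] by (simp add: Hom_def)
    have "forget_arr C (g \<odot>\<^bsub>ActMnd C\<^esub> f) = forget_arr C g \<odot>\<^bsub>Mnd_co_adj\<^esub> forget_arr C f"
      by (rule ActMnd_comp(2)[OF * **])
    then show "ArrMap (ActMnd_forget C) (g \<odot>\<^bsub>ActMnd C\<^esub> f) =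
        ArrMap (ActMnd_forget C) g \<odot>\<^bsub>Mnd_co_adj\<^esub> ArrMap (ActMnd_forget C) f"
      using gf * ** by (simp add: ActMnd_forget_simps Hom_def)
  qed
  moreover have "f = g" if "f \<in> Arr (ActMnd C)" "g \<in> Arr (ActMnd C)" "Dom (ActMnd C) f = Dom (ActMnd C) g"
      "Cod (ActMnd C) f = Cod (ActMnd C) g" "ArrMap (ActMnd_forget C) f = ArrMap (ActMnd_forget C) g" for f g
    using that by (intro forget_arr_inject) (auto simp: Hom_def ActMnd_forget_simps)
  ultimately show ?thesis unfolding faithful_functor_def by blast
qed

end

section \<open>Internal categories and their action monads\<close>

context category_with_pullbacks
begin

lemma pb_pair_precompose:
  assumes "f \<in> Arr C" "g \<in> Arr C" "Cod C f = Cod C g" "a \<in> Arr C" "b \<in> Arr C" "Dom C a = Dom C b"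
    "Cod C a = Dom C f" "Cod C b = Dom C g" "f \<odot> a = g \<odot> b" "x \<in> Arr C" "Cod C x = Dom C b"
  shows "pb_pair C f g a b \<odot> x = pb_pair C f g (a \<odot> x) (b \<odot> x)"
proof -
  have "f \<odot> (a \<odot> x) = g \<odot> (b \<odot> x)" by (rule precompose2) (use assms in simp_all)
  then show ?thesis by - (rule pb_eqI[of f g]; use assms(1-8,10-) in \<open>simp add: assms(9)\<close>)
qed

lemma pb_pair_pr [simp]:
  assumes "f \<in> Arr C" "g \<in> Arr C" "Cod C f = Cod C g"
  shows "pb_pair C f g (pr1 C f g) (pr2 C f g) = Ident C (pb C f g)"
  by (rule pb_eqI[of f g]; simp add: assms)

end

locale internal_cat = category_with_pullbacks C for C :: "('o, 'm) cat" (structure) +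
  fixes D :: "('o, 'm) icat"
  assumes internal: "internal_category C D"
begin

abbreviation s where "s \<equiv> isrc D"
abbreviation t where "t \<equiv> itgt D"
abbreviation i where "i \<equiv> iid D"
abbreviation c where "c \<equiv> icomp D"

lemma typing [simp]:
  "iobj D \<in> Obj C" "iarr D \<in> Obj C"
  "s \<in> Arr C" "Dom C s = iarr D" "Cod C s = iobj D"
  "t \<in> Arr C" "Dom C t = iarr D" "Cod C t = iobj D"
  "i \<in> Arr C" "Dom C i = iobj D" "Cod C i = iarr D"
  "c \<in> Arr C" "Dom C c = pb C s t" "Cod C c = iarr D"
  using internal unfolding internal_category_def Let_def Hom_def by blast+

lemma equations [simp]:
  "s \<odot> i = Ident C (iobj D)" "t \<odot> i = Ident C (iobj D)"
  "s \<odot> c = s \<odot> pr2 C s t" "t \<odot> c = t \<odot> pr1 C s t"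
  using internal unfolding internal_category_def Let_def by blast+

lemma equations_precompose [simp]:
  "\<lbrakk>x \<in> Arr C; Cod C x = iobj D\<rbrakk> \<Longrightarrow> s \<odot> (i \<odot> x) = x"
  "\<lbrakk>x \<in> Arr C; Cod C x = iobj D\<rbrakk> \<Longrightarrow> t \<odot> (i \<odot> x) = x"
  "\<lbrakk>x \<in> Arr C; Cod C x = pb C s t\<rbrakk> \<Longrightarrow> s \<odot> (c \<odot> x) = s \<odot> (pr2 C s t \<odot> x)"
  "\<lbrakk>x \<in> Arr C; Cod C x = pb C s t\<rbrakk> \<Longrightarrow> t \<odot> (c \<odot> x) = t \<odot> (pr1 C s t \<odot> x)"
  using precompose[OF equations(1), of x] precompose[OF equations(2), of x]
    precompose2[OF equations(3), of x] precompose2[OF equations(4), of x] by simp_all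

text \<open>
  The composite of two generalized elements of the object of arrows.
\<close>

definition mul :: "'m \<Rightarrow> 'm \<Rightarrow> 'm" where
  "mul x y = c \<odot> pb_pair C s t x y"

lemma mul_pr: "mul (pr1 C s t) (pr2 C s t) = c"
  by (simp add: mul_def)

context
  fixes x y
  assumes xy: "x \<in> Arr C" "y \<in> Arr C" "Dom C x = Dom C y" "Cod C x = iarr D" "Cod C y = iarr D"
    "s \<odot> x = t \<odot> y"
begin

lemma mul [simp]:
  "mul x y \<in> Arr C" "Dom C (mul x y) = Dom C y" "Cod C (mul x y) = iarr D"
  "s \<odot> mul x y = s \<odot> y" "t \<odot> mul x y = t \<odot> x"
  using xy by (simp_all add: mul_def)

lemma mul_precompose [simp]:
  "\<lbrakk>z \<in> Arr C; Cod C z = Dom C y\<rbrakk> \<Longrightarrow> mul x y \<odot> z = mul (x \<odot> z) (y \<odot> z)"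
  using xy by (simp add: mul_def pb_pair_precompose)

end

lemma mul_ident_left [simp]:
  assumes "x \<in> Arr C" "Cod C x = iarr D" "t \<odot> x = y"
  shows "mul (i \<odot> y) x = x"
proof -
  have 1: "mul (i \<odot> t) (Ident C (iarr D)) = Ident C (iarr D)"
    using internal unfolding internal_category_def Let_def mul_def by blast
  have "mul (i \<odot> t) (Ident C (iarr D)) \<odot> x = mul (i \<odot> y) x"
    using assms by simp
  then show ?thesis unfolding 1 using assms by simp
qed

lemma mul_ident_right [simp]:
  assumes "x \<in> Arr C" "Cod C x = iarr D" "s \<odot> x = y"
  shows "mul x (i \<odot> y) = x"
proof -
  have 1: "mul (Ident C (iarr D)) (i \<odot> s) = Ident C (iarr D)"
    using internal unfolding internal_category_def Let_def mul_def by blast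
  have "mul (Ident C (iarr D)) (i \<odot> s) \<odot> x = mul x (i \<odot> y)"
    using assms by simp
  then show ?thesis unfolding 1 using assms by simp
qed

text \<open>
  Associativity is an axiom for the generic composable triple; every composable triple is obtained
  from it by precomposition with the induced arrow \<open>w\<close>.
\<close>

lemma mul_assoc:
  assumes "x \<in> Arr C" "y \<in> Arr C" "z \<in> Arr C" "Dom C x = Dom C z" "Dom C y = Dom C z"
    "Cod C x = iarr D" "Cod C y = iarr D" "Cod C z = iarr D" "s \<odot> x = t \<odot> y" "s \<odot> y = t \<odot> z"
  shows "mul x (mul y z) = mul (mul x y) z"
proof -
  let ?p = "pr1 C s (t \<odot> pr1 C s t)" and ?q = "pr2 C s (t \<odot> pr1 C s t)"
  define w where "w = pb_pair C s (t \<odot> pr1 C s t) x (pb_pair C s t y z)"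
  have w: "w \<in> Arr C" "Dom C w = Dom C z" "Cod C w = pb C s (t \<odot> pr1 C s t)"
    "?p \<odot> w = x" "?q \<odot> w = pb_pair C s t y z"
    using assms by (simp_all add: w_def)
  have "mul ?p (c \<odot> ?q) = mul (mul ?p (pr1 C s t \<odot> ?q)) (pr2 C s t \<odot> ?q)"
    using internal unfolding internal_category_def Let_def mul_def by blast
  then have "mul ?p (c \<odot> ?q) \<odot> w = mul (mul ?p (pr1 C s t \<odot> ?q)) (pr2 C s t \<odot> ?q) \<odot> w"
    by simp
  then show ?thesis using w assms by (simp add: mul_def[of y z])
qed

text \<open>
  On generalized elements the multiplication is \<open>(g, (f, x)) \<mapsto> (g f, x)\<close>. This form avoids the
  intermediate pullback of \<open>((g, f), x)\<close>.
\<close>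

lemma act_comp_assoc_eq:
  assumes "\<gamma> \<in> Arr C" "Cod C \<gamma> = iobj D"
  shows "act_comp_id C D \<gamma> \<odot> act_assoc C D \<gamma> = pb_pair C s \<gamma>
    (mul (pr1 C s (t \<odot> pr1 C s \<gamma>)) (pr1 C s \<gamma> \<odot> pr2 C s (t \<odot> pr1 C s \<gamma>)))
    (pr2 C s \<gamma> \<odot> pr2 C s (t \<odot> pr1 C s \<gamma>))"
proof -
  let ?u = "s \<odot> pr2 C s t"
  have u: "s \<odot> (pr2 C s t \<odot> pr1 C ?u \<gamma>) = \<gamma> \<odot> pr2 C ?u \<gamma>"
  proof -
    have "?u \<odot> pr1 C ?u \<gamma> = \<gamma> \<odot> pr2 C ?u \<gamma>" by (rule pr_eq) (use assms in simp_all)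
    moreover have "?u \<odot> pr1 C ?u \<gamma> = s \<odot> (pr2 C s t \<odot> pr1 C ?u \<gamma>)" by (rule assoc) (use assms in simp_all)
    ultimately show ?thesis by metis
  qed
  show ?thesis
    unfolding act_comp_id_def act_assoc_def Let_def act_obj_def
    by (rule pb_eqI[of s \<gamma>]) (simp_all add: assms u mul_def)
qed

lemma act_monad_simps [simp]:
  "\<lbrakk>\<gamma> \<in> Arr C; Cod C \<gamma> = iobj D\<rbrakk> \<Longrightarrow> ObjMap (mfun (act_monad C D)) \<gamma> = t \<odot> pr1 C s \<gamma>"
  "\<lbrakk>\<gamma> \<in> Arr C; Cod C \<gamma> = iobj D\<rbrakk> \<Longrightarrow> act_proj C D \<gamma> = pr2 C s \<gamma>"
  by (simp_all add: act_monad_def act_functor_def act_proj_def act_obj_def)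

text \<open>
  Underlying arrows of the functor, the unit and the multiplication. They are characterised by
  their composites with the two projections; on generalized elements, \<open>ar f \<delta>\<close> is
  \<open>(g, x) \<mapsto> (g, f x)\<close>, \<open>un \<gamma>\<close> is \<open>x \<mapsto> (i (\<gamma> x), x)\<close> and \<open>mu \<gamma>\<close> is \<open>(g, (f, x)) \<mapsto> (g f, x)\<close>.
\<close>

definition ar :: "'m \<Rightarrow> 'm \<Rightarrow> 'm" where
  "ar f \<delta> = pb_pair C s \<delta> (pr1 C s (\<delta> \<odot> f)) (f \<odot> pr2 C s (\<delta> \<odot> f))"

definition un :: "'m \<Rightarrow> 'm" where
  "un \<gamma> = pb_pair C s \<gamma> (i \<odot> \<gamma>) (Ident C (Dom C \<gamma>))"

definition mu :: "'m \<Rightarrow> 'm" where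
  "mu \<gamma> = pb_pair C s \<gamma>
    (mul (pr1 C s (t \<odot> pr1 C s \<gamma>)) (pr1 C s \<gamma> \<odot> pr2 C s (t \<odot> pr1 C s \<gamma>)))
    (pr2 C s \<gamma> \<odot> pr2 C s (t \<odot> pr1 C s \<gamma>))"

context
  fixes f \<delta>
  assumes typed: "\<delta> \<in> Arr C" "Cod C \<delta> = iobj D" "f \<in> Arr C" "Cod C f = Dom C \<delta>"
begin

lemma ar [simp]:
  "ar f \<delta> \<in> Arr C" "Dom C (ar f \<delta>) = pb C s (\<delta> \<odot> f)" "Cod C (ar f \<delta>) = pb C s \<delta>"
  "pr1 C s \<delta> \<odot> ar f \<delta> = pr1 C s (\<delta> \<odot> f)" "pr2 C s \<delta> \<odot> ar f \<delta> = f \<odot> pr2 C s (\<delta> \<odot> f)"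
  using typed by (simp_all add: ar_def)

lemma ar_precompose [simp]:
  assumes "x \<in> Arr C" "Cod C x = pb C s (\<delta> \<odot> f)"
  shows "pr1 C s \<delta> \<odot> (ar f \<delta> \<odot> x) = pr1 C s (\<delta> \<odot> f) \<odot> x"
    "pr2 C s \<delta> \<odot> (ar f \<delta> \<odot> x) = f \<odot> (pr2 C s (\<delta> \<odot> f) \<odot> x)"
  using precompose[OF ar(4), of x] precompose2[OF ar(5), of x] assms typed by simp_all

end

context
  fixes \<gamma>
  assumes typed: "\<gamma> \<in> Arr C" "Cod C \<gamma> = iobj D"
begin

lemma un [simp]:
  "un \<gamma> \<in> Arr C" "Dom C (un \<gamma>) = Dom C \<gamma>" "Cod C (un \<gamma>) = pb C s \<gamma>"
  "pr1 C s \<gamma> \<odot> un \<gamma> = i \<odot> \<gamma>" "pr2 C s \<gamma> \<odot> un \<gamma> = Ident C (Dom C \<gamma>)"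
  using typed by (simp_all add: un_def)

lemma un_precompose [simp]:
  assumes "x \<in> Arr C" "Cod C x = Dom C \<gamma>"
  shows "pr1 C s \<gamma> \<odot> (un \<gamma> \<odot> x) = i \<odot> (\<gamma> \<odot> x)" "pr2 C s \<gamma> \<odot> (un \<gamma> \<odot> x) = x"
  using precompose2[OF un(4), of x] precompose[OF un(5), of x] assms typed by simp_all

lemma mu [simp]:
  "mu \<gamma> \<in> Arr C" "Dom C (mu \<gamma>) = pb C s (t \<odot> pr1 C s \<gamma>)" "Cod C (mu \<gamma>) = pb C s \<gamma>"
  "pr1 C s \<gamma> \<odot> mu \<gamma> = mul (pr1 C s (t \<odot> pr1 C s \<gamma>)) (pr1 C s \<gamma> \<odot> pr2 C s (t \<odot> pr1 C s \<gamma>))"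
  "pr2 C s \<gamma> \<odot> mu \<gamma> = pr2 C s \<gamma> \<odot> pr2 C s (t \<odot> pr1 C s \<gamma>)"
  using typed by (simp_all add: mu_def)

lemma mu_precompose [simp]:
  assumes "x \<in> Arr C" "Cod C x = pb C s (t \<odot> pr1 C s \<gamma>)"
  shows "pr1 C s \<gamma> \<odot> (mu \<gamma> \<odot> x) =
      mul (pr1 C s (t \<odot> pr1 C s \<gamma>) \<odot> x) (pr1 C s \<gamma> \<odot> (pr2 C s (t \<odot> pr1 C s \<gamma>) \<odot> x))"
    "pr2 C s \<gamma> \<odot> (mu \<gamma> \<odot> x) = pr2 C s \<gamma> \<odot> (pr2 C s (t \<odot> pr1 C s \<gamma>) \<odot> x)"
  using precompose[OF mu(4), of x] precompose2[OF mu(5), of x] assms typed by simp_all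

end

text \<open>
  An arrow into the pullback of \<open>s\<close> and \<open>\<delta> \<odot> f\<close> is a pair, and \<open>ar f \<delta>\<close> leaves the first component
  unchanged; so the first component is read off from \<open>x\<close> and the second one is \<open>y\<close>.
\<close>

lemma ar_pullback:
  assumes typed: "\<delta> \<in> Arr C" "Cod C \<delta> = iobj D" "f \<in> Arr C" "Cod C f = Dom C \<delta>"
  shows "is_pullback C (pr2 C s \<delta>) f (ar f \<delta>) (pr2 C s (\<delta> \<odot> f))"
proof -
  have "\<exists>!u. u \<in> Hom C w (Dom C (ar f \<delta>)) \<and> ar f \<delta> \<odot> u = x \<and> pr2 C s (\<delta> \<odot> f) \<odot> u = y"
    if xy: "x \<in> Arr C" "Dom C x = w" "Cod C x = pb C s \<delta>" "y \<in> Arr C" "Dom C y = w" "Cod C y = Dom C f"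
      "pr2 C s \<delta> \<odot> x = f \<odot> y" for w x y
  proof (rule ex1I[of _ "pb_pair C s (\<delta> \<odot> f) (pr1 C s \<delta> \<odot> x) y"])
    define v where "v = pb_pair C s (\<delta> \<odot> f) (pr1 C s \<delta> \<odot> x) y"
    have v: "v \<in> Arr C" "Dom C v = w" "Cod C v = pb C s (\<delta> \<odot> f)"
      "pr1 C s (\<delta> \<odot> f) \<odot> v = pr1 C s \<delta> \<odot> x" "pr2 C s (\<delta> \<odot> f) \<odot> v = y"
      using xy typed by (simp_all add: v_def)
    have "ar f \<delta> \<odot> v = x"
      by (rule pb_eqI[of s \<delta>]; simp add: typed xy v)
    then show "v \<in> Hom C w (Dom C (ar f \<delta>)) \<and> ar f \<delta> \<odot> v = x \<and> pr2 C s (\<delta> \<odot> f) \<odot> v = y"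
      by (simp add: Hom_def v typed)
    fix u assume "u \<in> Hom C w (Dom C (ar f \<delta>)) \<and> ar f \<delta> \<odot> u = x \<and> pr2 C s (\<delta> \<odot> f) \<odot> u = y"
    then have u: "u \<in> Arr C" "Dom C u = w" "Cod C u = pb C s (\<delta> \<odot> f)"
      "ar f \<delta> \<odot> u = x" "pr2 C s (\<delta> \<odot> f) \<odot> u = y"
      by (simp_all add: Hom_def typed)
    have "pr1 C s (\<delta> \<odot> f) \<odot> u = pr1 C s \<delta> \<odot> x"
      using ar_precompose(1)[OF typed u(1,3)] u(4) by simp
    then show "u = v"
      by - (rule pb_eqI[of s "\<delta> \<odot> f"]; simp add: typed u v)
  qed
  then show ?thesis using typed unfolding is_pullback_def by (simp add: Hom_def)
qed

lemma act_monad_eq: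
  "mfun (act_monad C D) = \<lparr>ObjMap = (\<lambda>\<gamma>\<in>Obj (slice C (iobj D)). t \<odot> pr1 C s \<gamma>),
     ArrMap = (\<lambda>(\<gamma>, f, \<delta>)\<in>Arr (slice C (iobj D)). (t \<odot> pr1 C s \<gamma>, ar f \<delta>, t \<odot> pr1 C s \<delta>))\<rparr>"
  "munit (act_monad C D) = (\<lambda>\<gamma>\<in>Obj (slice C (iobj D)). (\<gamma>, un \<gamma>, t \<odot> pr1 C s \<gamma>))"
  "mmult (act_monad C D) = (\<lambda>\<gamma>\<in>Obj (slice C (iobj D)).
     (t \<odot> pr1 C s (t \<odot> pr1 C s \<gamma>), mu \<gamma>, t \<odot> pr1 C s \<gamma>))"
proof -
  show "mfun (act_monad C D) = \<lparr>ObjMap = (\<lambda>\<gamma>\<in>Obj (slice C (iobj D)). t \<odot> pr1 C s \<gamma>),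
     ArrMap = (\<lambda>(\<gamma>, f, \<delta>)\<in>Arr (slice C (iobj D)). (t \<odot> pr1 C s \<gamma>, ar f \<delta>, t \<odot> pr1 C s \<delta>))\<rparr>"
    by (auto simp: act_monad_def act_functor_def act_obj_def ar_def intro!: restrict_ext)
qed (simp_all add: act_monad_def act_unit_def act_mult_def act_obj_def act_comp_assoc_eq un_def mu_def
    cong: restrict_cong)

lemma action_monad_act: "action_monad C (iobj D) (act_monad C D) (act_proj C D)"
proof (rule action_monadI[OF typing(1) act_monad_eq, where p = "\<lambda>\<gamma>. pr2 C s \<gamma>"], goal_cases)
  case 1 show ?case by (simp add: act_proj_def)
next
  case 2 then show ?case by simp
next
  case 3 then show ?case by simp
next
  case (4 \<delta>) show ?case by (rule pb_eqI[of s \<delta>]; use 4 in simp)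
next
  case (5 \<delta> f g) show ?case by (rule pb_eqI[of s \<delta>]; use 5 in simp)
next
  case 6 then show ?case by simp
next
  case 7 then show ?case by simp
next
  case 8 then show ?case by simp
next
  case (9 \<delta> f) show ?case by (rule pb_eqI[of s \<delta>]; use 9 in simp)
next
  case (10 \<delta> f) show ?case by (rule pb_eqI[of s \<delta>]; use 10 in simp)
next
  case 11 then show ?case by (rule ar_pullback)
next
  case 12 then show ?case by simp
next
  case 13 then show ?case by simp
next
  case (14 \<gamma>) show ?case by (rule pb_eqI[of s \<gamma>]; use 14 in simp)
next
  case (15 \<gamma>) show ?case by (rule pb_eqI[of s \<gamma>]; use 15 in simp)
next
  case (16 \<gamma>) show ?case by (rule pb_eqI[of s \<gamma>]; use 16 in \<open>simp add: mul_assoc\<close>)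
qed

end

sublocale internal_cat \<subseteq> A: action_monad_on C "iobj D" "act_monad C D" "act_proj C D"
  using action_monad_act category_axioms by (simp add: action_monad_on_def action_monad_on_axioms_def)

context internal_cat
begin

lemma Tar_act [simp]:
  "\<lbrakk>\<delta> \<in> Arr C; Cod C \<delta> = iobj D; f \<in> Arr C; Cod C f = Dom C \<delta>\<rbrakk> \<Longrightarrow> A.Tar f \<delta> = ar f \<delta>"
  unfolding A.Tar_def act_monad_eq by simp

lemma e_act [simp]: "\<lbrakk>\<gamma> \<in> Arr C; Cod C \<gamma> = iobj D\<rbrakk> \<Longrightarrow> A.e \<gamma> = un \<gamma>"
  unfolding A.e_def act_monad_eq by simp

lemma m_act [simp]: "\<lbrakk>\<gamma> \<in> Arr C; Cod C \<gamma> = iobj D\<rbrakk> \<Longrightarrow> A.m \<gamma> = mu \<gamma>"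
  unfolding A.m_def act_monad_eq by simp

end

locale internal_functor_between = D: internal_cat C D + E: internal_cat C E
  for C :: "('o, 'm) cat" (structure) and D E +
  fixes F0 F1 :: 'm
  assumes internal_functor: "internal_functor C D E F0 F1"
begin

lemma F_typing [simp]:
  "F0 \<in> Arr C" "Dom C F0 = iobj D" "Cod C F0 = iobj E"
  "F1 \<in> Arr C" "Dom C F1 = iarr D" "Cod C F1 = iarr E"
  using internal_functor unfolding internal_functor_def Hom_def by blast+

lemma F_axioms [simp]:
  "isrc E \<odot> F1 = F0 \<odot> isrc D" "itgt E \<odot> F1 = F0 \<odot> itgt D" "F1 \<odot> iid D = iid E \<odot> F0"
  using internal_functor unfolding internal_functor_def by blast+

lemma F_axioms_precompose [simp]:
  "\<lbrakk>x \<in> Arr C; Cod C x = iarr D\<rbrakk> \<Longrightarrow> isrc E \<odot> (F1 \<odot> x) = F0 \<odot> (isrc D \<odot> x)"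
  "\<lbrakk>x \<in> Arr C; Cod C x = iarr D\<rbrakk> \<Longrightarrow> itgt E \<odot> (F1 \<odot> x) = F0 \<odot> (itgt D \<odot> x)"
  "\<lbrakk>x \<in> Arr C; Cod C x = iobj D\<rbrakk> \<Longrightarrow> F1 \<odot> (iid D \<odot> x) = iid E \<odot> (F0 \<odot> x)"
  using D.precompose2[OF F_axioms(1), of x] D.precompose2[OF F_axioms(2), of x]
    D.precompose2[OF F_axioms(3), of x] by simp_all

lemma F_mul [simp]:
  assumes "x \<in> Arr C" "y \<in> Arr C" "Dom C x = Dom C y" "Cod C x = iarr D" "Cod C y = iarr D"
    "isrc D \<odot> x = itgt D \<odot> y"
  shows "F1 \<odot> D.mul x y = E.mul (F1 \<odot> x) (F1 \<odot> y)"
proof -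
  have "F1 \<odot> icomp D = E.mul (F1 \<odot> pr1 C (isrc D) (itgt D)) (F1 \<odot> pr2 C (isrc D) (itgt D))"
    using internal_functor unfolding internal_functor_def E.mul_def by blast
  then have "F1 \<odot> icomp D \<odot> pb_pair C (isrc D) (itgt D) x y =
      E.mul (F1 \<odot> pr1 C (isrc D) (itgt D)) (F1 \<odot> pr2 C (isrc D) (itgt D)) \<odot> pb_pair C (isrc D) (itgt D) x y"
    by simp
  then show ?thesis using assms by (simp add: D.mul_def)
qed

sublocale two_action_monads C "iobj D" "act_monad C D" "act_proj C D" "iobj E" "act_monad C E" "act_proj C E" F0
  by unfold_locales (simp add: Hom_def)

text \<open>
  The underlying arrow of the component of the comorphism, \<open>(g, x) \<mapsto> (F1 g, x)\<close>.
\<close>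

definition tau :: "'m \<Rightarrow> 'm" where
  "tau \<gamma> = pb_pair C (isrc E) (F0 \<odot> \<gamma>) (F1 \<odot> pr1 C (isrc D) \<gamma>) (pr2 C (isrc D) \<gamma>)"

context
  fixes \<gamma>
  assumes typed: "\<gamma> \<in> Arr C" "Cod C \<gamma> = iobj D"
begin

lemma tau [simp]:
  "tau \<gamma> \<in> Arr C" "Dom C (tau \<gamma>) = pb C (isrc D) \<gamma>" "Cod C (tau \<gamma>) = pb C (isrc E) (F0 \<odot> \<gamma>)"
  "pr1 C (isrc E) (F0 \<odot> \<gamma>) \<odot> tau \<gamma> = F1 \<odot> pr1 C (isrc D) \<gamma>"
  "pr2 C (isrc E) (F0 \<odot> \<gamma>) \<odot> tau \<gamma> = pr2 C (isrc D) \<gamma>"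
  using typed by (simp_all add: tau_def)

lemma tau_precompose [simp]:
  assumes "x \<in> Arr C" "Cod C x = pb C (isrc D) \<gamma>"
  shows "pr1 C (isrc E) (F0 \<odot> \<gamma>) \<odot> (tau \<gamma> \<odot> x) = F1 \<odot> (pr1 C (isrc D) \<gamma> \<odot> x)"
    "pr2 C (isrc E) (F0 \<odot> \<gamma>) \<odot> (tau \<gamma> \<odot> x) = pr2 C (isrc D) \<gamma> \<odot> x"
  using D.precompose2[OF tau(4), of x] D.precompose[OF tau(5), of x] assms typed by simp_all

end

lemma act_tau_eq: "act_tau C D E F0 F1 = (\<lambda>\<gamma>\<in>Obj (slice C (iobj D)).
    (F0 \<odot> ObjMap (mfun (act_monad C D)) \<gamma>, tau \<gamma>, ObjMap (mfun (act_monad C E)) (F0 \<odot> \<gamma>)))"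
  by (simp add: act_tau_def act_obj_def tau_def cong: restrict_cong)

lemma act_tau_morphism:
  "action_monad_morphism C (iobj D, act_monad C D, act_proj C D) (iobj E, act_monad C E, act_proj C E)
     F0 (act_tau C D E F0 F1)"
proof (rule morphismI[OF act_tau_eq], goal_cases)
  case 1 then show ?case by simp
next
  case (2 \<delta> f) show ?case by (rule D.pb_eqI[of "isrc E" "F0 \<odot> \<delta>"]; use 2 in simp)
next
  case (3 \<gamma>) show ?case by (rule D.pb_eqI[of "isrc E" "F0 \<odot> \<gamma>"]; use 3 in simp)
next
  case (4 \<gamma>) show ?case by (rule D.pb_eqI[of "isrc E" "F0 \<odot> \<gamma>"]; use 4 in simp)
next
  case 5 then show ?case by simp
qed

end

section \<open>The functor from internal categories to action monads\<close>

lemma Cat_int_simps [simp]: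
  "D \<in> Obj (Cat_int C) \<longleftrightarrow> internal_category C D"
  "(D, F0, F1, E) \<in> Arr (Cat_int C) \<longleftrightarrow> internal_functor C D E F0 F1"
  "Dom (Cat_int C) (D, F0, F1, E) = D" "Cod (Cat_int C) (D, F0, F1, E) = E"
  "Ident (Cat_int C) D = (D, Ident C (iobj D), Ident C (iarr D), D)"
  "(E', G0, G1, H) \<odot>\<^bsub>Cat_int C\<^esub> (D, F0, F1, E) = (D, G0 \<odot>\<^bsub>C\<^esub> F0, G1 \<odot>\<^bsub>C\<^esub> F1, H)"
  by (simp_all add: Cat_int_def)

context category_with_pullbacks
begin

lemma internal_catI: "internal_category C D \<Longrightarrow> internal_cat C D"
  by (simp add: internal_cat_def internal_cat_axioms_def category_with_pullbacks_axioms)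

lemma internal_functor_betweenI: "internal_functor C D E F0 F1 \<Longrightarrow> internal_functor_between C D E F0 F1"
  unfolding internal_functor_between_def internal_functor_between_axioms_def
  using internal_catI by (simp add: internal_functor_def)

lemma internal_functor_ident:
  assumes "internal_category C D" shows "internal_functor C D D (Ident C (iobj D)) (Ident C (iarr D))"
proof -
  interpret internal_cat C D by (rule internal_catI) fact
  show ?thesis using assms by (simp add: internal_functor_def Hom_def)
qed

lemma internal_functor_comp:
  assumes "internal_functor C D E F0 F1" "internal_functor C E H G0 G1"
  shows "internal_functor C D H (G0 \<odot> F0) (G1 \<odot> F1)"
proof -
  interpret F: internal_functor_between C D E F0 F1 by (rule internal_functor_betweenI) fact
  interpret G: internal_functor_between C E H G0 G1 by (rule internal_functor_betweenI) fact
  have "G1 \<odot> (F1 \<odot> F.D.mul (pr1 C (isrc D) (itgt D)) (pr2 C (isrc D) (itgt D))) =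
      G.E.mul (G1 \<odot> (F1 \<odot> pr1 C (isrc D) (itgt D))) (G1 \<odot> (F1 \<odot> pr2 C (isrc D) (itgt D)))"
    by simp
  then show ?thesis
    using F.D.internal G.E.internal
    by (simp add: internal_functor_def Hom_def F.D.mul_pr) (simp add: G.E.mul_def)
qed

lemma category_Cat_int: "category (Cat_int C)"
proof
  fix f assume f: "f \<in> Arr (Cat_int C)"
  obtain D F0 F1 E where [simp]: "f = (D, F0, F1, E)" by (cases f)
  show "Dom (Cat_int C) f \<in> Obj (Cat_int C)" "Cod (Cat_int C) f \<in> Obj (Cat_int C)"
    using f by (simp_all add: internal_functor_def)
next
  fix D assume "D \<in> Obj (Cat_int C)"
  then show "Ident (Cat_int C) D \<in> Hom (Cat_int C) D D"
    by (simp add: Hom_def internal_functor_ident)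
next
  fix f g h D E H K
  assume f: "f \<in> Hom (Cat_int C) D E"
  obtain F0 F1 where [simp]: "f = (D, F0, F1, E)" using f by (cases f) (simp add: Hom_def)
  have F: "internal_functor C D E F0 F1" using f by (simp add: Hom_def)
  then interpret F: internal_functor_between C D E F0 F1 by (rule internal_functor_betweenI)
  show "Ident (Cat_int C) E \<odot>\<^bsub>Cat_int C\<^esub> f = f" "f \<odot>\<^bsub>Cat_int C\<^esub> Ident (Cat_int C) D = f"
    by simp_all
  assume g: "g \<in> Hom (Cat_int C) E H"
  obtain G0 G1 where [simp]: "g = (E, G0, G1, H)" using g by (cases g) (simp add: Hom_def)
  have G: "internal_functor C E H G0 G1" using g by (simp add: Hom_def)
  then interpret G: internal_functor_between C E H G0 G1 by (rule internal_functor_betweenI)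
  show "g \<odot>\<^bsub>Cat_int C\<^esub> f \<in> Hom (Cat_int C) D H"
    using internal_functor_comp[OF F G] by (simp add: Hom_def)
  assume h: "h \<in> Hom (Cat_int C) H K"
  obtain H0 H1 where [simp]: "h = (H, H0, H1, K)" using h by (cases h) (simp add: Hom_def)
  interpret H: internal_functor_between C H K H0 H1
    by (rule internal_functor_betweenI) (use h in \<open>simp add: Hom_def\<close>)
  show "h \<odot>\<^bsub>Cat_int C\<^esub> g \<odot>\<^bsub>Cat_int C\<^esub> f = h \<odot>\<^bsub>Cat_int C\<^esub> (g \<odot>\<^bsub>Cat_int C\<^esub> f)"
    by simp
qed

lemma T_Act_simps:
  "internal_category C D \<Longrightarrow> ObjMap (T_Act C) D = (iobj D, act_monad C D, act_proj C D)"
  "internal_functor C D E F0 F1 \<Longrightarrow> ArrMap (T_Act C) (D, F0, F1, E) =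
    ((iobj D, act_monad C D, act_proj C D), F0, act_tau C D E F0 F1, (iobj E, act_monad C E, act_proj C E))"
  by (simp_all add: T_Act_def)

theorem is_functor_T_Act: "is_functor (Cat_int C) (ActMnd C) (T_Act C)"
  unfolding is_functor_def
proof (intro conjI ballI impI category_Cat_int category_ActMnd)
  show "ObjMap (T_Act C) \<in> extensional (Obj (Cat_int C))" "ArrMap (T_Act C) \<in> extensional (Arr (Cat_int C))"
    by (simp_all add: T_Act_def)
next
  fix D assume D: "D \<in> Obj (Cat_int C)"
  then interpret internal_cat C D by (intro internal_catI) simp
  show "ObjMap (T_Act C) D \<in> Obj (ActMnd C)"
    using internal by (simp add: T_Act_simps action_monad_act)
  interpret I: internal_functor_between C D D "Ident C (iobj D)" "Ident C (iarr D)"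
    by (rule internal_functor_betweenI) (rule internal_functor_ident[OF internal])
  have "I.tau \<gamma> = Ident C (pb C s \<gamma>)" if "\<gamma> \<in> Arr C" "Cod C \<gamma> = iobj D" for \<gamma>
    using that by (simp add: I.tau_def)
  then have "act_tau C D D (Ident C (iobj D)) (Ident C (iarr D)) =
      (\<lambda>\<gamma>\<in>Obj (slice C (iobj D)). Ident (slice C (iobj D)) (ObjMap (mfun (act_monad C D)) \<gamma>))"
    unfolding I.act_tau_eq by (intro restrict_ext) simp
  then show "ArrMap (T_Act C) (Ident (Cat_int C) D) = Ident (ActMnd C) (ObjMap (T_Act C) D)"
    using internal internal_functor_ident[OF internal] by (simp add: T_Act_simps)
next
  fix f assume f: "f \<in> Arr (Cat_int C)"
  obtain D F0 F1 E where [simp]: "f = (D, F0, F1, E)" by (cases f)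
  have F: "internal_functor C D E F0 F1" using f by simp
  then interpret F: internal_functor_between C D E F0 F1 by (rule internal_functor_betweenI)
  show "ArrMap (T_Act C) f \<in> Hom (ActMnd C) (ObjMap (T_Act C) (Dom (Cat_int C) f)) (ObjMap (T_Act C) (Cod (Cat_int C) f))"
    using F F.D.internal F.E.internal F.act_tau_morphism by (simp add: T_Act_simps Hom_def)
  fix g assume g: "g \<in> Arr (Cat_int C)" "Cod (Cat_int C) f = Dom (Cat_int C) g"
  obtain G0 G1 H where [simp]: "g = (E, G0, G1, H)" using g by (cases g) simp
  have G: "internal_functor C E H G0 G1" using g by simp
  then interpret G: internal_functor_between C E H G0 G1 by (rule internal_functor_betweenI)
  note GF = internal_functor_comp[OF F G]
  interpret GF: internal_functor_between C D H "G0 \<odot> F0" "G1 \<odot> F1" by (rule internal_functor_betweenI[OF GF])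
  have "GF.tau \<gamma> = G.tau (F0 \<odot> \<gamma>) \<odot> F.tau \<gamma>" if \<gamma>: "\<gamma> \<in> Arr C" "Cod C \<gamma> = iobj D" for \<gamma>
    using GF.tau[OF \<gamma>] by - (rule pb_eqI[of "isrc H" "G0 \<odot> (F0 \<odot> \<gamma>)"]; use \<gamma> in simp)
  then have "act_tau C D H (G0 \<odot> F0) (G1 \<odot> F1) = (\<lambda>\<gamma>\<in>Obj (slice C (iobj D)).
      act_tau C E H G0 G1 (F0 \<odot> \<gamma>) \<odot>\<^bsub>slice C (iobj H)\<^esub> ArrMap (postcomp C G0) (act_tau C D E F0 F1 \<gamma>))"
    unfolding GF.act_tau_eq G.act_tau_eq F.act_tau_eq by (intro restrict_ext) simp
  then show "ArrMap (T_Act C) (g \<odot>\<^bsub>Cat_int C\<^esub> f) = ArrMap (T_Act C) g \<odot>\<^bsub>ActMnd C\<^esub> ArrMap (T_Act C) f"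
    using F G GF by (simp add: T_Act_simps)
qed

lemma T_Mnd_eq: "T_Mnd C = comp_functor (Cat_int C) (ActMnd_forget C) (T_Act C)"
proof (rule cfunctor_eqI[where A = "Cat_int C"])
  fix D assume "D \<in> Obj (Cat_int C)"
  then interpret internal_cat C D by (intro internal_catI) simp
  show "ObjMap (T_Mnd C) D = ObjMap (comp_functor (Cat_int C) (ActMnd_forget C) (T_Act C)) D"
    using internal by (simp add: T_Mnd_def T_Act_simps ActMnd_forget_simps action_monad_act)
next
  fix f assume f: "f \<in> Arr (Cat_int C)"
  obtain D F0 F1 E where [simp]: "f = (D, F0, F1, E)" by (cases f)
  have F: "internal_functor C D E F0 F1" using f by simp
  then interpret F: internal_functor_between C D E F0 F1 by (rule internal_functor_betweenI)
  show "ArrMap (T_Mnd C) f = ArrMap (comp_functor (Cat_int C) (ActMnd_forget C) (T_Act C)) f"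
    using F F.act_tau_morphism by (simp add: T_Mnd_def T_Act_simps ActMnd_forget_simps forget_arr_def)
qed (simp_all add: T_Mnd_def)

end

section \<open>The functor is fully faithful\<close>

context internal_cat
begin

text \<open>
  The arrow \<open>g \<mapsto> (g, s g)\<close>. It is inverse to the first projection from the pullback of \<open>s\<close> along the
  identity, and so identifies the object of arrows with the value of the action monad at the
  terminal object of the slice.
\<close>

definition sec :: 'm where
  "sec = pb_pair C s (Ident C (iobj D)) (Ident C (iarr D)) s"

lemma sec [simp]:
  "sec \<in> Arr C" "Dom C sec = iarr D" "Cod C sec = pb C s (Ident C (iobj D))"
  "pr1 C s (Ident C (iobj D)) \<odot> sec = Ident C (iarr D)" "pr2 C s (Ident C (iobj D)) \<odot> sec = s"
  by (simp_all add: sec_def)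

lemma sec_precompose [simp]:
  assumes "x \<in> Arr C" "Cod C x = iarr D"
  shows "pr1 C s (Ident C (iobj D)) \<odot> (sec \<odot> x) = x" "pr2 C s (Ident C (iobj D)) \<odot> (sec \<odot> x) = s \<odot> x"
  using precompose[OF sec(4), of x] precompose[OF sec(5), of x] assms by simp_all

lemma sec_pr1:
  assumes "\<gamma> \<in> Arr C" "Cod C \<gamma> = iobj D"
  shows "sec \<odot> pr1 C s \<gamma> = ar \<gamma> (Ident C (iobj D))"
  by (rule pb_eqI[of s "Ident C (iobj D)"]; simp add: assms)

end

text \<open>
  A morphism between the action monads of two internal categories comes from an internal functor.
  Its arrow part \<open>F1\<close> is read off from the component at the identity of the object of objects.
\<close>

locale internal_action_morphism = D: internal_cat C D + E: internal_cat C E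
  for C :: "('o, 'm) cat" (structure) and D E +
  fixes h :: 'm and \<Lambda> :: "'m \<Rightarrow> 'm sarr"
  assumes morphism: "action_monad_morphism C (iobj D, act_monad C D, act_proj C D)
    (iobj E, act_monad C E, act_proj C E) h \<Lambda>"
begin

sublocale two_action_monads C "iobj D" "act_monad C D" "act_proj C D" "iobj E" "act_monad C E" "act_proj C E" h
  by unfold_locales (rule action_monad_morphismD(3)[OF morphism])

definition l :: "'m \<Rightarrow> 'm" where "l \<gamma> = und (\<Lambda> \<gamma>)"

context
  fixes \<gamma>
  assumes typed: "\<gamma> \<in> Arr C" "Cod C \<gamma> = iobj D"
begin

lemma l [simp]:
  "l \<gamma> \<in> Arr C" "Dom C (l \<gamma>) = pb C (isrc D) \<gamma>" "Cod C (l \<gamma>) = pb C (isrc E) (h \<odot> \<gamma>)"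
  "itgt E \<odot> (pr1 C (isrc E) (h \<odot> \<gamma>) \<odot> l \<gamma>) = h \<odot> (itgt D \<odot> pr1 C (isrc D) \<gamma>)"
  "pr2 C (isrc E) (h \<odot> \<gamma>) \<odot> l \<gamma> = pr2 C (isrc D) \<gamma>"
  using morphism_und[OF morphism typed] morphism_action[OF morphism typed] typed
  by (simp_all add: l_def)

lemma l_precompose [simp]:
  assumes "x \<in> Arr C" "Cod C x = pb C (isrc D) \<gamma>"
  shows "pr2 C (isrc E) (h \<odot> \<gamma>) \<odot> (l \<gamma> \<odot> x) = pr2 C (isrc D) \<gamma> \<odot> x"
    "itgt E \<odot> (pr1 C (isrc E) (h \<odot> \<gamma>) \<odot> (l \<gamma> \<odot> x)) = h \<odot> (itgt D \<odot> (pr1 C (isrc D) \<gamma> \<odot> x))"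
proof -
  show "pr2 C (isrc E) (h \<odot> \<gamma>) \<odot> (l \<gamma> \<odot> x) = pr2 C (isrc D) \<gamma> \<odot> x"
    using D.precompose[OF l(5), of x] assms typed by simp
  have "(itgt E \<odot> (pr1 C (isrc E) (h \<odot> \<gamma>) \<odot> l \<gamma>)) \<odot> x = (h \<odot> (itgt D \<odot> pr1 C (isrc D) \<gamma>)) \<odot> x"
    by (simp only: l(4))
  then show "itgt E \<odot> (pr1 C (isrc E) (h \<odot> \<gamma>) \<odot> (l \<gamma> \<odot> x)) = h \<odot> (itgt D \<odot> (pr1 C (isrc D) \<gamma> \<odot> x))"
    using assms typed by (simp del: l(4))
qed

end

definition F1 :: 'm where
  "F1 = pr1 C (isrc E) h \<odot> (l (Ident C (iobj D)) \<odot> D.sec)"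

lemma l_ident [simp]:
  "Cod C (l (Ident C (iobj D))) = pb C (isrc E) h"
  "pr2 C (isrc E) h \<odot> l (Ident C (iobj D)) = pr2 C (isrc D) (Ident C (iobj D))"
  "\<lbrakk>x \<in> Arr C; Cod C x = pb C (isrc D) (Ident C (iobj D))\<rbrakk> \<Longrightarrow>
    pr2 C (isrc E) h \<odot> (l (Ident C (iobj D)) \<odot> x) = pr2 C (isrc D) (Ident C (iobj D)) \<odot> x"
  "\<lbrakk>x \<in> Arr C; Cod C x = pb C (isrc D) (Ident C (iobj D))\<rbrakk> \<Longrightarrow>
    itgt E \<odot> (pr1 C (isrc E) h \<odot> (l (Ident C (iobj D)) \<odot> x)) =
      h \<odot> (itgt D \<odot> (pr1 C (isrc D) (Ident C (iobj D)) \<odot> x))"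
  "itgt E \<odot> (pr1 C (isrc E) h \<odot> l (Ident C (iobj D))) = h \<odot> (itgt D \<odot> pr1 C (isrc D) (Ident C (iobj D)))"
  using l(3,4,5)[of "Ident C (iobj D)"] l_precompose[of "Ident C (iobj D)" x] by simp_all

lemma F1 [simp]: "F1 \<in> Arr C" "Dom C F1 = iarr D" "Cod C F1 = iarr E"
  "isrc E \<odot> F1 = h \<odot> isrc D" "itgt E \<odot> F1 = h \<odot> itgt D"
  by (simp_all add: F1_def)

lemma F1_precompose [simp]:
  assumes "x \<in> Arr C" "Cod C x = iarr D"
  shows "isrc E \<odot> (F1 \<odot> x) = h \<odot> (isrc D \<odot> x)" "itgt E \<odot> (F1 \<odot> x) = h \<odot> (itgt D \<odot> x)"
  using D.precompose2[OF F1(4), of x] D.precompose2[OF F1(5), of x] assms by simp_all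

text \<open>
  Naturality at the unique slice arrow from \<open>\<gamma>\<close> to the identity determines the first component of
  \<open>l \<gamma>\<close>, while compatibility with the actions determines the second one. Hence \<open>l \<gamma>\<close> is
  \<open>(g, x) \<mapsto> (F1 g, x)\<close>.
\<close>

lemma pr1_l:
  assumes \<gamma>: "\<gamma> \<in> Arr C" "Cod C \<gamma> = iobj D"
  shows "pr1 C (isrc E) (h \<odot> \<gamma>) \<odot> l \<gamma> = F1 \<odot> pr1 C (isrc D) \<gamma>"
proof -
  have "l (Ident C (iobj D)) \<odot> D.ar \<gamma> (Ident C (iobj D)) = E.ar \<gamma> h \<odot> l \<gamma>"
    using morphism_natural[OF morphism, of "Ident C (iobj D)" \<gamma>] \<gamma> by (simp add: l_def)
  then have "F1 \<odot> pr1 C (isrc D) \<gamma> = pr1 C (isrc E) h \<odot> (E.ar \<gamma> h \<odot> l \<gamma>)"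
    using \<gamma> by (simp add: F1_def D.sec_pr1)
  then show ?thesis using \<gamma> by simp
qed

lemma pr1_l_precompose:
  assumes "\<gamma> \<in> Arr C" "Cod C \<gamma> = iobj D" "x \<in> Arr C" "Cod C x = pb C (isrc D) \<gamma>"
  shows "pr1 C (isrc E) (h \<odot> \<gamma>) \<odot> (l \<gamma> \<odot> x) = F1 \<odot> (pr1 C (isrc D) \<gamma> \<odot> x)"
  by (rule D.precompose2[OF pr1_l]) (use assms in simp_all)

lemma F1_i: "F1 \<odot> iid D = iid E \<odot> h"
proof -
  let ?I = "Ident C (iobj D)"
  have "l ?I \<odot> D.un ?I = E.un h"
    using morphism_unit[OF morphism, of ?I] by (simp add: l_def)
  then have "iid E \<odot> h = pr1 C (isrc E) (h \<odot> ?I) \<odot> (l ?I \<odot> D.un ?I)"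
    by simp
  also have "\<dots> = F1 \<odot> (pr1 C (isrc D) ?I \<odot> D.un ?I)"
    by (rule pr1_l_precompose) simp_all
  finally show ?thesis by simp
qed

text \<open>
  Compatibility with the multiplications at the identity, read in the first component, says that
  \<open>F1\<close> preserves the composite of \<open>g\<close> and \<open>f\<close> for the generic \<open>(g, (f, x))\<close>, where \<open>x\<close> must be the source
  of \<open>f\<close>. Precomposition with \<open>w\<close>, which is \<open>(g, f) \<mapsto> (g, (f, s f))\<close>, gives the claim.
\<close>

lemma F1_c: "F1 \<odot> icomp D =
    E.mul (F1 \<odot> pr1 C (isrc D) (itgt D)) (F1 \<odot> pr2 C (isrc D) (itgt D))"
proof -
  let ?I = "Ident C (iobj D)" and ?s = "isrc D" and ?t = "itgt D"
  let ?\<tau> = "?t \<odot> pr1 C ?s ?I"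
  let ?p = "pr1 C ?s ?\<tau>" and ?q = "pr2 C ?s ?\<tau>"
  have "l ?I \<odot> D.mu ?I = E.mu h \<odot> (E.ar (l ?I) (itgt E \<odot> pr1 C (isrc E) h) \<odot> l ?\<tau>)"
    using morphism_mult[OF morphism, of ?I] by (simp add: l_def[symmetric])
  then have "pr1 C (isrc E) (h \<odot> ?I) \<odot> (l ?I \<odot> D.mu ?I) =
      pr1 C (isrc E) h \<odot> (E.mu h \<odot> (E.ar (l ?I) (itgt E \<odot> pr1 C (isrc E) h) \<odot> l ?\<tau>))"
    by simp
  moreover have "pr1 C (isrc E) (h \<odot> ?I) \<odot> (l ?I \<odot> D.mu ?I) =
      F1 \<odot> D.mul ?p (pr1 C ?s ?I \<odot> ?q)"
    using pr1_l_precompose[of ?I "D.mu ?I"] by simp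
  moreover have "pr1 C (isrc E) (h \<odot> ?\<tau>) \<odot> l ?\<tau> = F1 \<odot> ?p"
    by (rule pr1_l) simp_all
  moreover have "pr1 C (isrc E) (h \<odot> ?I) \<odot> (l ?I \<odot> ?q) = F1 \<odot> (pr1 C ?s ?I \<odot> ?q)"
    by (rule pr1_l_precompose) simp_all
  moreover have "pr1 C (isrc E) h \<odot> (E.mu h \<odot> (E.ar (l ?I) (itgt E \<odot> pr1 C (isrc E) h) \<odot> l ?\<tau>)) =
      E.mul (pr1 C (isrc E) (h \<odot> ?\<tau>) \<odot> l ?\<tau>) (pr1 C (isrc E) (h \<odot> ?I) \<odot> (l ?I \<odot> ?q))"
    by simp
  ultimately have mult: "F1 \<odot> D.mul ?p (pr1 C ?s ?I \<odot> ?q) = E.mul (F1 \<odot> ?p) (F1 \<odot> (pr1 C ?s ?I \<odot> ?q))"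
    by (simp only:)
  define w where "w = pb_pair C ?s ?\<tau> (pr1 C ?s ?t) (D.sec \<odot> pr2 C ?s ?t)"
  have w: "w \<in> Arr C" "Dom C w = pb C ?s ?t" "Cod C w = pb C ?s ?\<tau>"
    "?p \<odot> w = pr1 C ?s ?t" "?q \<odot> w = D.sec \<odot> pr2 C ?s ?t"
    by (simp_all add: w_def)
  have "F1 \<odot> (D.mul ?p (pr1 C ?s ?I \<odot> ?q) \<odot> w) = E.mul (F1 \<odot> ?p) (F1 \<odot> (pr1 C ?s ?I \<odot> ?q)) \<odot> w"
    by (rule D.precompose[OF mult]) (simp_all add: w)
  then show ?thesis by (simp add: w D.mul_pr)
qed

lemma internal_functor_F1: "internal_functor C D E h F1"
  unfolding internal_functor_def
  using D.internal E.internal F1_c by (simp add: Hom_def F1_i E.mul_def)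

lemma act_tau_F1: "act_tau C D E h F1 = \<Lambda>"
proof -
  interpret F: internal_functor_between C D E h F1
    by (rule D.internal_functor_betweenI[OF internal_functor_F1])
  show ?thesis
  proof (rule extensionalityI[where A = "Obj (slice C (iobj D))"])
    show "act_tau C D E h F1 \<in> extensional (Obj (slice C (iobj D)))" by (simp add: F.act_tau_eq)
    show "\<Lambda> \<in> extensional (Obj (slice C (iobj D)))" by (rule morphism_ext[OF morphism])
    fix \<gamma> assume "\<gamma> \<in> Obj (slice C (iobj D))"
    then have \<gamma>: "\<gamma> \<in> Arr C" "Cod C \<gamma> = iobj D" by simp_all
    have "F.tau \<gamma> = l \<gamma>"
      by (rule D.pb_eqI[of "isrc E" "h \<odot> \<gamma>"]; simp add: \<gamma> pr1_l)
    then show "act_tau C D E h F1 \<gamma> = \<Lambda> \<gamma>"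
      unfolding F.act_tau_eq using \<gamma> by (simp add: morphism_eq[OF morphism \<gamma>, folded l_def])
  qed
qed

end

context category_with_pullbacks
begin

lemma T_Act_full:
  assumes "internal_category C D" "internal_category C E"
    "g \<in> Hom (ActMnd C) (ObjMap (T_Act C) D) (ObjMap (T_Act C) E)"
  shows "\<exists>f \<in> Hom (Cat_int C) D E. ArrMap (T_Act C) f = g"
proof -
  obtain h \<Lambda> where g: "g = ((iobj D, act_monad C D, act_proj C D), h, \<Lambda>, (iobj E, act_monad C E, act_proj C E))"
    using assms by (cases g) (simp add: Hom_def T_Act_simps)
  interpret D: internal_cat C D by (rule internal_catI) fact
  interpret E: internal_cat C E by (rule internal_catI) fact
  interpret internal_action_morphism C D E h \<Lambda>
    by unfold_locales (use assms g in \<open>simp add: Hom_def T_Act_simps\<close>)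
  have "(D, h, F1, E) \<in> Hom (Cat_int C) D E" "ArrMap (T_Act C) (D, h, F1, E) = g"
    using internal_functor_F1 act_tau_F1 by (simp_all add: Hom_def T_Act_simps g)
  then show ?thesis by blast
qed

text \<open>
  The arrow part of an internal functor is recovered from the component at the identity, because
  the first projection there has the section \<open>sec\<close>.
\<close>

lemma T_Act_faithful:
  assumes "f \<in> Arr (Cat_int C)" "g \<in> Arr (Cat_int C)" "Dom (Cat_int C) f = Dom (Cat_int C) g"
    "Cod (Cat_int C) f = Cod (Cat_int C) g" "ArrMap (T_Act C) f = ArrMap (T_Act C) g"
  shows "f = g"
proof -
  obtain D F0 F1 E where f: "f = (D, F0, F1, E)" by (cases f)
  obtain G0 G1 where g: "g = (D, G0, G1, E)" using assms(3,4) by (cases g) (simp add: f)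
  have F: "internal_functor C D E F0 F1" and G: "internal_functor C D E G0 G1"
    using assms(1,2) by (simp_all add: f g)
  note eqs = assms(5)[unfolded f g T_Act_simps(2)[OF F] T_Act_simps(2)[OF G]]
  have [simp]: "G0 = F0" using eqs by (elim Pair_inject) (rule sym)
  have eq: "act_tau C D E F0 F1 = act_tau C D E F0 G1" using eqs by simp
  interpret F: internal_functor_between C D E F0 F1 by (rule internal_functor_betweenI) fact
  interpret G: internal_functor_between C D E F0 G1 by (rule internal_functor_betweenI) (use G in simp)
  let ?I = "Ident C (iobj D)"
  have "F.tau ?I = G.tau ?I"
    using fun_cong[OF eq, of ?I] by (simp add: F.act_tau_eq G.act_tau_eq)
  then have pr1: "F1 \<odot> pr1 C (isrc D) ?I = G1 \<odot> pr1 C (isrc D) ?I"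
    using F.tau(4)[of ?I] G.tau(4)[of ?I] by simp
  have "F1 = F1 \<odot> pr1 C (isrc D) ?I \<odot> F.D.sec" by simp
  also have "\<dots> = G1 \<odot> pr1 C (isrc D) ?I \<odot> F.D.sec" by (simp only: pr1)
  also have "\<dots> = G1" by simp
  finally have "F1 = G1" .
  then show ?thesis by (simp add: f g)
qed

end

section \<open>Every action monad comes from an internal category\<close>

text \<open>
  The internal category of an action monad. Its object of arrows is the domain of \<open>t0 = T id\<close>, with
  target \<open>t0\<close>, source \<open>s0 = \<alpha> id\<close> and the unit at \<open>id\<close> as identities.
\<close>

locale action_monad_pb = category_with_pullbacks C + action_monad_on C a T \<alpha>
  for C :: "('o, 'm) cat" (structure) and a T \<alpha>
begin

abbreviation I where "I \<equiv> Ident C a"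
abbreviation t0 where "t0 \<equiv> Tob I"
abbreviation s0 where "s0 \<equiv> \<alpha> I"

text \<open>
  The value of \<open>T\<close> at the unique slice arrow from \<open>\<gamma>\<close> to the identity. Since \<open>\<alpha>\<close> is cartesian, \<open>q \<gamma>\<close>
  and \<open>\<alpha> \<gamma>\<close> exhibit the domain of \<open>T \<gamma>\<close> as a pullback of \<open>s0\<close> and \<open>\<gamma>\<close>. Equations between arrows into
  it are therefore checked after composing with \<open>q \<gamma>\<close> and \<open>\<alpha> \<gamma>\<close>.
\<close>

definition q :: "'m \<Rightarrow> 'm" where "q \<gamma> = Tar \<gamma> I"

lemma t0_typing [simp]: "t0 \<in> Arr C" "Cod C t0 = a" "s0 \<in> Arr C" "Dom C s0 = Dom C t0" "Cod C s0 = a"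
  by simp_all

context
  fixes \<gamma>
  assumes typed: "\<gamma> \<in> Arr C" "Cod C \<gamma> = a"
begin

lemma q [simp]: "q \<gamma> \<in> Arr C" "Dom C (q \<gamma>) = Dom C (Tob \<gamma>)" "Cod C (q \<gamma>) = Dom C t0"
  "t0 \<odot> q \<gamma> = Tob \<gamma>" "q \<gamma> \<odot> e \<gamma> = e I \<odot> \<gamma>"
  using typed Tar[of I \<gamma>] e_natural[of I \<gamma>] by (simp_all add: q_def del: Tar)

lemma q_m: "q \<gamma> \<odot> m \<gamma> = m I \<odot> Tar (q \<gamma>) t0"
  using typed m_natural[of I \<gamma>] by (simp add: q_def)

lemma q_pullback: "is_pullback C s0 \<gamma> (q \<gamma>) (\<alpha> \<gamma>)"
  using typed \<alpha>_pullback[of I \<gamma>] by (simp add: q_def)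

lemma s0_q [simp]: "s0 \<odot> q \<gamma> = \<gamma> \<odot> \<alpha> \<gamma>"
  using is_pullbackD(6)[OF q_pullback] .

lemma T_eqI:
  assumes "u \<in> Arr C" "v \<in> Arr C" "Cod C u = Dom C (Tob \<gamma>)" "Cod C v = Dom C (Tob \<gamma>)" "Dom C u = Dom C v"
    "q \<gamma> \<odot> u = q \<gamma> \<odot> v" "\<alpha> \<gamma> \<odot> u = \<alpha> \<gamma> \<odot> v"
  shows "u = v"
proof -
  have "s0 \<odot> (q \<gamma> \<odot> u) = \<gamma> \<odot> (\<alpha> \<gamma> \<odot> u)"
    by (rule precompose2[OF s0_q]) (use assms typed in simp_all)
  then have "\<exists>!w. w \<in> Hom C (Dom C (\<alpha> \<gamma> \<odot> u)) (Dom C (q \<gamma>)) \<and> q \<gamma> \<odot> w = q \<gamma> \<odot> u \<and> \<alpha> \<gamma> \<odot> w = \<alpha> \<gamma> \<odot> u"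
    by (intro is_pullbackD(7)[OF q_pullback]) (simp_all add: assms(1-5) typed)
  moreover have "u \<in> Hom C (Dom C (\<alpha> \<gamma> \<odot> u)) (Dom C (q \<gamma>))" "v \<in> Hom C (Dom C (\<alpha> \<gamma> \<odot> u)) (Dom C (q \<gamma>))"
    using assms(1-5) typed by (simp_all add: Hom_def)
  ultimately show ?thesis using assms(6,7) by metis
qed

text \<open>
  The comparison between the chosen pullback of \<open>s0\<close> and \<open>\<gamma>\<close> and the domain of \<open>T \<gamma>\<close>, and its inverse
  \<open>\<psi>\<close>.
\<close>

definition \<phi> :: 'm where
  "\<phi> = (THE u. u \<in> Hom C (pb C s0 \<gamma>) (Dom C (Tob \<gamma>)) \<and> q \<gamma> \<odot> u = pr1 C s0 \<gamma> \<and> \<alpha> \<gamma> \<odot> u = pr2 C s0 \<gamma>)"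

definition \<psi> :: 'm where
  "\<psi> = pb_pair C s0 \<gamma> (q \<gamma>) (\<alpha> \<gamma>)"

lemma \<phi> [simp]: "\<phi> \<in> Arr C" "Dom C \<phi> = pb C s0 \<gamma>" "Cod C \<phi> = Dom C (Tob \<gamma>)"
  "q \<gamma> \<odot> \<phi> = pr1 C s0 \<gamma>" "\<alpha> \<gamma> \<odot> \<phi> = pr2 C s0 \<gamma>"
proof -
  have "\<exists>!u. u \<in> Hom C (Dom C (pr2 C s0 \<gamma>)) (Dom C (q \<gamma>)) \<and> q \<gamma> \<odot> u = pr1 C s0 \<gamma> \<and> \<alpha> \<gamma> \<odot> u = pr2 C s0 \<gamma>"
    by (rule is_pullbackD(7)[OF q_pullback]) (simp_all add: typed)
  then have "\<exists>!u. u \<in> Hom C (pb C s0 \<gamma>) (Dom C (Tob \<gamma>)) \<and> q \<gamma> \<odot> u = pr1 C s0 \<gamma> \<and> \<alpha> \<gamma> \<odot> u = pr2 C s0 \<gamma>"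
    by (simp add: typed)
  from theI'[OF this, folded \<phi>_def]
  show "\<phi> \<in> Arr C" "Dom C \<phi> = pb C s0 \<gamma>" "Cod C \<phi> = Dom C (Tob \<gamma>)"
    "q \<gamma> \<odot> \<phi> = pr1 C s0 \<gamma>" "\<alpha> \<gamma> \<odot> \<phi> = pr2 C s0 \<gamma>" by (simp_all add: Hom_def)
qed

lemma \<psi> [simp]: "\<psi> \<in> Arr C" "Dom C \<psi> = Dom C (Tob \<gamma>)" "Cod C \<psi> = pb C s0 \<gamma>"
  "pr1 C s0 \<gamma> \<odot> \<psi> = q \<gamma>" "pr2 C s0 \<gamma> \<odot> \<psi> = \<alpha> \<gamma>"
  using typed by (simp_all add: \<psi>_def)

end

context
  fixes \<gamma>
  assumes typed: "\<gamma> \<in> Arr C" "Cod C \<gamma> = a"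
begin

lemma \<phi>_precompose [simp]:
  assumes "x \<in> Arr C" "Cod C x = pb C s0 \<gamma>"
  shows "q \<gamma> \<odot> (\<phi> \<gamma> \<odot> x) = pr1 C s0 \<gamma> \<odot> x" "\<alpha> \<gamma> \<odot> (\<phi> \<gamma> \<odot> x) = pr2 C s0 \<gamma> \<odot> x"
  using precompose[OF \<phi>(4), of \<gamma> x] precompose[OF \<phi>(5), of \<gamma> x] assms typed by simp_all

lemma \<psi>_precompose [simp]:
  assumes "x \<in> Arr C" "Cod C x = Dom C (Tob \<gamma>)"
  shows "pr1 C s0 \<gamma> \<odot> (\<psi> \<gamma> \<odot> x) = q \<gamma> \<odot> x" "pr2 C s0 \<gamma> \<odot> (\<psi> \<gamma> \<odot> x) = \<alpha> \<gamma> \<odot> x"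
  using precompose[OF \<psi>(4), of \<gamma> x] precompose[OF \<psi>(5), of \<gamma> x] assms typed by simp_all

lemma \<phi>_\<psi>: "\<phi> \<gamma> \<odot> \<psi> \<gamma> = Ident C (Dom C (Tob \<gamma>))"
  by (rule T_eqI[OF typed]; simp add: typed)

lemma \<psi>_\<phi>: "\<psi> \<gamma> \<odot> \<phi> \<gamma> = Ident C (pb C s0 \<gamma>)"
  by (rule pb_eqI[of s0 \<gamma>]; simp add: typed)

lemma Tob_\<phi> [simp]: "Tob \<gamma> \<odot> \<phi> \<gamma> = t0 \<odot> pr1 C s0 \<gamma>"
proof -
  have "t0 \<odot> (q \<gamma> \<odot> \<phi> \<gamma>) = Tob \<gamma> \<odot> \<phi> \<gamma>"
    by (rule precompose[OF q(4)]) (simp_all add: typed)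
  then show ?thesis using typed by simp
qed

lemma t0_q_precompose [simp]:
  "\<lbrakk>x \<in> Arr C; Cod C x = Dom C (Tob \<gamma>)\<rbrakk> \<Longrightarrow> t0 \<odot> (q \<gamma> \<odot> x) = Tob \<gamma> \<odot> x"
  by (rule precompose[OF q(4)]) (simp_all add: typed)

end

context
  fixes f \<delta>
  assumes typed: "\<delta> \<in> Arr C" "Cod C \<delta> = a" "f \<in> Arr C" "Cod C f = Dom C \<delta>"
begin

lemma q_Tar [simp]: "q \<delta> \<odot> Tar f \<delta> = q (\<delta> \<odot> f)"
  using Tar_comp[of I \<delta> f] typed by (simp add: q_def)

lemma q_Tar_precompose [simp]:
  "\<lbrakk>x \<in> Arr C; Cod C x = Dom C (Tob (\<delta> \<odot> f))\<rbrakk> \<Longrightarrow> q \<delta> \<odot> (Tar f \<delta> \<odot> x) = q (\<delta> \<odot> f) \<odot> x"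
  by (rule precompose[OF q_Tar]) (simp_all add: typed)

lemma \<alpha>_Tar_precompose [simp]:
  "\<lbrakk>x \<in> Arr C; Cod C x = Dom C (Tob (\<delta> \<odot> f))\<rbrakk> \<Longrightarrow> \<alpha> \<delta> \<odot> (Tar f \<delta> \<odot> x) = f \<odot> (\<alpha> (\<delta> \<odot> f) \<odot> x)"
  by (rule precompose2[OF \<alpha>_natural]) (simp_all add: typed)

end

lemmas [simp] = \<alpha>_natural \<alpha>_e

lemma e_precompose [simp]:
  assumes "\<gamma> \<in> Arr C" "Cod C \<gamma> = a" "x \<in> Arr C" "Cod C x = Dom C \<gamma>"
  shows "\<alpha> \<gamma> \<odot> (e \<gamma> \<odot> x) = x" "Tob \<gamma> \<odot> (e \<gamma> \<odot> x) = \<gamma> \<odot> x"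
  using precompose[OF \<alpha>_e, of \<gamma> x] precompose[OF e(4), of \<gamma> x] assms by simp_all

lemma q_I [simp]: "q I = Ident C (Dom C t0)"
  by (simp add: q_def)

text \<open>
  The composition: the domain of \<open>T t0\<close> is the object of composable pairs, and the multiplication
  at the identity maps it to the domain of \<open>t0\<close>.
\<close>

definition c0 :: 'm where "c0 = m I \<odot> \<phi> t0"

lemma c0 [simp]: "c0 \<in> Arr C" "Dom C c0 = pb C s0 t0" "Cod C c0 = Dom C t0"
  by (simp_all add: c0_def)

lemma c0_comp:
  "\<lbrakk>x \<in> Arr C; Cod C x = pb C s0 t0\<rbrakk> \<Longrightarrow> c0 \<odot> x = m I \<odot> (\<phi> t0 \<odot> x)"
  by (simp add: c0_def)

lemma t0_c0 [simp]: "t0 \<odot> c0 = t0 \<odot> pr1 C s0 t0"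
  and s0_c0 [simp]: "s0 \<odot> c0 = s0 \<odot> pr2 C s0 t0"
proof -
  have "t0 \<odot> (m I \<odot> \<phi> t0) = Tob t0 \<odot> \<phi> t0"
    by (rule precompose[OF m(4)]) simp_all
  then show "t0 \<odot> c0 = t0 \<odot> pr1 C s0 t0" by (simp add: c0_def)
  have "s0 \<odot> (m I \<odot> \<phi> t0) = s0 \<odot> (\<alpha> t0 \<odot> \<phi> t0)"
    by (rule precompose2[OF \<alpha>_m]) simp_all
  then show "s0 \<odot> c0 = s0 \<odot> pr2 C s0 t0" by (simp add: c0_def)
qed

lemma c0_precompose [simp]:
  assumes "x \<in> Arr C" "Cod C x = pb C s0 t0"
  shows "t0 \<odot> (c0 \<odot> x) = t0 \<odot> (pr1 C s0 t0 \<odot> x)" "s0 \<odot> (c0 \<odot> x) = s0 \<odot> (pr2 C s0 t0 \<odot> x)"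
  using precompose2[OF t0_c0, of x] precompose2[OF s0_c0, of x] assms by simp_all

lemma q_m_c0:
  assumes \<gamma>: "\<gamma> \<in> Arr C" "Cod C \<gamma> = a"
  shows "q \<gamma> \<odot> m \<gamma> = c0 \<odot> pb_pair C s0 t0 (q (Tob \<gamma>)) (q \<gamma> \<odot> \<alpha> (Tob \<gamma>))"
proof -
  have "\<phi> t0 \<odot> pb_pair C s0 t0 (q (Tob \<gamma>)) (q \<gamma> \<odot> \<alpha> (Tob \<gamma>)) = Tar (q \<gamma>) t0"
    by (rule T_eqI[of t0]; simp add: \<gamma>)
  then show ?thesis by (simp add: q_m \<gamma> c0_def)
qed

text \<open>
  The multiplication of \<open>T\<close> at \<open>\<gamma>\<close>, with its source replaced by an iterated pullback. The next
  lemmas identify it with \<open>(g, (f, x)) \<mapsto> (g f, x)\<close>, which is what makes \<open>\<phi>\<close> compatible with the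
  multiplications.
\<close>

definition M :: "'m \<Rightarrow> 'm" where
  "M \<gamma> = m \<gamma> \<odot> (Tar (\<phi> \<gamma>) (Tob \<gamma>) \<odot> \<phi> (t0 \<odot> pr1 C s0 \<gamma>))"

context
  fixes \<gamma>
  assumes \<gamma>: "\<gamma> \<in> Arr C" "Cod C \<gamma> = a"
begin

lemma M [simp]:
  "M \<gamma> \<in> Arr C" "Dom C (M \<gamma>) = pb C s0 (t0 \<odot> pr1 C s0 \<gamma>)" "Cod C (M \<gamma>) = Dom C (Tob \<gamma>)"
  using \<gamma> by (simp_all add: M_def)

lemma \<alpha>_M [simp]: "\<alpha> \<gamma> \<odot> M \<gamma> = pr2 C s0 \<gamma> \<odot> pr2 C s0 (t0 \<odot> pr1 C s0 \<gamma>)"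
proof -
  let ?x = "Tar (\<phi> \<gamma>) (Tob \<gamma>) \<odot> \<phi> (t0 \<odot> pr1 C s0 \<gamma>)"
  have "\<alpha> \<gamma> \<odot> (m \<gamma> \<odot> ?x) = \<alpha> \<gamma> \<odot> (\<alpha> (Tob \<gamma>) \<odot> ?x)"
    by (rule precompose2[OF \<alpha>_m]) (simp_all add: \<gamma>)
  then show ?thesis using \<gamma> by (simp add: M_def)
qed

lemma q_M [simp]: "q \<gamma> \<odot> M \<gamma> =
    c0 \<odot> pb_pair C s0 t0 (pr1 C s0 (t0 \<odot> pr1 C s0 \<gamma>)) (pr1 C s0 \<gamma> \<odot> pr2 C s0 (t0 \<odot> pr1 C s0 \<gamma>))"
proof -
  let ?x = "Tar (\<phi> \<gamma>) (Tob \<gamma>) \<odot> \<phi> (t0 \<odot> pr1 C s0 \<gamma>)"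
  let ?k = "pb_pair C s0 t0 (q (Tob \<gamma>)) (q \<gamma> \<odot> \<alpha> (Tob \<gamma>))"
  have "q \<gamma> \<odot> (m \<gamma> \<odot> ?x) = c0 \<odot> (?k \<odot> ?x)"
    by (rule precompose2[OF q_m_c0]) (simp_all add: \<gamma>)
  also have "?k \<odot> ?x = pb_pair C s0 t0 (pr1 C s0 (t0 \<odot> pr1 C s0 \<gamma>)) (pr1 C s0 \<gamma> \<odot> pr2 C s0 (t0 \<odot> pr1 C s0 \<gamma>))"
    by (rule pb_eqI[of s0 t0]; simp add: \<gamma>)
  finally show ?thesis by (simp add: M_def)
qed

end

definition D :: "('o, 'm) icat" where
  "D = \<lparr>iobj = a, iarr = Dom C t0, isrc = s0, itgt = t0, iid = e I, icomp = c0\<rparr>"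

lemma D_simps: "iobj D = a" "iarr D = Dom C t0" "isrc D = s0" "itgt D = t0" "iid D = e I" "icomp D = c0"
  by (simp_all add: D_def)

text \<open>
  The unit and associativity axioms are the monad laws at the identity. The associativity law compares
  \<open>m I\<close> after \<open>T (m I)\<close> with \<open>m I\<close> after \<open>m t0\<close>; restricted along the comparison arrows, the former is
  \<open>(h, (g, f)) \<mapsto> h (g f)\<close> and the latter, which is \<open>m I \<odot> M t0\<close>, is \<open>(h, (g, f)) \<mapsto> (h g) f\<close>.
\<close>

lemma internal_category_D: "internal_category C D"
proof -
  let ?p = "pr1 C s0 (t0 \<odot> pr1 C s0 t0)" and ?r = "pr2 C s0 (t0 \<odot> pr1 C s0 t0)"
  have ident_left: "c0 \<odot> pb_pair C s0 t0 (e I \<odot> t0) (Ident C (Dom C t0)) = Ident C (Dom C t0)"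
  proof -
    have "\<phi> t0 \<odot> pb_pair C s0 t0 (e I \<odot> t0) (Ident C (Dom C t0)) = e t0"
      by (rule T_eqI[of t0]; simp)
    then show ?thesis using m_e[of I] by (simp add: c0_def)
  qed
  have ident_right: "c0 \<odot> pb_pair C s0 t0 (Ident C (Dom C t0)) (e I \<odot> s0) = Ident C (Dom C t0)"
  proof -
    have "\<phi> t0 \<odot> pb_pair C s0 t0 (Ident C (Dom C t0)) (e I \<odot> s0) = Tar (e I) t0"
      by (rule T_eqI[of t0]; simp)
    then show ?thesis using m_Tar_e[of I] by (simp add: c0_def)
  qed
  have "c0 \<odot> pb_pair C s0 t0 ?p (c0 \<odot> ?r) = m I \<odot> (Tar c0 t0 \<odot> \<phi> (t0 \<odot> pr1 C s0 t0))"
  proof -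
    have "\<phi> t0 \<odot> pb_pair C s0 t0 ?p (c0 \<odot> ?r) = Tar c0 t0 \<odot> \<phi> (t0 \<odot> pr1 C s0 t0)"
      by (rule T_eqI[of t0]; simp)
    then show ?thesis using c0_comp[of "pb_pair C s0 t0 ?p (c0 \<odot> ?r)"] by simp
  qed
  also have "\<dots> = m I \<odot> M t0"
  proof -
    have "Tar c0 t0 = Tar (m I) t0 \<odot> Tar (\<phi> t0) (Tob t0)"
      unfolding c0_def using Tar_comp[of t0 "m I" "\<phi> t0"] by simp
    moreover have "m I \<odot> (Tar (m I) t0 \<odot> x) = m I \<odot> (m t0 \<odot> x)"
      if "x \<in> Arr C" "Cod C x = Dom C (Tob (Tob t0))" for x
      by (rule precompose2[OF m_m]) (simp_all add: that)
    ultimately show ?thesis by (simp add: M_def)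
  qed
  also have "\<dots> = c0 \<odot> pb_pair C s0 t0 (c0 \<odot> pb_pair C s0 t0 ?p (pr1 C s0 t0 \<odot> ?r)) (pr2 C s0 t0 \<odot> ?r)"
  proof -
    have "\<phi> t0 \<odot> pb_pair C s0 t0 (c0 \<odot> pb_pair C s0 t0 ?p (pr1 C s0 t0 \<odot> ?r)) (pr2 C s0 t0 \<odot> ?r) = M t0"
      by (rule T_eqI[of t0]; simp)
    then show ?thesis
      using c0_comp[of "pb_pair C s0 t0 (c0 \<odot> pb_pair C s0 t0 ?p (pr1 C s0 t0 \<odot> ?r)) (pr2 C s0 t0 \<odot> ?r)"]
      by simp
  qed
  finally show ?thesis
    unfolding internal_category_def Let_def D_simps
    using ident_left ident_right by (simp add: Hom_def)
qed

sublocale D: internal_cat C D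
  rewrites "iobj D = a" and "iarr D = Dom C t0" and "isrc D = s0" and "itgt D = t0"
    and "iid D = e I" and "icomp D = c0"
  by (unfold_locales, rule internal_category_D) (simp_all only: D_simps)

(* Here this rule reads Dom C t0 = Dom C t0, on which rewriting does not terminate. *)
declare D.typing(7) [simp del]

definition \<Phi> :: "'m \<Rightarrow> 'm sarr" where
  "\<Phi> = (\<lambda>\<gamma>\<in>Obj (slice C a). (t0 \<odot> pr1 C s0 \<gamma>, \<phi> \<gamma>, Tob \<gamma>))"

definition \<Psi> :: "'m \<Rightarrow> 'm sarr" where
  "\<Psi> = (\<lambda>\<gamma>\<in>Obj (slice C a). (Tob \<gamma>, \<psi> \<gamma>, t0 \<odot> pr1 C s0 \<gamma>))"

lemma \<Phi>_morphism: "action_monad_morphism C (a, act_monad C D, act_proj C D) (a, T, \<alpha>) I \<Phi>"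
proof -
  interpret two_action_monads C a "act_monad C D" "act_proj C D" a T \<alpha> I
    by (rule two_action_monadsI[OF D.action_monad_act action_monad]) (simp add: Hom_def)
  show ?thesis
  proof (rule morphismI[where l = \<phi>], goal_cases)
    case 1 show ?case unfolding \<Phi>_def by (rule restrict_ext, simp)
  next
    case 2 then show ?case by simp
  next
    case (3 \<delta> f) show ?case by (rule T_eqI[of "\<delta>"]; use 3 in simp)
  next
    case (4 \<gamma>) show ?case by (rule T_eqI[of "\<gamma>"]; use 4 in simp)
  next
    case (5 \<gamma>)
    have "\<phi> \<gamma> \<odot> D.mu \<gamma> = M \<gamma>"
      by (rule T_eqI[of "\<gamma>"]; use 5 in \<open>simp add: D.mul_def D_simps\<close>)
    then show ?case using 5 by (simp add: M_def)
  next
    case 6 then show ?case by simp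
  qed
qed

lemma \<Psi>_morphism: "action_monad_morphism C (a, T, \<alpha>) (a, act_monad C D, act_proj C D) I \<Psi>"
proof -
  interpret two_action_monads C a T \<alpha> a "act_monad C D" "act_proj C D" I
    by (rule two_action_monadsI[OF action_monad D.action_monad_act]) (simp add: Hom_def)
  show ?thesis
  proof (rule morphismI[where l = \<psi>], goal_cases)
    case 1 show ?case unfolding \<Psi>_def by (rule restrict_ext, simp)
  next
    case 2 then show ?case by simp
  next
    case (3 \<delta> f) show ?case by (rule pb_eqI[of s0 "\<delta>"]; use 3 in simp)
  next
    case (4 \<gamma>) show ?case by (rule pb_eqI[of s0 "\<gamma>"]; use 4 in simp)
  next
    case (5 \<gamma>)
    have "\<psi> \<gamma> \<odot> m \<gamma> = D.mu \<gamma> \<odot> (D.ar (\<psi> \<gamma>) (t0 \<odot> pr1 C s0 \<gamma>) \<odot> \<psi> (Tob \<gamma>))"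
      by (rule pb_eqI[of s0 "\<gamma>"]; use 5 in \<open>simp add: D.mul_def D_simps q_m_c0 \<alpha>_m\<close>)
    then show ?case using 5 by simp
  next
    case 6 then show ?case by simp
  qed
qed

text \<open>
  The components \<open>\<phi> \<gamma>\<close> and \<open>\<psi> \<gamma>\<close> are mutually inverse, and both families are morphisms of action monads
  over the identity of \<open>a\<close>.
\<close>

lemma act_monad_iso:
  "\<exists>f \<in> Hom (ActMnd C) (ObjMap (T_Act C) D) (a, T, \<alpha>). is_iso (ActMnd C) f"
proof -
  let ?X = "(a, act_monad C D, act_proj C D)" and ?Y = "(a, T, \<alpha>)"
  have T_D: "ObjMap (T_Act C) D = ?X"
    using internal_category_D by (simp add: T_Act_simps D_simps)
  have \<Psi>\<Phi>: "(?Y, I, \<Psi>, ?X) \<odot>\<^bsub>ActMnd C\<^esub> (?X, I, \<Phi>, ?Y) = Ident (ActMnd C) ?X"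
  proof -
    have "(\<lambda>\<gamma>\<in>Obj (slice C a). \<Psi> (I \<odot> \<gamma>) \<odot>\<^bsub>slice C a\<^esub> ArrMap (postcomp C I) (\<Phi> \<gamma>)) =
        (\<lambda>\<gamma>\<in>Obj (slice C a). Ident (slice C a) (ObjMap (mfun (act_monad C D)) \<gamma>))"
      by (rule restrict_ext) (simp add: \<Phi>_def \<Psi>_def \<psi>_\<phi>)
    then show ?thesis by simp
  qed
  have \<Phi>\<Psi>: "(?X, I, \<Phi>, ?Y) \<odot>\<^bsub>ActMnd C\<^esub> (?Y, I, \<Psi>, ?X) = Ident (ActMnd C) ?Y"
  proof -
    have "(\<lambda>\<gamma>\<in>Obj (slice C a). \<Phi> (I \<odot> \<gamma>) \<odot>\<^bsub>slice C a\<^esub> ArrMap (postcomp C I) (\<Psi> \<gamma>)) =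
        (\<lambda>\<gamma>\<in>Obj (slice C a). Ident (slice C a) (Tob \<gamma>))"
      by (rule restrict_ext) (simp add: \<Phi>_def \<Psi>_def \<phi>_\<psi>)
    then show ?thesis by simp
  qed
  have \<Phi>: "(?X, I, \<Phi>, ?Y) \<in> Hom (ActMnd C) ?X ?Y" and \<Psi>: "(?Y, I, \<Psi>, ?X) \<in> Hom (ActMnd C) ?Y ?X"
    using \<Phi>_morphism \<Psi>_morphism by (simp_all add: Hom_def)
  show ?thesis unfolding T_D by (rule bexI[where x = "(?X, I, \<Phi>, ?Y)"]) (rule is_isoI[OF \<Phi> \<Psi> \<Psi>\<Phi> \<Phi>\<Psi>], rule \<Phi>)
qed

end

lemma (in category_with_pullbacks) T_Act_ess_surj:
  assumes "X \<in> Obj (ActMnd C)"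
  shows "\<exists>D \<in> Obj (Cat_int C). \<exists>f \<in> Hom (ActMnd C) (ObjMap (T_Act C) D) X. is_iso (ActMnd C) f"
proof -
  obtain a T \<alpha> where X: "X = (a, T, \<alpha>)" by (cases X)
  interpret action_monad_pb C a T \<alpha>
    by unfold_locales (use assms X in simp)
  show ?thesis unfolding X using act_monad_iso internal_category_D Cat_int_simps(1) by blast
qed

section \<open>The equivalence\<close>

theorem theorem5p11:
  fixes C :: "('o, 'm) cat"
  assumes "category C" and "has_finite_limits C"
  shows "is_functor (Cat_int C) Mnd_co_adj (T_Mnd C) \<and>
         faithful_functor (ActMnd C) Mnd_co_adj (ActMnd_forget C) \<and>
         is_functor (Cat_int C) (ActMnd C) (T_Act C) \<and>
         T_Mnd C = comp_functor (Cat_int C) (ActMnd_forget C) (T_Act C) \<and>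
         (\<exists>\<Psi>. equivalence_of_cats (Cat_int C) (ActMnd C) (T_Act C) \<Psi>)"
proof -
  interpret category_with_pullbacks C by (rule category_with_pullbacksI) fact+
  have "is_functor (Cat_int C) Mnd_co_adj (T_Mnd C)"
    unfolding T_Mnd_eq
    by (rule is_functor_comp[OF is_functor_T_Act])
      (use faithful_ActMnd_forget in \<open>simp add: faithful_functor_def\<close>)
  moreover have "\<exists>\<Psi>. equivalence_of_cats (Cat_int C) (ActMnd C) (T_Act C) \<Psi>"
    by (rule equivalence_if_fully_faithful_ess_surj[OF is_functor_T_Act T_Act_faithful _ T_Act_ess_surj])
      (simp_all add: T_Act_full)
  ultimately show ?thesis
    using faithful_ActMnd_forget is_functor_T_Act T_Mnd_eq by blast
qed

end
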